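(* Let $M_z=(M_{z_1},\dots,M_{z_d})$ be the tuple of left shifts on the nc Drury–Arveson space $\mathcal H_d^2$, and let $\mathcal S$ be a non-trivial closed subspace of $\mathcal H^2_d$. Then $\mathcal S$ is jointly $M_z$-invariant (i.e. $M_{z_i}\mathcal S\subseteq\mathcal S$ for all $i$) if and only if there exist a Hilbert space $\mathcal E$ and a partial isometric right multiplier $\Psi\in\mathrm{Mult}_R(H_{\mathcal E}(\mathcal K),\mathcal H_d^2)$ (i.e. $M^R_\Psi$ is a partial isometry) such that $$\mathcal S=\Psi H_{\mathcal E}(\mathcal K),$$ that is, $\mathcal S$ is the range of $M^R_\Psi$.
   Context: Hilbert spaces are complex; $d\in\mathbb N$ is fixed. $\mathbb M^d=\bigsqcup_{n\ge1}M_n(\mathbb C)^d$ and $\mathfrak B_d=\{X=(X_1,\dots,X_d)\in\mathbb M^d:\|\sum_jX_jX_j^*\|<1\}$, with $\mathfrak B_d(n)=\mathfrak B_d\cap M_n(\mathbb C)^d$. $\mathbb W_d$ is the free monoid on $\{1,\dots,d\}$ (words, with concatenation $\alpha\cdot\beta$); for $\alpha=\alpha_1\cdots\alpha_p$, $Z^\alpha=Z_{\alpha_1}\cdots Z_{\alpha_p}$, and $Z^\emptyset=I$. An nc function on $\mathfrak B_d$ with values in a vector space $\mathcal V$ is a map $f:\mathfrak B_d\to\bigsqcup_nM_n(\mathcal V)$ that is graded ($f(X)\in M_n(\mathcal V)$ for $X\in\mathfrak B_d(n)$), respects direct sums ($f(X\oplus Y)=f(X)\oplus f(Y)$) and similarities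 ($f(S^{-1}XS)=S^{-1}f(X)S$ for $X\in\mathfrak B_d(n)$, $S\in M_n(\mathbb C)$ invertible with $S^{-1}XS\in\mathfrak B_d(n)$). $M_n(\mathcal B(\mathcal E,\mathcal F))$ is identified with $\mathcal B(\mathbb C^n\otimes\mathcal E,\mathbb C^n\otimes\mathcal F)$. The $\mathcal E$-valued nc Drury–Arveson space $H_{\mathcal E}(\mathcal K)$ is the Hilbert space of nc functions $f(Z)=\sum_{\alpha\in\mathbb W_d}Z^\alpha\otimes f_\alpha$, $f_\alpha\in\mathcal E$, $\sum\|f_\alpha\|^2<\infty$, on $\mathfrak B_d$, where $f(Z):\mathbb C^n\to\mathbb C^n\otimes\mathcal E$, $f(Z)v=\sum_\alpha Z^\alpha v\otimes f_\alpha$ for $Z\in\mathfrak B_d(n)$, with $\langle f,g\rangle=\sum_\alpha\langle f_\alpha,g_\alpha\rangle$. (It is the nc reproducing kernel Hilbert space of $\mathcal K\otimes I_{\mathcal E}$, $\mathcal K(Z,W)(P)=\sum_\alpha Z^\alpha P(W^\alpha)^*$.) $\mathcal H_d^2=H_{\mathbb C}(\mathcal K)$. Left shifts: $(M_{z_i}f)(Z)=Z_if(Z)=\sum_\alpha Z^{i\cdot\alpha}f_\alpha$. A right multiplier $\Psi\in\mathrm{Mult}_R(H_{\mathcal E}(\mathcal K),H_{\mathcal F}(\mathcal K))$ is an nc function on $\mathfrak B_d$ with values in $\mathcal B(\mathcal E,\mathcal F)$, $\Psi(Z)=\sum_\alpha Z^\alpha\otimes\psi_\alpha$ with $\psi_\alpha\in\mathcal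 B(\mathcal E,\mathcal F)$ (summed over homogeneous components, converging pointwise on vectors), such that for every $f=\sum_\beta Z^\beta\otimes f_\beta\in H_{\mathcal E}(\mathcal K)$ the right product $(M_\Psi^Rf)(Z)=\Psi(Z)\bullet_Rf(Z):=\sum_{\alpha,\beta}Z^{\beta\cdot\alpha}\otimes\psi_\alpha f_\beta$ belongs to $H_{\mathcal F}(\mathcal K)$. $M^R_\Psi$ is then a bounded operator. Here $\mathcal F=\mathbb C$. *)

theory Defs
  imports "HOL-Analysis.Analysis" "HOL-Library.Function_Algebras"
    "Jordan_Normal_Form.Schur_Decomposition"
begin

section \<open>Complex Hilbert spaces\<close>

text \<open>
  Hilbert spaces occur under an existential quantifier, so they are values rather than types: a
  carrier, which is a linear subspace of a complex vector space, with an inner product that is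
  linear in the first argument. Nothing is required of the inner product off the carrier.
\<close>

record 'v hspace =
  hcarrier :: "'v set"
  hscale :: "complex \<Rightarrow> 'v \<Rightarrow> 'v"
  hinner :: "'v \<Rightarrow> 'v \<Rightarrow> complex"

definition hnorm :: "'v hspace \<Rightarrow> 'v \<Rightarrow> real" where
  "hnorm E x = sqrt (Re (hinner E x x))"

locale hilbert_space = vector_space "hscale E" for E :: "'v::ab_group_add hspace" +
  assumes subspace_carrier: "subspace (hcarrier E)"
    and inner_add_left: "\<lbrakk>x \<in> hcarrier E; y \<in> hcarrier E; z \<in> hcarrier E\<rbrakk>
          \<Longrightarrow> hinner E (x + y) z = hinner E x z + hinner E y z"
    and inner_scale_left: "\<lbrakk>x \<in> hcarrier E; y \<in> hcarrier E\<rbrakk>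
          \<Longrightarrow> hinner E (hscale E a x) y = a * hinner E x y"
    and inner_cnj: "\<lbrakk>x \<in> hcarrier E; y \<in> hcarrier E\<rbrakk>
          \<Longrightarrow> hinner E x y = cnj (hinner E y x)"
    and inner_pos: "\<lbrakk>x \<in> hcarrier E; x \<noteq> 0\<rbrakk> \<Longrightarrow> 0 < Re (hinner E x x)"
    and complete: "\<lbrakk>\<And>k. u k \<in> hcarrier E;
          \<And>e. 0 < e \<Longrightarrow> \<exists>N::nat. \<forall>k\<ge>N. \<forall>l\<ge>N. hnorm E (u k - u l) < e\<rbrakk>
          \<Longrightarrow> \<exists>x\<in>hcarrier E. (\<lambda>k. hnorm E (u k - x)) \<longlonglongrightarrow> 0"

definition complex_hspace :: "complex hspace" where
  "complex_hspace = \<lparr>hcarrier = UNIV, hscale = (*), hinner = (\<lambda>x y. x * cnj y)\<rparr>"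

definition closed_subspace :: "'v::ab_group_add hspace \<Rightarrow> 'v set \<Rightarrow> bool" where
  "closed_subspace H S \<longleftrightarrow> S \<subseteq> hcarrier H \<and> Modules.module.subspace (hscale H) S \<and>
     (\<forall>u x. (\<forall>k::nat. u k \<in> S) \<and> x \<in> hcarrier H \<and> (\<lambda>k. hnorm H (u k - x)) \<longlonglongrightarrow> 0
        \<longrightarrow> x \<in> S)"

text \<open>
  Bounded operators are represented by functions that vanish off the carrier of the domain, so
  that equality of operators is equality of functions.
\<close>

definition bounded_ops ::
  "'v::ab_group_add hspace \<Rightarrow> 'w::ab_group_add hspace \<Rightarrow> ('v \<Rightarrow> 'w) set" where
  "bounded_ops E F = {T.
     (\<forall>x. x \<notin> hcarrier E \<longrightarrow> T x = 0) \<and>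
     (\<forall>x\<in>hcarrier E. T x \<in> hcarrier F) \<and>
     (\<forall>x\<in>hcarrier E. \<forall>y\<in>hcarrier E. T (x + y) = T x + T y) \<and>
     (\<forall>a. \<forall>x\<in>hcarrier E. T (hscale E a x) = hscale F a (T x)) \<and>
     (\<exists>K. \<forall>x\<in>hcarrier E. hnorm F (T x) \<le> K * hnorm E x)}"

definition op_scale :: "'w hspace \<Rightarrow> complex \<Rightarrow> ('v \<Rightarrow> 'w) \<Rightarrow> 'v \<Rightarrow> 'w" where
  "op_scale F a T = (\<lambda>x. hscale F a (T x))"

definition partial_isometry ::
  "'v::ab_group_add hspace \<Rightarrow> 'w::ab_group_add hspace \<Rightarrow> ('v \<Rightarrow> 'w) \<Rightarrow> bool" where
  "partial_isometry E F T \<longleftrightarrow> T \<in> bounded_ops E F \<and>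
     (\<forall>x\<in>hcarrier E. (\<forall>k\<in>hcarrier E. T k = 0 \<longrightarrow> hinner E x k = 0)
        \<longrightarrow> hnorm F (T x) = hnorm E x)"


section \<open>Noncommutative functions on the row ball\<close>

text \<open>
  The number of variables is the cardinality of the finite index type \<open>'d\<close>, and words are lists
  over \<open>'d\<close>. Points are tuples of complex matrices. An \<open>n \<times> n\<close> matrix over a
  vector space \<open>V\<close> is a function of two indices that vanishes unless both are below \<open>n\<close>;
  the size \<open>n\<close> of a value \<open>f X\<close> is that of the point \<open>X\<close>. In this way nc functions
  themselves form a vector space under the pointwise operations.
\<close>

type_synonym ('d, 'v) nc_fun = "('d \<Rightarrow> complex mat) \<Rightarrow> nat \<Rightarrow> nat \<Rightarrow> 'v"

definition vec_l2norm :: "complex vec \<Rightarrow> real" where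
  "vec_l2norm v = sqrt (\<Sum>i<dim_vec v. (cmod (vec_index v i))\<^sup>2)"

definition mat_opnorm :: "complex mat \<Rightarrow> real" where
  "mat_opnorm A = (SUP v\<in>{v \<in> carrier_vec (dim_col A). vec_l2norm v \<le> 1}.
                     vec_l2norm (A *\<^sub>v v))"

definition nc_ball :: "nat \<Rightarrow> ('d::finite \<Rightarrow> complex mat) set" where
  "nc_ball n = {X. 1 \<le> n \<and> (\<forall>j. X j \<in> carrier_mat n n) \<and>
     mat_opnorm (mat n n (\<lambda>ij. \<Sum>j\<in>UNIV. (X j * mat_adjoint (X j)) $$ ij)) < 1}"

definition nmat :: "nat \<Rightarrow> 'v::zero set \<Rightarrow> (nat \<Rightarrow> nat \<Rightarrow> 'v) set" where
  "nmat n V = {A. (\<forall>i<n. \<forall>j<n. A i j \<in> V) \<and> (\<forall>i j. \<not> (i < n \<and> j < n) \<longrightarrow> A i j = 0)}"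

definition nmat_sum :: "nat \<Rightarrow> (nat \<Rightarrow> nat \<Rightarrow> 'v::zero) \<Rightarrow> (nat \<Rightarrow> nat \<Rightarrow> 'v) \<Rightarrow> nat \<Rightarrow> nat \<Rightarrow> 'v" where
  "nmat_sum n A B = (\<lambda>i j. if i < n \<and> j < n then A i j
                           else if n \<le> i \<and> n \<le> j then B (i - n) (j - n) else 0)"

definition lmult ::
  "(complex \<Rightarrow> 'v \<Rightarrow> 'v) \<Rightarrow> complex mat \<Rightarrow> (nat \<Rightarrow> nat \<Rightarrow> 'v::ab_group_add) \<Rightarrow> nat \<Rightarrow> nat \<Rightarrow> 'v" where
  "lmult s S A = (\<lambda>i j. if i < dim_row S then \<Sum>k<dim_col S. s (S $$ (i, k)) (A k j) else 0)"

definition rmult ::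
  "(complex \<Rightarrow> 'v \<Rightarrow> 'v) \<Rightarrow> (nat \<Rightarrow> nat \<Rightarrow> 'v::ab_group_add) \<Rightarrow> complex mat \<Rightarrow> nat \<Rightarrow> nat \<Rightarrow> 'v" where
  "rmult s A S = (\<lambda>i j. if j < dim_col S then \<Sum>k<dim_row S. s (S $$ (k, j)) (A i k) else 0)"

text \<open>Functions on the ball are extended by zero to all tuples of matrices.\<close>

definition nc_function ::
  "(complex \<Rightarrow> 'v \<Rightarrow> 'v) \<Rightarrow> 'v set \<Rightarrow> ('d::finite, 'v::ab_group_add) nc_fun \<Rightarrow> bool" where
  "nc_function s V f \<longleftrightarrow>
     (\<forall>X. X \<notin> (\<Union>n. nc_ball n) \<longrightarrow> f X = 0) \<and>
     (\<forall>n. \<forall>X\<in>nc_ball n. f X \<in> nmat n V) \<and>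
     (\<forall>n m. \<forall>X\<in>nc_ball n. \<forall>Y\<in>nc_ball m.
        f (\<lambda>j. four_block_mat (X j) (0\<^sub>m n m) (0\<^sub>m m n) (Y j)) = nmat_sum n (f X) (f Y)) \<and>
     (\<forall>n. \<forall>X\<in>nc_ball n. \<forall>S\<in>carrier_mat n n. \<forall>S'\<in>carrier_mat n n.
        S * S' = 1\<^sub>m n \<and> S' * S = 1\<^sub>m n \<and> (\<lambda>j. S' * X j * S) \<in> nc_ball n
        \<longrightarrow> f (\<lambda>j. S' * X j * S) = rmult s (lmult s S' (f X)) S)"

primrec word_mat :: "nat \<Rightarrow> ('d \<Rightarrow> complex mat) \<Rightarrow> 'd list \<Rightarrow> complex mat" where
  "word_mat n Z [] = 1\<^sub>m n"
| "word_mat n Z (i # \<alpha>) = Z i * word_mat n Z \<alpha>"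


section \<open>The nc Drury--Arveson space\<close>

text \<open>
  \<open>nc_series E c f\<close>: \<open>c\<close> is a square summable family in \<open>E\<close>, and
  \<open>f Z = (\<Sum>\<alpha>. Z\<^sup>\<alpha> \<otimes> c \<alpha>)\<close> on the ball. For such \<open>c\<close> the series
  converges absolutely, so the sum over all words is taken as an unordered sum, in every matrix
  entry. An operator from \<open>\<complex>\<^sup>n\<close> to \<open>\<complex>\<^sup>n \<otimes> E\<close> is given by an
  \<open>n \<times> n\<close> matrix over \<open>E\<close>.
\<close>

definition nc_series ::
  "'e::ab_group_add hspace \<Rightarrow> ('d::finite list \<Rightarrow> 'e) \<Rightarrow> ('d, 'e) nc_fun \<Rightarrow> bool" where
  "nc_series E c f \<longleftrightarrow>
     (\<forall>\<alpha>. c \<alpha> \<in> hcarrier E) \<and> (\<lambda>\<alpha>. (hnorm E (c \<alpha>))\<^sup>2) summable_on UNIV \<and>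
     (\<forall>n. \<forall>Z\<in>nc_ball n. \<forall>i<n. \<forall>j<n.
        ((\<lambda>A. hnorm E ((\<Sum>\<alpha>\<in>A. hscale E (word_mat n Z \<alpha> $$ (i, j)) (c \<alpha>)) - f Z i j)) \<longlongrightarrow> 0)
          (finite_subsets_at_top UNIV))"

definition nc_coeff ::
  "'e::ab_group_add hspace \<Rightarrow> ('d::finite, 'e) nc_fun \<Rightarrow> 'd list \<Rightarrow> 'e" where
  "nc_coeff E f = (THE c. nc_series E c f)"

definition drury_arveson ::
  "'e::ab_group_add hspace \<Rightarrow> ('d::finite, 'e) nc_fun hspace" where
  "drury_arveson E =
     \<lparr>hcarrier = {f. nc_function (hscale E) (hcarrier E) f \<and> (\<exists>c. nc_series E c f)},
      hscale = (\<lambda>a f Z i j. hscale E a (f Z i j)),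
      hinner = (\<lambda>f g. \<Sum>\<^sub>\<infinity>\<alpha>. hinner E (nc_coeff E f \<alpha>) (nc_coeff E g \<alpha>))\<rparr>"

abbreviation H2d :: "('d::finite, complex) nc_fun hspace" where
  "H2d \<equiv> drury_arveson complex_hspace"

definition left_shift :: "'d \<Rightarrow> ('d, complex) nc_fun \<Rightarrow> ('d, complex) nc_fun" where
  "left_shift i f = (\<lambda>Z. lmult (*) (Z i) (f Z))"


section \<open>Right multipliers\<close>

text \<open>
  \<open>{\<alpha>. length \<alpha> \<le> N}\<close> indexes the sum of the homogeneous components of degree at most
  \<open>N\<close>. The convergence is pointwise on vectors, in every matrix entry.
\<close>

definition multiplier_series ::
  "'e::ab_group_add hspace \<Rightarrow> 'f::ab_group_add hspace \<Rightarrow> ('d::finite list \<Rightarrow> 'e \<Rightarrow> 'f)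
     \<Rightarrow> ('d, 'e \<Rightarrow> 'f) nc_fun \<Rightarrow> bool" where
  "multiplier_series E F \<psi> \<Psi> \<longleftrightarrow>
     (\<forall>\<alpha>. \<psi> \<alpha> \<in> bounded_ops E F) \<and>
     (\<forall>n. \<forall>Z\<in>nc_ball n. \<forall>i<n. \<forall>j<n. \<forall>e\<in>hcarrier E.
        (\<lambda>N. hnorm F ((\<Sum>\<alpha> | length \<alpha> \<le> N. hscale F (word_mat n Z \<alpha> $$ (i, j)) (\<psi> \<alpha> e))
                        - \<Psi> Z i j e)) \<longlonglongrightarrow> 0)"

definition multiplier_coeff ::
  "'e::ab_group_add hspace \<Rightarrow> 'f::ab_group_add hspace \<Rightarrow> ('d::finite, 'e \<Rightarrow> 'f) nc_fun
     \<Rightarrow> 'd list \<Rightarrow> 'e \<Rightarrow> 'f" where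
  "multiplier_coeff E F \<Psi> = (THE \<psi>. multiplier_series E F \<psi> \<Psi>)"

text \<open>The coefficient of \<open>Z\<^sup>\<gamma>\<close> in \<open>\<Sum>\<^bsub>\<alpha>,\<beta>\<^esub> Z\<^bsup>\<beta>\<alpha>\<^esup> \<otimes> \<psi>\<^sub>\<alpha> c\<^sub>\<beta>\<close>.\<close>

definition right_product_coeff ::
  "('d list \<Rightarrow> 'e \<Rightarrow> 'f::ab_group_add) \<Rightarrow> ('d list \<Rightarrow> 'e) \<Rightarrow> 'd list \<Rightarrow> 'f" where
  "right_product_coeff \<psi> c \<gamma> = (\<Sum>(\<beta>, \<alpha>) \<in> {(\<beta>, \<alpha>). \<beta> @ \<alpha> = \<gamma>}. \<psi> \<alpha> (c \<beta>))"

definition is_right_product ::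
  "'e::ab_group_add hspace \<Rightarrow> 'f::ab_group_add hspace \<Rightarrow> ('d::finite, 'e \<Rightarrow> 'f) nc_fun
     \<Rightarrow> ('d, 'e) nc_fun \<Rightarrow> ('d, 'f) nc_fun \<Rightarrow> bool" where
  "is_right_product E F \<Psi> f g \<longleftrightarrow> g \<in> hcarrier (drury_arveson F) \<and>
     nc_series F (right_product_coeff (multiplier_coeff E F \<Psi>) (nc_coeff E f)) g"

definition MultR ::
  "'e::ab_group_add hspace \<Rightarrow> 'f::ab_group_add hspace \<Rightarrow> ('d::finite, 'e \<Rightarrow> 'f) nc_fun set" where
  "MultR E F = {\<Psi>. nc_function (op_scale F) (bounded_ops E F) \<Psi> \<and>
     (\<exists>\<psi>. multiplier_series E F \<psi> \<Psi>) \<and>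
     (\<forall>f\<in>hcarrier (drury_arveson E). \<exists>g. is_right_product E F \<Psi> f g)}"

definition right_mult_op ::
  "'e::ab_group_add hspace \<Rightarrow> 'f::ab_group_add hspace \<Rightarrow> ('d::finite, 'e \<Rightarrow> 'f) nc_fun
     \<Rightarrow> ('d, 'e) nc_fun \<Rightarrow> ('d, 'f) nc_fun" where
  "right_mult_op E F \<Psi> f =
     (if f \<in> hcarrier (drury_arveson E) then THE g. is_right_product E F \<Psi> f g else 0)"

text \<open>
  A quantifier inside a formula cannot range over types, so the underlying vector space of
  \<open>E\<close> has to be fixed wherever \<open>\<exists>E\<close> is written. The type \<open>('d, complex) nc_fun\<close> of
  \<open>H2d\<close> itself contains an isometric copy of every Hilbert space of cardinality at most
  that of this type, in particular every closed subspace of \<open>H2d\<close>. For Hilbert spaces over an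
  arbitrary type \<open>'e\<close> the corresponding implication is stated with \<open>\<forall>E\<close>.
\<close>

definition is_partial_isometric_range ::
  "'e::ab_group_add hspace \<Rightarrow> ('d::finite, 'e \<Rightarrow> complex) nc_fun \<Rightarrow> ('d, complex) nc_fun set
     \<Rightarrow> bool" where
  "is_partial_isometric_range E \<Psi> S \<longleftrightarrow>
     \<Psi> \<in> MultR E complex_hspace \<and>
     partial_isometry (drury_arveson E) H2d (right_mult_op E complex_hspace \<Psi>) \<and>
     S = right_mult_op E complex_hspace \<Psi> ` hcarrier (drury_arveson E)"

lemma hilbert_space_complex: "hilbert_space complex_hspace"
proof -
  have n: "hnorm complex_hspace x = cmod x" for x
    by (simp add: hnorm_def complex_hspace_def cmod_def power2_eq_square)
  show ?thesis
  proof (unfold_locales)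
    have v: "Modules.module (hscale complex_hspace)"
      by (unfold_locales) (auto simp: complex_hspace_def algebra_simps)
    then show "Modules.module.subspace (hscale complex_hspace) (hcarrier complex_hspace)"
      by (simp add: Modules.module.subspace_def complex_hspace_def)
  next
    fix x assume "x \<in> hcarrier complex_hspace" "x \<noteq> 0"
    then show "0 < Re (hinner complex_hspace x x)"
      by (simp add: complex_hspace_def complex_eq_iff flip: power2_eq_square)
        (metis not_sum_power2_lt_zero sum_power2_gt_zero_iff)
  next
    fix u :: "nat \<Rightarrow> complex"
    assume "\<And>e. 0 < e \<Longrightarrow> \<exists>N. \<forall>k\<ge>N. \<forall>l\<ge>N. hnorm complex_hspace (u k - u l) < e"
    then have "Cauchy u"
      by (simp add: n Cauchy_def dist_norm)
    then obtain x where "u \<longlonglongrightarrow> x"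
      using Cauchy_convergent convergent_def by blast
    then show "\<exists>x\<in>hcarrier complex_hspace. (\<lambda>k. hnorm complex_hspace (u k - x)) \<longlonglongrightarrow> 0"
      unfolding n by (intro bexI[of _ x]) (auto simp: complex_hspace_def tendsto_norm_zero LIM_zero)
  qed (auto simp: complex_hspace_def algebra_simps)
qed

end

theory Submission
  imports Defs
begin

text \<open>
  On coefficient families, \<open>S\<close> is a closed subspace of \<open>\<ell>\<^sup>2\<close> of the words and the left shifts are
  isometries \<open>L\<^sub>i\<close> with pairwise orthogonal ranges. For an invariant \<open>S\<close> let \<open>W\<close> be the orthogonal
  complement of \<open>\<Sum>\<^sub>i L\<^sub>i S\<close> in \<open>S\<close>. Splitting \<open>s = w + \<Sum>\<^sub>i L\<^sub>i s\<^sub>i\<close> with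
  \<open>w \<in> W\<close>, \<open>s\<^sub>i \<in> S\<close> and iterating gives \<open>s = \<Sum>\<^sub>\<beta> L\<^sub>\<beta> w\<^sub>\<beta>\<close>; there is no remainder because
  the \<open>N\<close>-th one only has coefficients of length at least \<open>N\<close>. Take \<open>E = W\<close> and let \<open>\<psi>\<^sub>\<alpha>\<close> be
  the \<open>\<alpha>\<close>-th coefficient functional on \<open>W\<close>, so that \<open>\<Psi> Z\<close> is point evaluation at \<open>Z\<close> and
  the multiplier sends \<open>(w\<^sub>\<beta>)\<close> to \<open>\<Sum>\<^sub>\<beta> L\<^sub>\<beta> w\<^sub>\<beta>\<close>: it is even isometric. Conversely, right
  multiplication commutes with the left shift of the coefficients.
\<close>

section \<open>Geometry of Hilbert spaces\<close>

text \<open>Coefficients of functions and of multipliers enter the definitions through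
  \<open>THE\<close>, so everything rests on values determining coefficients. Nilpotent points
  provide this: there a single matrix entry of the series is a multiple of a single coefficient. In
  the other direction, the strict row contraction makes the entries of all word products at a point
  square summable, so every square summable family defines a function. Hence \<open>synth\<close>
  and \<open>nc_coeff\<close> are mutually inverse, and \<open>H2d\<close> inherits completeness
  from \<open>ell2\<close>. Completeness is needed to project onto \<open>S\<close>: the component
  of \<open>s\<close> along the \<open>i\<close>-th shift is the projection onto \<open>S\<close> of
  the adjoint shift of \<open>s\<close>. The splitting is thus explicit, and the sum of the shifted
  copies of \<open>S\<close> need not be shown closed. A coefficient of the expansion at a word
  involves only the prefixes of that word, so recovering \<open>s\<close> from its components is a
  finite identity. Convergence matters for the opposite inclusion, from square summable families
  into \<open>S\<close>: finitely supported families are handled by induction, the others by a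
  contractive bound on tails and the closedness of \<open>S\<close>.\<close>

context hilbert_space
begin

lemma zero_mem [simp]: "0 \<in> hcarrier E"
  using subspace_carrier by (simp add: subspace_def)

lemma add_mem [simp]: "x \<in> hcarrier E \<Longrightarrow> y \<in> hcarrier E \<Longrightarrow> x + y \<in> hcarrier E"
  using subspace_carrier by (simp add: subspace_def)

lemma scale_mem [simp]: "x \<in> hcarrier E \<Longrightarrow> hscale E a x \<in> hcarrier E"
  using subspace_carrier by (simp add: subspace_def)

lemma minus_mem [simp]: "x \<in> hcarrier E \<Longrightarrow> - x \<in> hcarrier E"
  using subspace_carrier subspace_neg by blast

lemma diff_mem [simp]: "x \<in> hcarrier E \<Longrightarrow> y \<in> hcarrier E \<Longrightarrow> x - y \<in> hcarrier E"
  using subspace_carrier subspace_diff by blast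

lemma sum_mem: "(\<And>i. i \<in> A \<Longrightarrow> f i \<in> hcarrier E) \<Longrightarrow> sum f A \<in> hcarrier E"
  using subspace_carrier subspace_sum by blast

lemma scale_minus_one: "hscale E (- 1) x = - x"
  by (metis scale_minus_left scale_one)

lemma inner_minus_left: "x \<in> hcarrier E \<Longrightarrow> y \<in> hcarrier E \<Longrightarrow> hinner E (- x) y = - hinner E x y"
  using inner_scale_left[of x y "- 1"] by (simp add: scale_minus_one)

lemma inner_diff_left:
  "\<lbrakk>x \<in> hcarrier E; y \<in> hcarrier E; z \<in> hcarrier E\<rbrakk>
    \<Longrightarrow> hinner E (x - y) z = hinner E x z - hinner E y z"
  using inner_add_left[of x "- y" z] by (simp add: inner_minus_left)

lemma inner_add_right:
  "\<lbrakk>x \<in> hcarrier E; y \<in> hcarrier E; z \<in> hcarrier E\<rbrakk>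
    \<Longrightarrow> hinner E z (x + y) = hinner E z x + hinner E z y"
  by (metis inner_cnj add_mem inner_add_left complex_cnj_add)

lemma inner_diff_right:
  "\<lbrakk>x \<in> hcarrier E; y \<in> hcarrier E; z \<in> hcarrier E\<rbrakk>
    \<Longrightarrow> hinner E z (x - y) = hinner E z x - hinner E z y"
  by (metis inner_cnj diff_mem inner_diff_left complex_cnj_diff)

lemma inner_scale_right:
  "\<lbrakk>x \<in> hcarrier E; y \<in> hcarrier E\<rbrakk> \<Longrightarrow> hinner E x (hscale E a y) = cnj a * hinner E x y"
  by (metis inner_cnj scale_mem inner_scale_left complex_cnj_mult)

lemma inner_zero_left [simp]: "y \<in> hcarrier E \<Longrightarrow> hinner E 0 y = 0"
  using inner_diff_left[of 0 0 y] by simp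

lemma inner_zero_right [simp]: "y \<in> hcarrier E \<Longrightarrow> hinner E y 0 = 0"
  using inner_diff_right[of 0 0 y] by simp

lemma inner_sum_left:
  "\<lbrakk>\<And>i. i \<in> A \<Longrightarrow> f i \<in> hcarrier E; y \<in> hcarrier E\<rbrakk>
    \<Longrightarrow> hinner E (sum f A) y = (\<Sum>i\<in>A. hinner E (f i) y)"
  by (induction A rule: infinite_finite_induct) (simp_all add: inner_add_left sum_mem)

lemma inner_self_nonneg [simp]: "x \<in> hcarrier E \<Longrightarrow> 0 \<le> Re (hinner E x x)"
  using inner_pos[of x] by (cases "x = 0") (auto simp: less_imp_le)

lemma hnorm_nonneg [simp]: "x \<in> hcarrier E \<Longrightarrow> 0 \<le> hnorm E x"
  by (simp add: hnorm_def)

lemma hnorm_power2: "x \<in> hcarrier E \<Longrightarrow> (hnorm E x)\<^sup>2 = Re (hinner E x x)"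
  by (simp add: hnorm_def)

lemma inner_self: "x \<in> hcarrier E \<Longrightarrow> hinner E x x = complex_of_real ((hnorm E x)\<^sup>2)"
  using inner_cnj[of x x] by (auto simp: hnorm_power2 complex_eq_iff)

lemma hnorm_zero [simp]: "hnorm E 0 = 0"
  by (simp add: hnorm_def)

lemma hnorm_eq_0: "x \<in> hcarrier E \<Longrightarrow> hnorm E x = 0 \<longleftrightarrow> x = 0"
  using inner_pos[of x] by (cases "x = 0") (auto simp: hnorm_def)

lemma hnorm_scale: "x \<in> hcarrier E \<Longrightarrow> hnorm E (hscale E a x) = cmod a * hnorm E x"
proof -
  assume x: "x \<in> hcarrier E"
  have "hinner E (hscale E a x) (hscale E a x) = (a * cnj a) * hinner E x x"
    using x by (simp add: inner_scale_left inner_scale_right)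
  also have "\<dots> = complex_of_real ((cmod a * hnorm E x)\<^sup>2)"
    using x by (simp add: inner_self complex_norm_square[symmetric] power_mult_distrib)
  finally show ?thesis
    using x by (simp add: hnorm_def[of E "hscale E a x"] del: of_real_power of_real_mult)
qed

lemma hnorm_minus: "x \<in> hcarrier E \<Longrightarrow> hnorm E (- x) = hnorm E x"
  using hnorm_scale[of x "- 1"] by (simp add: scale_minus_one)

lemma hnorm_minus_commute:
  "x \<in> hcarrier E \<Longrightarrow> y \<in> hcarrier E \<Longrightarrow> hnorm E (x - y) = hnorm E (y - x)"
  using hnorm_minus[of "x - y"] by simp

lemma hnorm_add_power2:
  assumes "x \<in> hcarrier E" "y \<in> hcarrier E"
  shows "(hnorm E (x + y))\<^sup>2 = (hnorm E x)\<^sup>2 + 2 * Re (hinner E x y) + (hnorm E y)\<^sup>2"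
proof -
  have "Re (hinner E y x) = Re (hinner E x y)"
    by (metis assms inner_cnj complex_cnj_cancel_iff cnj.simps(1))
  then show ?thesis
    using assms by (simp add: hnorm_power2 inner_add_left inner_add_right)
qed

lemma hnorm_diff_power2:
  assumes "x \<in> hcarrier E" "y \<in> hcarrier E"
  shows "(hnorm E (x - y))\<^sup>2 = (hnorm E x)\<^sup>2 - 2 * Re (hinner E x y) + (hnorm E y)\<^sup>2"
  using hnorm_add_power2[of x "- y"] assms
  by (simp add: hnorm_minus inner_scale_right[of x y "- 1", simplified scale_minus_one])

text \<open>Pythagoras for the component of \<open>x\<close> along \<open>y\<close>. Nonnegativity
  of the left side gives Cauchy-Schwarz; the strict decrease when the inner product is nonzero gives
  the variational step of the projection theorem.\<close>

lemma hnorm_diff_component: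
  assumes x: "x \<in> hcarrier E" and y: "y \<in> hcarrier E" "y \<noteq> 0"
  shows "(hnorm E (x - hscale E (hinner E x y / of_real ((hnorm E y)\<^sup>2)) y))\<^sup>2
    = (hnorm E x)\<^sup>2 - (cmod (hinner E x y))\<^sup>2 / (hnorm E y)\<^sup>2"
proof -
  define N where "N = (hnorm E y)\<^sup>2"
  define c where "c = hinner E x y"
  have N: "N > 0"
    using inner_pos[of y] y by (simp add: N_def hnorm_power2)
  have "hinner E x (hscale E (c / of_real N) y) = complex_of_real ((cmod c)\<^sup>2 / N)"
    using x y by (simp add: inner_scale_right c_def[symmetric] complex_norm_square[unfolded
        of_real_power] mult.commute)
  then have 1: "Re (hinner E x (hscale E (c / of_real N) y)) = (cmod c)\<^sup>2 / N"
    by (simp only: Re_complex_of_real)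
  have "(hnorm E (hscale E (c / of_real N) y))\<^sup>2 = (cmod c / N)\<^sup>2 * N"
    using N y unfolding N_def by (simp add: hnorm_scale power_mult_distrib power_divide
        norm_divide norm_power)
  also have "\<dots> = (cmod c)\<^sup>2 / N"
    using N by (simp add: power2_eq_square)
  finally show ?thesis
    using 1 x y unfolding N_def[symmetric] c_def[symmetric] by (simp add: hnorm_diff_power2)
qed

lemma hnorm_cauchy_schwarz:
  assumes x: "x \<in> hcarrier E" and y: "y \<in> hcarrier E"
  shows "cmod (hinner E x y) \<le> hnorm E x * hnorm E y"
proof (cases "y = 0")
  case True
  then show ?thesis using x by simp
next
  case False
  have "(cmod (hinner E x y))\<^sup>2 / (hnorm E y)\<^sup>2 \<le> (hnorm E x)\<^sup>2"
    using hnorm_diff_component[OF x y False] by (metis diff_ge_0_iff_ge zero_le_power2)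
  moreover have "hnorm E y > 0"
    using False y hnorm_eq_0[of y] hnorm_nonneg[of y] by linarith
  ultimately have "(cmod (hinner E x y))\<^sup>2 \<le> (hnorm E x * hnorm E y)\<^sup>2"
    by (simp add: divide_le_eq power_mult_distrib)
  then show ?thesis
    using x y by (auto intro!: power2_le_imp_le)
qed

lemma hnorm_triangle:
  assumes x: "x \<in> hcarrier E" and y: "y \<in> hcarrier E"
  shows "hnorm E (x + y) \<le> hnorm E x + hnorm E y"
proof -
  have "Re (hinner E x y) \<le> hnorm E x * hnorm E y"
    using hnorm_cauchy_schwarz[OF x y] complex_Re_le_cmod order_trans by blast
  then have "(hnorm E (x + y))\<^sup>2 \<le> (hnorm E x + hnorm E y)\<^sup>2"
    using x y by (simp add: hnorm_add_power2 power2_sum)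
  then show ?thesis
    using x y by (auto intro!: power2_le_imp_le)
qed

lemma hnorm_triangle_diff:
  assumes "x \<in> hcarrier E" "y \<in> hcarrier E" "z \<in> hcarrier E"
  shows "hnorm E (x - z) \<le> hnorm E (x - y) + hnorm E (y - z)"
  using hnorm_triangle[of "x - y" "y - z"] assms by simp

lemma hnorm_sum:
  assumes "\<And>i. i \<in> A \<Longrightarrow> f i \<in> hcarrier E"
  shows "hnorm E (sum f A) \<le> (\<Sum>i\<in>A. hnorm E (f i))"
  using assms
proof (induction A rule: infinite_finite_induct)
  case (insert i A)
  then show ?case
    using hnorm_triangle[of "f i" "sum f A"] by (fastforce simp: sum_mem)
qed auto

text \<open>An arbitrary filter is allowed because unordered sums converge along
  \<open>finite_subsets_at_top\<close>.\<close>

lemma hnorm_lim_unique: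
  assumes "F \<noteq> bot" and u: "\<And>k. u k \<in> hcarrier E" and x: "x \<in> hcarrier E" and y: "y \<in> hcarrier E"
    and lim: "((\<lambda>k. hnorm E (u k - x)) \<longlongrightarrow> 0) F" "((\<lambda>k. hnorm E (u k - y)) \<longlongrightarrow> 0) F"
  shows "x = y"
proof -
  have "((\<lambda>k. hnorm E (u k - x) + hnorm E (u k - y)) \<longlongrightarrow> 0 + 0) F"
    by (intro tendsto_add lim)
  moreover have "hnorm E (x - y) \<le> hnorm E (u k - x) + hnorm E (u k - y)" for k
    using hnorm_triangle_diff[of x "u k" y] hnorm_minus_commute[of x "u k"] u x y by simp
  ultimately have "hnorm E (x - y) \<le> 0 + 0"
    by (intro tendsto_lowerbound[OF _ _ \<open>F \<noteq> bot\<close>]) auto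
  then show ?thesis
    using hnorm_eq_0[of "x - y"] hnorm_nonneg[of "x - y"] x y by (simp add: order_antisym)
qed

lemma hnorm_lim:
  assumes u: "\<And>k. u k \<in> hcarrier E" and x: "x \<in> hcarrier E"
    and lim: "((\<lambda>k. hnorm E (u k - x)) \<longlongrightarrow> 0) F"
  shows "((\<lambda>k. hnorm E (u k)) \<longlongrightarrow> hnorm E x) F"
proof (rule Lim_transform_bound[of "\<lambda>k. hnorm E (u k) - hnorm E x", THEN LIM_zero_cancel, OF _ lim])
  have "\<bar>hnorm E (u k) - hnorm E x\<bar> \<le> hnorm E (u k - x)" for k
    using hnorm_triangle[of "u k - x" x] hnorm_triangle[of "x - u k" "u k"]
      hnorm_minus_commute[of x "u k"] u x by simp
  then show "\<forall>\<^sub>F k in F. norm (hnorm E (u k) - hnorm E x) \<le> norm (hnorm E (u k - x))"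
    using u x by simp
qed

text \<open>Norm and operations do not change with the carrier, so a Cauchy sequence in
  \<open>S\<close> has a limit in \<open>E\<close>, which closedness puts into \<open>S\<close>.
  This is what allows the wandering subspace to serve as coefficient space.\<close>

lemma closed_subspace_complete:
  assumes S: "closed_subspace E S"
  shows "hilbert_space (E\<lparr>hcarrier := S\<rparr>)"
proof -
  have sub: "S \<subseteq> hcarrier E" "subspace S"
    and cl: "\<And>u x. \<lbrakk>\<And>k::nat. u k \<in> S; x \<in> hcarrier E; (\<lambda>k. hnorm E (u k - x)) \<longlonglongrightarrow> 0\<rbrakk> \<Longrightarrow> x \<in> S"
    using S by (auto simp: closed_subspace_def)
  have n: "hnorm (E\<lparr>hcarrier := S\<rparr>) = hnorm E"
    by (simp add: fun_eq_iff hnorm_def)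
  show ?thesis
  proof (unfold_locales, unfold n)
    fix u :: "nat \<Rightarrow> _"
    assume u: "\<And>k. u k \<in> hcarrier (E\<lparr>hcarrier := S\<rparr>)"
      and "\<And>e. 0 < e \<Longrightarrow> \<exists>N. \<forall>k\<ge>N. \<forall>l\<ge>N. hnorm E (u k - u l) < e"
    then obtain x where "x \<in> hcarrier E" "(\<lambda>k. hnorm E (u k - x)) \<longlonglongrightarrow> 0"
      using complete[of u] sub(1) by (auto simp: subset_iff)
    then show "\<exists>x\<in>hcarrier (E\<lparr>hcarrier := S\<rparr>). (\<lambda>k. hnorm E (u k - x)) \<longlonglongrightarrow> 0"
      using cl[of u x] u by auto
  next
    show "Modules.module.subspace (hscale (E\<lparr>hcarrier := S\<rparr>)) (hcarrier (E\<lparr>hcarrier := S\<rparr>))"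
      using sub(2) by simp
  next
    fix x y assume "x \<in> hcarrier (E\<lparr>hcarrier := S\<rparr>)" "y \<in> hcarrier (E\<lparr>hcarrier := S\<rparr>)"
    then show "hinner (E\<lparr>hcarrier := S\<rparr>) x y = cnj (hinner (E\<lparr>hcarrier := S\<rparr>) y x)"
      using inner_cnj[of x y] sub by auto
  qed (use sub in \<open>auto simp: inner_add_left inner_scale_left inner_pos subset_iff
      scale_right_distrib scale_left_distrib\<close>)
qed

text \<open>The point \<open>p\<close> is the limit of a sequence in \<open>S\<close> that minimises
  the distance to \<open>x\<close>; orthogonality of \<open>x - p\<close> to \<open>S\<close> then
  follows from minimality.\<close>

theorem orthogonal_projection:
  assumes S: "closed_subspace E S" and x: "x \<in> hcarrier E"
  shows "\<exists>p\<in>S. \<forall>t\<in>S. hinner E p t = hinner E x t"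
proof -
  have sub: "S \<subseteq> hcarrier E" "subspace S"
    and cl: "\<And>u x. \<lbrakk>\<And>k::nat. u k \<in> S; x \<in> hcarrier E; (\<lambda>k. hnorm E (u k - x)) \<longlonglongrightarrow> 0\<rbrakk> \<Longrightarrow> x \<in> S"
    using S by (auto simp: closed_subspace_def)
  note [simp] = subsetD[OF sub(1)] x
  define D where "D = (\<lambda>s. (hnorm E (x - s))\<^sup>2) ` S"
  define d where "d = Inf D"
  have D: "D \<noteq> {}" "bdd_below D"
    using subspace_0[OF sub(2)] by (auto simp: D_def intro: bdd_belowI[of _ 0])
  have d_le: "d \<le> (hnorm E (x - s))\<^sup>2" if "s \<in> S" for s
    using that D by (auto simp: d_def D_def intro: cInf_lower)
  have "\<exists>s\<in>S. (hnorm E (x - s))\<^sup>2 < d + inverse (real (Suc k))" for k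
    using cInf_lessD[OF D(1), of "d + inverse (real (Suc k))"]
        by (auto simp: d_def[symmetric]) (auto simp: D_def)
  then obtain u where u: "\<And>k. u k \<in> S" "\<And>k. (hnorm E (x - u k))\<^sup>2 < d + inverse (real (Suc k))"
    by metis
  \<comment> \<open>Parallelogram law: the midpoint of \<open>u k\<close> and \<open>u l\<close>
    lies in \<open>S\<close>, so its distance to \<open>x\<close> is at least the infimum, which
    leaves little room for \<open>u k - u l\<close>.\<close>
  have par: "(hnorm E (u k - u l))\<^sup>2 \<le> 2 * inverse (real (Suc k)) + 2 * inverse (real (Suc l))"
      for k l
  proof -
    let ?a = "x - u k" and ?b = "x - u l"
    have m: "hscale E (1/2) (u k + u l) \<in> S"
      using sub(2) u by (simp add: subspace_def)
    have two: "x + x = hscale E 2 x"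
      using scale_left_distrib[of 1 1 x] by simp
    have "?a + ?b = hscale E 2 (x - hscale E (1/2) (u k + u l))"
      by (simp add: scale_right_diff_distrib two[symmetric])
    then have "(hnorm E (?a + ?b))\<^sup>2 = 4 * (hnorm E (x - hscale E (1/2) (u k + u l)))\<^sup>2"
      using m by (simp add: hnorm_scale power_mult_distrib)
    then have "4 * d \<le> (hnorm E (?a + ?b))\<^sup>2"
      using d_le[OF m] by simp
    moreover have "(hnorm E (?a + ?b))\<^sup>2 + (hnorm E (?a - ?b))\<^sup>2 = 2 * (hnorm E ?a)\<^sup>2
        + 2 * (hnorm E ?b)\<^sup>2"
      using hnorm_add_power2[of ?a ?b] hnorm_diff_power2[of ?a ?b] u by simp
    moreover have "?a - ?b = u l - u k"
      by simp
    ultimately have "(hnorm E (u l - u k))\<^sup>2 \<le> 2 * inverse (real (Suc k))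
        + 2 * inverse (real (Suc l))"
      using u(2)[of k] u(2)[of l] by simp
    then show ?thesis
      using hnorm_minus_commute[of "u l" "u k"] u by simp
  qed
  have "\<exists>N. \<forall>k\<ge>N. \<forall>l\<ge>N. hnorm E (u k - u l) < e" if "e > 0" for e
  proof -
    have "e\<^sup>2 / 4 > 0"
      using that by simp
    then obtain N where N: "inverse (real (Suc N)) < e\<^sup>2 / 4"
      using reals_Archimedean by blast
    have "hnorm E (u k - u l) < e" if "k \<ge> N" "l \<ge> N" for k l
    proof -
      have "inverse (real (Suc k)) \<le> inverse (real (Suc N))" "inverse (real (Suc l))
          \<le> inverse (real (Suc N))"
        using that by (auto intro!: le_imp_inverse_le)
      then have "(hnorm E (u k - u l))\<^sup>2 < e\<^sup>2"
        using par[of k l] N by argo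
      then show ?thesis
        using \<open>e > 0\<close> by (auto intro: power2_less_imp_less)
    qed
    then show ?thesis by blast
  qed
  then obtain p where p: "p \<in> hcarrier E" "(\<lambda>k. hnorm E (u k - p)) \<longlonglongrightarrow> 0"
    using complete[of u] u by auto
  then have pS: "p \<in> S"
    using cl u by blast
  have "(\<lambda>k. hnorm E (x - u k)) \<longlonglongrightarrow> hnorm E (x - p)"
  proof (rule hnorm_lim)
    show "(\<lambda>k. hnorm E (x - u k - (x - p))) \<longlonglongrightarrow> 0"
      using p u hnorm_minus_commute[of p "u _"] by simp
  qed (use u p in auto)
  then have "(\<lambda>k. (hnorm E (x - u k))\<^sup>2) \<longlonglongrightarrow> (hnorm E (x - p))\<^sup>2"
    by (intro tendsto_intros)
  moreover have "(\<lambda>k. d + inverse (real (Suc k))) \<longlonglongrightarrow> d + 0"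
    by (intro tendsto_intros LIMSEQ_inverse_real_of_nat)
  ultimately have dp: "(hnorm E (x - p))\<^sup>2 \<le> d"
    using u(2) by (intro LIMSEQ_le[of _ _ "\<lambda>k. d + inverse (real (Suc k))"]) (auto intro:
        less_imp_le)
  have "hinner E (x - p) t = 0" if t: "t \<in> S" for t
  proof (rule ccontr)
    assume nz: "hinner E (x - p) t \<noteq> 0"
    then have "t \<noteq> 0"
      using pS by auto
    \<comment> \<open>The best multiple of \<open>t\<close>: moving from \<open>p\<close> to
      \<open>p + a t\<close> inside \<open>S\<close> would push the squared distance to
      \<open>x\<close> below the infimum \<open>d\<close>.\<close>
    define a where "a = hinner E (x - p) t / of_real ((hnorm E t)\<^sup>2)"
    have "(hnorm E (x - p - hscale E a t))\<^sup>2
        = (hnorm E (x - p))\<^sup>2 - (cmod (hinner E (x - p) t))\<^sup>2 / (hnorm E t)\<^sup>2"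
      unfolding a_def using pS t \<open>t \<noteq> 0\<close> by (intro hnorm_diff_component) auto
    moreover have "p + hscale E a t \<in> S"
      using sub(2) pS t by (simp add: subspace_def)
    ultimately have "(cmod (hinner E (x - p) t))\<^sup>2 / (hnorm E t)\<^sup>2 \<le> 0"
      using d_le[of "p + hscale E a t"] dp by (simp add: diff_diff_eq)
    then show False
      using hnorm_eq_0[of t] nz t \<open>t \<noteq> 0\<close> by (simp add: divide_le_0_iff)
  qed
  then show ?thesis
    using pS by (intro bexI[of _ p]) (auto simp: inner_diff_left)
qed

end

text \<open>Cauchy sequences are mapped to \<open>K\<close>, and surjectivity of
  \<open>\<phi>\<close> brings the limit back; injectivity yields definiteness. Linearity of
  \<open>\<phi>\<close> is available on the carrier only.\<close>

lemma hilbert_space_transport: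
  assumes K: "hilbert_space K" and V: "vector_space (hscale E)"
    and sub: "Modules.module.subspace (hscale E) (hcarrier E)"
    and bij: "bij_betw \<phi> (hcarrier E) (hcarrier K)"
    and add: "\<And>x y. x \<in> hcarrier E \<Longrightarrow> y \<in> hcarrier E \<Longrightarrow> \<phi> (x + y) = \<phi> x + \<phi> y"
    and scale: "\<And>a x. x \<in> hcarrier E \<Longrightarrow> \<phi> (hscale E a x) = hscale K a (\<phi> x)"
    and inner: "\<And>x y. x \<in> hcarrier E \<Longrightarrow> y \<in> hcarrier E \<Longrightarrow> hinner E x y = hinner K (\<phi> x) (\<phi> y)"
  shows "hilbert_space E"
proof -
  interpret K: hilbert_space K by fact
  interpret V: vector_space "hscale E" by fact
  have mem [simp]: "\<phi> x \<in> hcarrier K" if "x \<in> hcarrier E" for x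
    using that bij bij_betwE by blast
  have addm: "x + y \<in> hcarrier E" "hscale E a x \<in> hcarrier E" "x - y \<in> hcarrier E" "0 \<in> hcarrier E" 
    if "x \<in> hcarrier E" "y \<in> hcarrier E" for x y a
    using sub that V.subspace_diff by (auto simp: V.subspace_def)
  have diff: "\<phi> (x - y) = \<phi> x - \<phi> y" if "x \<in> hcarrier E" "y \<in> hcarrier E" for x y
    using add[of "x - y" y] that addm by simp
  have n: "hnorm E x = hnorm K (\<phi> x)" if "x \<in> hcarrier E" for x
    using that by (simp add: hnorm_def inner)
  show ?thesis
  proof unfold_locales
    fix u :: "nat \<Rightarrow> _"
    assume u: "\<And>k. u k \<in> hcarrier E"
      and "\<And>e. 0 < e \<Longrightarrow> \<exists>N. \<forall>k\<ge>N. \<forall>l\<ge>N. hnorm E (u k - u l) < e"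
    then obtain y where y: "y \<in> hcarrier K" "(\<lambda>k. hnorm K (\<phi> (u k) - y)) \<longlonglongrightarrow> 0"
      using K.complete[of "\<lambda>k. \<phi> (u k)"] by (auto simp: n addm diff)
    then obtain x where x: "x \<in> hcarrier E" "\<phi> x = y"
      using bij bij_betw_imp_surj_on by (metis imageE)
    then show "\<exists>x\<in>hcarrier E. (\<lambda>k. hnorm E (u k - x)) \<longlonglongrightarrow> 0"
      using y u by (intro bexI[of _ x]) (auto simp: n addm diff)
  next
    fix x assume x: "x \<in> hcarrier E" "x \<noteq> 0"
    have "\<phi> 0 = 0"
      using diff[of x x] x by simp
    then have "\<phi> x \<noteq> 0"
      using x bij addm(4)[of x x] unfolding bij_betw_def inj_on_def by metis
    then show "0 < Re (hinner E x x)"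
      using x by (simp add: inner K.inner_pos)
  next
    fix x y assume "x \<in> hcarrier E" "y \<in> hcarrier E"
    then show "hinner E x y = cnj (hinner E y x)"
      using K.inner_cnj[of "\<phi> x" "\<phi> y"] by (simp add: inner)
  qed (use sub in \<open>auto simp: inner addm add scale K.inner_add_left K.inner_scale_left\<close>)
qed

section \<open>Square summable families\<close>

lemma power2_add_le: "(x + y :: real)\<^sup>2 \<le> 2 * x\<^sup>2 + 2 * y\<^sup>2"
  using zero_le_power2[of "x - y"] by (simp add: power2_sum power2_diff)

lemma summable_on_mult_power2:
  fixes f g :: "'a \<Rightarrow> real"
  assumes "(\<lambda>x. (f x)\<^sup>2) summable_on A" "(\<lambda>x. (g x)\<^sup>2) summable_on A"
  shows "(\<lambda>x. \<bar>f x * g x\<bar>) summable_on A"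
proof (rule summable_on_comparison_test)
  show "(\<lambda>x. (f x)\<^sup>2 + (g x)\<^sup>2) summable_on A"
    by (intro summable_on_add assms)
next
  fix x
  have "0 \<le> (\<bar>f x\<bar> - \<bar>g x\<bar>)\<^sup>2" "0 \<le> \<bar>f x\<bar> * \<bar>g x\<bar>"
    by simp_all
  then show "\<bar>f x * g x\<bar> \<le> (f x)\<^sup>2 + (g x)\<^sup>2"
    unfolding abs_mult power2_diff power2_abs by linarith
qed simp

definition sq_summable :: "'v hspace \<Rightarrow> ('a \<Rightarrow> 'v) \<Rightarrow> bool" where
  "sq_summable E c \<longleftrightarrow> (\<forall>\<alpha>. c \<alpha> \<in> hcarrier E) \<and> (\<lambda>\<alpha>. (hnorm E (c \<alpha>))\<^sup>2) summable_on UNIV"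

lemma sq_summable_mem: "sq_summable E c \<Longrightarrow> c \<alpha> \<in> hcarrier E"
  by (simp add: sq_summable_def)

context hilbert_space
begin

lemma sq_summable_add:
  assumes c: "sq_summable E c" and d: "sq_summable E d"
  shows "sq_summable E (\<lambda>\<alpha>. c \<alpha> + d \<alpha>)"
  unfolding sq_summable_def
proof (intro conjI allI)
  note [simp] = sq_summable_mem[OF c] sq_summable_mem[OF d]
  show "c \<alpha> + d \<alpha> \<in> hcarrier E" for \<alpha>
    by simp
  show "(\<lambda>\<alpha>. (hnorm E (c \<alpha> + d \<alpha>))\<^sup>2) summable_on UNIV"
  proof (rule summable_on_comparison_test)
    show "(\<lambda>\<alpha>. 2 * (hnorm E (c \<alpha>))\<^sup>2 + 2 * (hnorm E (d \<alpha>))\<^sup>2) summable_on UNIV"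
      using c d by (intro summable_on_add summable_on_cmult_right) (auto simp: sq_summable_def)
    fix \<alpha>
    have "(hnorm E (c \<alpha> + d \<alpha>))\<^sup>2 \<le> (hnorm E (c \<alpha>) + hnorm E (d \<alpha>))\<^sup>2"
      by (intro power_mono hnorm_triangle) auto
    then show "(hnorm E (c \<alpha> + d \<alpha>))\<^sup>2 \<le> 2 * (hnorm E (c \<alpha>))\<^sup>2 + 2 * (hnorm E (d \<alpha>))\<^sup>2"
      using power2_add_le order_trans by blast
  qed simp
qed

lemma sq_summable_scale:
  assumes c: "sq_summable E c"
  shows "sq_summable E (\<lambda>\<alpha>. hscale E a (c \<alpha>))"
  using c by (auto simp: sq_summable_def hnorm_scale power_mult_distrib intro:
      summable_on_cmult_right)

lemma sq_summable_summable_inner: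
  assumes c: "sq_summable E c" and d: "sq_summable E d"
  shows "(\<lambda>\<alpha>. hinner E (c \<alpha>) (d \<alpha>)) summable_on UNIV"
proof (rule abs_summable_summable, rule summable_on_comparison_test)
  show "(\<lambda>\<alpha>. \<bar>hnorm E (c \<alpha>) * hnorm E (d \<alpha>)\<bar>) summable_on UNIV"
    using c d by (intro summable_on_mult_power2) (auto simp: sq_summable_def)
  show "cmod (hinner E (c \<alpha>) (d \<alpha>)) \<le> \<bar>hnorm E (c \<alpha>) * hnorm E (d \<alpha>)\<bar>" for \<alpha>
    using hnorm_cauchy_schwarz[of "c \<alpha>" "d \<alpha>"] c d by (fastforce simp: sq_summable_def)
qed simp

lemma sq_summable_inner_self:
  assumes c: "sq_summable E c"
  shows "Re (\<Sum>\<^sub>\<infinity>\<alpha>. hinner E (c \<alpha>) (c \<alpha>)) = (\<Sum>\<^sub>\<infinity>\<alpha>. (hnorm E (c \<alpha>))\<^sup>2)"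
  using c infsum_Re[OF sq_summable_summable_inner[OF c c]]
  by (simp add: hnorm_power2 sq_summable_def)

text \<open>The analogue of \<open>has_sum\<close> for a norm that belongs to a value rather than to
  a type class. Weights and vectors are kept apart because the vectors stay fixed while the matrix
  point varies.\<close>

definition hsum :: "('a \<Rightarrow> complex) \<Rightarrow> ('a \<Rightarrow> 'v) \<Rightarrow> 'v \<Rightarrow> bool" where
  "hsum a c x \<longleftrightarrow> x \<in> hcarrier E \<and>
     ((\<lambda>A. hnorm E ((\<Sum>\<alpha>\<in>A. hscale E (a \<alpha>) (c \<alpha>)) - x)) \<longlongrightarrow> 0) (finite_subsets_at_top UNIV)"

lemma hsum_unique:
  assumes "\<And>\<alpha>. c \<alpha> \<in> hcarrier E" "hsum a c x" "hsum a c y"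
  shows "x = y"
  using assms by (intro hnorm_lim_unique[of "finite_subsets_at_top UNIV" "\<lambda>A. \<Sum>\<alpha>\<in>A. hscale E (a \<alpha>)
      (c \<alpha>)"])
    (auto simp: hsum_def intro: sum_mem)

text \<open>The equation \<open>eq\<close> is left abstract so that the same proof covers addition
  of the weights (\<open>hsum_lincomb\<close>) and addition of the vectors
  (\<open>synth_add\<close>).\<close>

lemma hsum_add_general:
  assumes c: "\<And>\<alpha>. c \<alpha> \<in> hcarrier E" "\<And>\<alpha>. c' \<alpha> \<in> hcarrier E" and "hsum a c x" "hsum a' c' y"
    and eq: "\<And>\<alpha>. hscale E (b \<alpha>) (d \<alpha>) = hscale E (a \<alpha>) (c \<alpha>) + hscale E (a' \<alpha>) (c' \<alpha>)"
  shows "hsum b d (x + y)"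
  unfolding hsum_def
proof
  note [simp] = c
  have xy [simp]: "x \<in> hcarrier E" "y \<in> hcarrier E"
    using assms by (auto simp: hsum_def)
  show "x + y \<in> hcarrier E"
    by simp
  let ?s = "\<lambda>A. \<Sum>\<alpha>\<in>A. hscale E (a \<alpha>) (c \<alpha>)" and ?t = "\<lambda>A. \<Sum>\<alpha>\<in>A. hscale E (a' \<alpha>) (c' \<alpha>)"
  have [simp]: "?s A \<in> hcarrier E" "?t A \<in> hcarrier E" for A
    by (auto intro: sum_mem)
  have lim: "((\<lambda>A. hnorm E (?s A - x) + hnorm E (?t A - y)) \<longlongrightarrow> 0 + 0) (finite_subsets_at_top UNIV)"
    using assms by (intro tendsto_add) (auto simp: hsum_def)
  show "((\<lambda>A. hnorm E ((\<Sum>\<alpha>\<in>A. hscale E (b \<alpha>) (d \<alpha>)) - (x + y))) \<longlongrightarrow> 0) (finite_subsets_at_top UNIV)"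
  proof (rule tendsto_sandwich[OF _ _ tendsto_const])
    show "((\<lambda>A. hnorm E (?s A - x) + hnorm E (?t A - y)) \<longlongrightarrow> 0) (finite_subsets_at_top UNIV)"
      using lim by simp
    have e: "(\<Sum>\<alpha>\<in>A. hscale E (b \<alpha>) (d \<alpha>)) - (x + y) = (?s A - x) + (?t A - y)" for A
      by (simp add: eq sum.distrib algebra_simps)
    show "\<forall>\<^sub>F A in finite_subsets_at_top UNIV. hnorm E ((\<Sum>\<alpha>\<in>A. hscale E (b \<alpha>) (d \<alpha>)) - (x + y))
        \<le> hnorm E (?s A - x) + hnorm E (?t A - y)"
      unfolding e by (intro always_eventually allI hnorm_triangle) auto
    show "\<forall>\<^sub>F A in finite_subsets_at_top UNIV. 0 \<le> hnorm E ((\<Sum>\<alpha>\<in>A. hscale E (b \<alpha>) (d \<alpha>)) - (x + y))"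
      unfolding e by simp
  qed
qed

lemma hsum_scale_general:
  assumes c: "\<And>\<alpha>. c \<alpha> \<in> hcarrier E" and "hsum a c x"
    and eq: "\<And>\<alpha>. hscale E (b \<alpha>) (d \<alpha>) = hscale E r (hscale E (a \<alpha>) (c \<alpha>))"
  shows "hsum b d (hscale E r x)"
  unfolding hsum_def
proof
  note [simp] = c
  have x [simp]: "x \<in> hcarrier E"
    using assms by (auto simp: hsum_def)
  show "hscale E r x \<in> hcarrier E"
    by simp
  let ?s = "\<lambda>A. \<Sum>\<alpha>\<in>A. hscale E (a \<alpha>) (c \<alpha>)"
  have [simp]: "?s A \<in> hcarrier E" for A
    by (auto intro: sum_mem)
  have "(\<Sum>\<alpha>\<in>A. hscale E (b \<alpha>) (d \<alpha>)) - hscale E r x = hscale E r (?s A - x)" for A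
    by (simp add: eq scale_sum_right scale_right_diff_distrib)
  moreover have "((\<lambda>A. cmod r * hnorm E (?s A - x)) \<longlongrightarrow> cmod r * 0) (finite_subsets_at_top UNIV)"
    using assms by (intro tendsto_mult tendsto_const) (auto simp: hsum_def)
  ultimately show "((\<lambda>A. hnorm E ((\<Sum>\<alpha>\<in>A. hscale E (b \<alpha>) (d \<alpha>)) - hscale E r x)) \<longlongrightarrow> 0)
      (finite_subsets_at_top UNIV)"
    by (simp add: hnorm_scale)
qed

lemma hsum_finite_support:
  assumes "\<And>\<alpha>. c \<alpha> \<in> hcarrier E" "finite B" "\<And>\<alpha>. \<alpha> \<notin> B \<Longrightarrow> a \<alpha> = 0"
  shows "hsum a c (\<Sum>\<alpha>\<in>B. hscale E (a \<alpha>) (c \<alpha>))"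
  unfolding hsum_def
proof
  show "(\<Sum>\<alpha>\<in>B. hscale E (a \<alpha>) (c \<alpha>)) \<in> hcarrier E"
    using assms by (auto intro: sum_mem)
  have "\<forall>\<^sub>F A in finite_subsets_at_top UNIV.
      hnorm E ((\<Sum>\<alpha>\<in>A. hscale E (a \<alpha>) (c \<alpha>)) - (\<Sum>\<alpha>\<in>B. hscale E (a \<alpha>) (c \<alpha>))) = 0"
    unfolding eventually_finite_subsets_at_top
  proof (intro exI[of _ B] conjI allI impI)
    fix A assume A: "finite A \<and> B \<subseteq> A \<and> A \<subseteq> UNIV"
    then have "(\<Sum>\<alpha>\<in>A. hscale E (a \<alpha>) (c \<alpha>)) = (\<Sum>\<alpha>\<in>B. hscale E (a \<alpha>) (c \<alpha>))"
      using assms(3) by (intro sum.mono_neutral_right) auto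
    then show "hnorm E ((\<Sum>\<alpha>\<in>A. hscale E (a \<alpha>) (c \<alpha>)) - (\<Sum>\<alpha>\<in>B. hscale E (a \<alpha>) (c \<alpha>))) = 0"
      by simp
  qed (use assms in auto)
  then show "((\<lambda>A. hnorm E ((\<Sum>\<alpha>\<in>A. hscale E (a \<alpha>) (c \<alpha>)) - (\<Sum>\<alpha>\<in>B. hscale E (a \<alpha>) (c \<alpha>)))) \<longlongrightarrow> 0)
      (finite_subsets_at_top UNIV)"
    by (rule tendsto_eventually)
qed

lemma hsum_zero: "(\<And>\<alpha>. a \<alpha> = 0) \<Longrightarrow> (\<And>\<alpha>. c \<alpha> \<in> hcarrier E) \<Longrightarrow> hsum a c 0"
  using hsum_finite_support[of c "{}" a] by simp

text \<open>Entries of matrix products are finite linear combinations of entries, so this is how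
  similarities and left shifts pass through the series.\<close>

lemma hsum_lincomb:
  assumes c: "\<And>\<alpha>. c \<alpha> \<in> hcarrier E" and "finite K" "\<And>k. k \<in> K \<Longrightarrow> hsum (a k) c (x k)"
  shows "hsum (\<lambda>\<alpha>. \<Sum>k\<in>K. b k * a k \<alpha>) c (\<Sum>k\<in>K. hscale E (b k) (x k))"
  using assms(2,3)
proof (induction K rule: finite_induct)
  case empty
  then show ?case
    using c by (simp add: hsum_zero)
next
  case (insert k K)
  have "hsum (\<lambda>\<alpha>. b k * a k \<alpha>) c (hscale E (b k) (x k))"
    by (rule hsum_scale_general[of c "a k"]) (use insert c in auto)
  moreover have "hsum (\<lambda>\<alpha>. \<Sum>k\<in>K. b k * a k \<alpha>) c (\<Sum>k\<in>K. hscale E (b k) (x k))"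
    using insert by auto
  ultimately have "hsum (\<lambda>\<alpha>. \<Sum>k\<in>insert k K. b k * a k \<alpha>) c
      (hscale E (b k) (x k) + (\<Sum>k\<in>K. hscale E (b k) (x k)))"
    by (rule hsum_add_general[of c c, rotated 2]) (use insert c in \<open>auto simp: scale_left_distrib\<close>)
  then show ?case
    using insert by simp
qed

text \<open>The two square summability assumptions make the norms of the terms summable; absolute
  convergence and completeness do the rest.\<close>

lemma hsum_exists:
  assumes a: "(\<lambda>\<alpha>. (cmod (a \<alpha>))\<^sup>2) summable_on UNIV" and c: "sq_summable E c"
  shows "\<exists>x. hsum a c x"
proof -
  note [simp] = sq_summable_mem[OF c]
  define h where "h \<alpha> = \<bar>cmod (a \<alpha>) * hnorm E (c \<alpha>)\<bar>" for \<alpha>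
  let ?s = "\<lambda>A. \<Sum>\<alpha>\<in>A. hscale E (a \<alpha>) (c \<alpha>)"
  have sA [simp]: "?s A \<in> hcarrier E" for A
    by (auto intro: sum_mem)
  have h: "h summable_on UNIV"
    unfolding h_def using a c by (intro summable_on_mult_power2) (auto simp: sq_summable_def)
  have h0: "0 \<le> h \<alpha>" for \<alpha>
    by (simp add: h_def)
  \<comment> \<open>Completeness speaks of sequences only, so a sequence of finite sets is extracted
    from the net: outside \<open>F N\<close> the norms sum to at most
    \<open>1 / (N + 1)\<close>.\<close>
  have "\<exists>F. finite F \<and> (\<forall>B. finite B \<and> F \<subseteq> B \<longrightarrow> sum h (B - F) \<le> inverse (real (Suc N)))" for N
  proof -
    have "\<forall>\<^sub>F F in finite_subsets_at_top UNIV. infsum h UNIV - inverse (real (Suc N)) < sum h F"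
      using infsum_tendsto[OF h] by (rule order_tendstoD) simp
    then obtain F where F: "finite F" "infsum h UNIV - inverse (real (Suc N)) < sum h F"
      by (auto simp: eventually_finite_subsets_at_top)
    have "sum h (B - F) \<le> inverse (real (Suc N))" if "finite B" "F \<subseteq> B" for B
      using finite_sum_le_infsum[OF h \<open>finite B\<close>] that F h0 by (simp add: sum_diff)
    then show ?thesis
      using F by blast
  qed
  then obtain F where F: "\<And>N. finite (F N)"
    "\<And>N B. finite B \<Longrightarrow> F N \<subseteq> B \<Longrightarrow> sum h (B - F N) \<le> inverse (real (Suc N))"
    by metis
  have tail: "hnorm E (?s B - ?s (F N)) \<le> inverse (real (Suc N))" if B: "finite B" "F N \<subseteq> B" for N B
  proof -
    have "?s B - ?s (F N) = ?s (B - F N)"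
      using B F by (simp add: sum_diff)
    then have "hnorm E (?s B - ?s (F N)) \<le> (\<Sum>\<alpha>\<in>B - F N. hnorm E (hscale E (a \<alpha>) (c \<alpha>)))"
      using hnorm_sum[of "B - F N"] by simp
    also have "\<dots> = sum h (B - F N)"
      by (simp add: hnorm_scale h_def abs_mult)
    finally show ?thesis
      using F(2)[OF B] by simp
  qed
  have "\<exists>N. \<forall>k\<ge>N. \<forall>l\<ge>N. hnorm E (?s (F k) - ?s (F l)) < e" if "e > 0" for e
  proof -
    obtain N where N: "inverse (real (Suc N)) < e / 2"
      using reals_Archimedean[of "e / 2"] \<open>e > 0\<close> by auto
    have "hnorm E (?s (F k) - ?s (F l)) < e" if "k \<ge> N" "l \<ge> N" for k l
    proof -
      have "inverse (real (Suc k)) \<le> inverse (real (Suc N))" "inverse (real (Suc l))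
          \<le> inverse (real (Suc N))"
        using that by (auto intro!: le_imp_inverse_le)
      moreover have "hnorm E (?s (F k) - ?s (F l))
          \<le> hnorm E (?s (F k \<union> F l) - ?s (F k)) + hnorm E (?s (F k \<union> F l) - ?s (F l))"
        using hnorm_triangle_diff[of "?s (F k)" "?s (F k \<union> F l)" "?s (F l)"]
          hnorm_minus_commute[of "?s (F k)" "?s (F k \<union> F l)"] by simp
      moreover have "hnorm E (?s (F k \<union> F l) - ?s (F k)) \<le> inverse (real (Suc k))"
        "hnorm E (?s (F k \<union> F l) - ?s (F l)) \<le> inverse (real (Suc l))"
        by (rule tail; use F in simp)+
      ultimately show ?thesis
        using N by linarith
    qed
    then show ?thesis by blast
  qed
  then obtain x where x: "x \<in> hcarrier E" "(\<lambda>k. hnorm E (?s (F k) - x)) \<longlonglongrightarrow> 0"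
    using complete[of "\<lambda>k. ?s (F k)"] by auto
  \<comment> \<open>Back from the sequence to the net: every finite set containing
    \<open>F k\<close> has its partial sum close to that of \<open>F k\<close>, hence to
    \<open>x\<close>.\<close>
  have "((\<lambda>A. hnorm E (?s A - x)) \<longlongrightarrow> 0) (finite_subsets_at_top UNIV)"
  proof (rule tendstoI)
    fix e :: real assume "e > 0"
    have "(\<lambda>k. inverse (real (Suc k)) + hnorm E (?s (F k) - x)) \<longlonglongrightarrow> 0"
      using tendsto_add[OF LIMSEQ_inverse_real_of_nat x(2)] by simp
    then have "\<forall>\<^sub>F k in sequentially. inverse (real (Suc k)) + hnorm E (?s (F k) - x) < e"
      using \<open>e > 0\<close> by (rule order_tendstoD(2))
    then obtain k where k: "inverse (real (Suc k)) + hnorm E (?s (F k) - x) < e"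
      by (meson eventually_happens sequentially_bot)
    show "\<forall>\<^sub>F A in finite_subsets_at_top UNIV. dist (hnorm E (?s A - x)) 0 < e"
      unfolding eventually_finite_subsets_at_top
    proof (intro exI[of _ "F k"] conjI allI impI)
      fix A assume "finite A \<and> F k \<subseteq> A \<and> A \<subseteq> UNIV"
      then show "dist (hnorm E (?s A - x)) 0 < e"
        using tail[of A k] hnorm_triangle_diff[of "?s A" "?s (F k)" x] k x(1) by simp
    qed (use F in auto)
  qed
  then show ?thesis
    using x by (auto simp: hsum_def)
qed

end

section \<open>Scalar families and the sequence space\<close>

lemma hnorm_complex [simp]: "hnorm complex_hspace x = cmod x"
  by (simp add: hnorm_def complex_hspace_def cmod_def power2_eq_square)

lemma hcarrier_complex [simp]: "hcarrier complex_hspace = UNIV"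
  and hscale_complex [simp]: "hscale complex_hspace = (*)"
  and hinner_complex [simp]: "hinner complex_hspace = (\<lambda>x y. x * cnj y)"
  by (simp_all add: complex_hspace_def)

interpretation C: hilbert_space complex_hspace
  by (rule hilbert_space_complex)

lemma sq_summable_complex: "sq_summable complex_hspace c \<longleftrightarrow> (\<lambda>\<alpha>. (cmod (c \<alpha>))\<^sup>2) summable_on UNIV"
  by (simp add: sq_summable_def)

lemma hsum_complex: "C.hsum a c x \<longleftrightarrow> ((\<lambda>\<alpha>. a \<alpha> * c \<alpha>) has_sum x) UNIV"
  unfolding C.hsum_def has_sum_def hnorm_complex hcarrier_complex hscale_complex
  by (simp add: tendsto_norm_zero_iff LIM_zero_iff)

definition ell2 :: "('a \<Rightarrow> complex) hspace" where
  "ell2 = \<lparr>hcarrier = Collect (sq_summable complex_hspace), hscale = (\<lambda>a c \<alpha>. a * c \<alpha>),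
     hinner = (\<lambda>c d. \<Sum>\<^sub>\<infinity>\<alpha>. c \<alpha> * cnj (d \<alpha>))\<rparr>"

lemma
  assumes "sq_summable complex_hspace c"
  shows hnorm_ell2: "(hnorm ell2 c)\<^sup>2 = (\<Sum>\<^sub>\<infinity>\<alpha>. (cmod (c \<alpha>))\<^sup>2)"
    and hnorm_ell2_nonneg: "0 \<le> hnorm ell2 c"
proof -
  have "hnorm ell2 c = sqrt (\<Sum>\<^sub>\<infinity>\<alpha>. (cmod (c \<alpha>))\<^sup>2)"
    using C.sq_summable_inner_self[OF assms] unfolding hnorm_complex
        by (simp add: hnorm_def ell2_def)
  moreover have "0 \<le> (\<Sum>\<^sub>\<infinity>\<alpha>. (cmod (c \<alpha>))\<^sup>2)"
    by (rule infsum_nonneg) simp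
  ultimately show "(hnorm ell2 c)\<^sup>2 = (\<Sum>\<^sub>\<infinity>\<alpha>. (cmod (c \<alpha>))\<^sup>2)" "0 \<le> hnorm ell2 c"
    by simp_all
qed

lemma vector_space_pointwise: "vector_space (\<lambda>a (c :: 'a \<Rightarrow> complex) \<alpha>. a * c \<alpha>)"
  by unfold_locales (auto simp: fun_eq_iff algebra_simps)

lemma sum_le_hnorm_ell2:
  assumes "sq_summable complex_hspace c" "finite A"
  shows "(\<Sum>\<alpha>\<in>A. (cmod (c \<alpha>))\<^sup>2) \<le> (hnorm ell2 c)\<^sup>2"
  using assms unfolding hnorm_ell2[OF assms(1)] sq_summable_complex
  by (intro finite_sum_le_infsum) auto

lemma cmod_le_hnorm_ell2: "sq_summable complex_hspace c \<Longrightarrow> cmod (c \<alpha>) \<le> hnorm ell2 c"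
  using sum_le_hnorm_ell2[of c "{\<alpha>}"]
  by (auto intro: power2_le_imp_le hnorm_ell2_nonneg)

text \<open>Turns a bound on finite partial sums, which survives pointwise limits and truncations,
  into membership in \<open>ell2\<close> with a norm bound.\<close>

lemma sq_summable_bounded:
  assumes "\<And>A. finite A \<Longrightarrow> (\<Sum>\<alpha>\<in>A. (cmod (c \<alpha>))\<^sup>2) \<le> M"
  shows "sq_summable complex_hspace c" "(hnorm ell2 c)\<^sup>2 \<le> M"
proof -
  show c: "sq_summable complex_hspace c"
    unfolding sq_summable_complex
    by (rule nonneg_bdd_above_summable_on) (auto intro!: bdd_aboveI[of _ M] assms)
  show "(hnorm ell2 c)\<^sup>2 \<le> M"
    using c assms unfolding hnorm_ell2[OF c] sq_summable_complex
        by (intro infsum_le_finite_sums) auto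
qed

lemma sq_summable_complex_diff:
  "\<lbrakk>sq_summable complex_hspace c; sq_summable complex_hspace d\<rbrakk>
      \<Longrightarrow> sq_summable complex_hspace (c - d)"
  using C.sq_summable_add[OF _ C.sq_summable_scale[of d "- 1"], of c] by (simp add: fun_diff_def)

text \<open>Only completeness needs an argument: coordinates are dominated by the norm, so a Cauchy
  sequence converges pointwise, and bounds on finite partial sums upgrade this to norm
  convergence.\<close>

theorem hilbert_space_ell2: "hilbert_space (ell2 :: ('a \<Rightarrow> complex) hspace)"
proof -
  interpret V: vector_space "hscale (ell2 :: ('a \<Rightarrow> complex) hspace)"
    using vector_space_pointwise by (simp add: ell2_def)
  have carrier [simp]: "c \<in> hcarrier ell2 \<longleftrightarrow> sq_summable complex_hspace c" for c :: "'a \<Rightarrow> complex"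
    by (simp add: ell2_def)
  show ?thesis
  proof unfold_locales
    show "V.subspace (hcarrier ell2)"
      unfolding V.subspace_def using C.sq_summable_add C.sq_summable_scale
      by (simp add: plus_fun_def zero_fun_def sq_summable_complex) (auto simp add: ell2_def
          sq_summable_complex)
  next
    fix x y z :: "'a \<Rightarrow> complex"
    assume "x \<in> hcarrier ell2" "y \<in> hcarrier ell2" "z \<in> hcarrier ell2"
    then show "hinner ell2 (x + y) z = hinner ell2 x z + hinner ell2 y z"
      using C.sq_summable_summable_inner[of x z] C.sq_summable_summable_inner[of y z]
      by (simp add: ell2_def infsum_add ring_distribs)
  next
    fix x y :: "'a \<Rightarrow> complex" and a
    show "hinner ell2 (hscale ell2 a x) y = a * hinner ell2 x y"
      by (simp add: ell2_def infsum_cmult_right' mult.assoc)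
    show "hinner ell2 x y = cnj (hinner ell2 y x)"
      by (simp add: ell2_def mult.commute flip: infsum_cnj)
  next
    fix x :: "'a \<Rightarrow> complex"
    assume x: "x \<in> hcarrier ell2" "x \<noteq> 0"
    then obtain \<alpha> where "x \<alpha> \<noteq> 0"
      by (auto simp: fun_eq_iff)
    then have "hnorm ell2 x > 0"
      using cmod_le_hnorm_ell2[of x \<alpha>] x by (auto intro: less_le_trans[of _ "cmod (x \<alpha>)"])
    then show "0 < Re (hinner ell2 x x)"
      by (simp add: hnorm_def)
  next
    fix u :: "nat \<Rightarrow> 'a \<Rightarrow> complex"
    assume u: "\<And>k. u k \<in> hcarrier ell2"
      and cauchy: "\<And>e. 0 < e \<Longrightarrow> \<exists>N. \<forall>k\<ge>N. \<forall>l\<ge>N. hnorm ell2 (u k - u l) < e"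
    have diff: "sq_summable complex_hspace (u k - u l)" for k l
      using u by (simp add: sq_summable_complex_diff)
    have "Cauchy (\<lambda>k. u k \<alpha>)" for \<alpha>
      unfolding Cauchy_def
    proof (intro allI impI)
      fix e :: real assume "0 < e"
      then obtain N where "\<forall>k\<ge>N. \<forall>l\<ge>N. hnorm ell2 (u k - u l) < e"
        using cauchy by blast
      then show "\<exists>N. \<forall>k\<ge>N. \<forall>l\<ge>N. dist (u k \<alpha>) (u l \<alpha>) < e"
        by (intro exI[of _ N]) (auto simp: dist_norm intro: le_less_trans[OF cmod_le_hnorm_ell2[OF
            diff, of _ _ \<alpha>, simplified]])
    qed
    then have "\<forall>\<alpha>. \<exists>l. (\<lambda>k. u k \<alpha>) \<longlonglongrightarrow> l"
      by (simp add: Cauchy_convergent_iff convergent_def)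
    then obtain x where x: "\<And>\<alpha>. (\<lambda>k. u k \<alpha>) \<longlonglongrightarrow> x \<alpha>"
      by metis
    \<comment> \<open>Only finite sums can be passed to the pointwise limit in \<open>l\<close>; the
      bound is uniform in \<open>A\<close>, which is all that \<open>sq_summable_bounded\<close>
      asks for.\<close>
    have close: "(\<Sum>\<alpha>\<in>A. (cmod ((u k - x) \<alpha>))\<^sup>2) \<le> e\<^sup>2"
      if A: "finite A" and k: "\<forall>k\<ge>N. \<forall>l\<ge>N. hnorm ell2 (u k - u l) < e" "k \<ge> N" "e > 0" for A k e N
    proof (rule tendsto_upperbound)
      show "(\<lambda>l. \<Sum>\<alpha>\<in>A. (cmod ((u k - u l) \<alpha>))\<^sup>2) \<longlonglongrightarrow> (\<Sum>\<alpha>\<in>A. (cmod ((u k - x) \<alpha>))\<^sup>2)"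
        using x by (auto intro!: tendsto_intros)
      have "(\<Sum>\<alpha>\<in>A. (cmod ((u k - u l) \<alpha>))\<^sup>2) \<le> e\<^sup>2" if "l \<ge> N" for l
      proof -
        have "(hnorm ell2 (u k - u l))\<^sup>2 \<le> e\<^sup>2"
          using k that by (intro power_mono hnorm_ell2_nonneg diff) (auto simp: less_imp_le)
        then show ?thesis
          using sum_le_hnorm_ell2[OF diff A, of k l] by simp
      qed
      then show "\<forall>\<^sub>F l in sequentially. (\<Sum>\<alpha>\<in>A. (cmod ((u k - u l) \<alpha>))\<^sup>2) \<le> e\<^sup>2"
        by (auto simp: eventually_sequentially)
    qed simp
    \<comment> \<open>The estimate controls \<open>u N - x\<close> and not \<open>x\<close>, which
      is recovered as \<open>u N - (u N - x)\<close>.\<close>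
    have "sq_summable complex_hspace x"
    proof -
      obtain N where N: "\<forall>k\<ge>N. \<forall>l\<ge>N. hnorm ell2 (u k - u l) < 1"
        using cauchy[of 1] by auto
      have "sq_summable complex_hspace (u N - x)"
        using close[OF _ N order_refl] by (intro sq_summable_bounded(1)[where M = "1\<^sup>2"]) auto
      then show ?thesis
        using sq_summable_complex_diff[of "u N" "u N - x"] u by simp
    qed
    moreover have "(\<lambda>k. hnorm ell2 (u k - x)) \<longlonglongrightarrow> 0"
    proof (rule LIMSEQ_I)
      fix r :: real assume "r > 0"
      then obtain N where N: "\<forall>k\<ge>N. \<forall>l\<ge>N. hnorm ell2 (u k - u l) < r / 2"
        using cauchy[of "r / 2"] by auto
      have "norm (hnorm ell2 (u k - x) - 0) < r" if "k \<ge> N" for k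
      proof -
        have "(hnorm ell2 (u k - x))\<^sup>2 \<le> (r / 2)\<^sup>2"
          using close[OF _ N that] \<open>r > 0\<close> by (intro sq_summable_bounded(2)) auto
        then have "hnorm ell2 (u k - x) \<le> r / 2"
          by (rule power2_le_imp_le) (use \<open>r > 0\<close> in simp)
        moreover have "sq_summable complex_hspace (u k - x)"
          using close[OF _ N that] \<open>r > 0\<close> by (intro sq_summable_bounded(1)) auto
        ultimately show ?thesis
          using hnorm_ell2_nonneg[of "u k - x"] \<open>r > 0\<close> by simp
      qed
      then show "\<exists>N. \<forall>k\<ge>N. norm (hnorm ell2 (u k - x) - 0) < r"
        by blast
    qed
    ultimately show "\<exists>x\<in>hcarrier ell2. (\<lambda>k. hnorm ell2 (u k - x)) \<longlonglongrightarrow> 0"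
      by auto
  qed
qed

interpretation L: hilbert_space ell2
  by (rule hilbert_space_ell2)

section \<open>The row ball\<close>

lemma vec_l2norm_eq: "dim_vec v = n \<Longrightarrow> vec_l2norm v = L2_set (\<lambda>i. cmod (vec_index v i)) {..<n}"
  by (simp add: vec_l2norm_def L2_set_def)

lemma vec_l2norm_mult_eq:
  assumes "A \<in> carrier_mat n n" "v \<in> carrier_vec n"
  shows "vec_l2norm (A *\<^sub>v v) = L2_set (\<lambda>i. cmod (\<Sum>k<n. A $$ (i, k) * vec_index v k)) {..<n}"
proof -
  have "vec_index (A *\<^sub>v v) i = (\<Sum>k<n. A $$ (i, k) * vec_index v k)" if "i < n" for i
    using assms that by (simp add: scalar_prod_def atLeast0LessThan)
  then show ?thesis
    using assms by (subst vec_l2norm_eq[of _ n]) (auto intro!: L2_set_cong)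
qed

text \<open>A real supremum carries information only over a set bounded above; the sum of the moduli
  of all entries is a crude bound.\<close>

lemma mat_opnorm_bdd:
  assumes A: "A \<in> carrier_mat n n"
  shows "bdd_above ((\<lambda>v. vec_l2norm (A *\<^sub>v v)) ` {v \<in> carrier_vec (dim_col A). vec_l2norm v \<le> 1})"
proof (rule bdd_aboveI2)
  fix v assume v: "v \<in> {v \<in> carrier_vec (dim_col A). vec_l2norm v \<le> 1}"
  then have vn: "v \<in> carrier_vec n"
    using A by auto
  have "cmod (vec_index v k) \<le> 1" if "k < n" for k
    using member_le_L2_set[of "{..<n}" k "\<lambda>i. cmod (vec_index v i)"] that v vn vec_l2norm_eq[of v
        n] by auto
  then have "cmod (\<Sum>k<n. A $$ (i, k) * vec_index v k) \<le> (\<Sum>k<n. cmod (A $$ (i, k)))" for i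
    by (intro order_trans[OF norm_sum] sum_mono) (auto simp: norm_mult mult_left_le)
  then show "vec_l2norm (A *\<^sub>v v) \<le> (\<Sum>i<n. \<Sum>k<n. cmod (A $$ (i, k)))"
    unfolding vec_l2norm_mult_eq[OF A vn]
    by (intro order_trans[OF L2_set_le_sum] sum_mono) auto
qed

lemma L2_set_matrix_le_opnorm:
  assumes A: "A \<in> carrier_mat n n"
  shows "L2_set (\<lambda>i. cmod (\<Sum>k<n. A $$ (i, k) * v k)) {..<n}
      \<le> mat_opnorm A * L2_set (\<lambda>i. cmod (v i)) {..<n}"
proof (cases "L2_set (\<lambda>i. cmod (v i)) {..<n} = 0")
  case True
  then have "v k = 0" if "k < n" for k
    using that by (simp add: L2_set_eq_0_iff)
  then show ?thesis
    using True by (simp add: L2_set_def)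
next
  case False
  define r where "r = L2_set (\<lambda>i. cmod (v i)) {..<n}"
  have r: "r > 0"
    using False by (simp add: r_def less_le)
  define w where "w = Matrix.vec n (\<lambda>k. v k / of_real r)"
  have w: "w \<in> carrier_vec n" "\<And>k. k < n \<Longrightarrow> vec_index w k = v k / of_real r"
    by (auto simp: w_def)
  have "vec_l2norm w = L2_set (\<lambda>i. inverse r * cmod (v i)) {..<n}"
    using w r by (subst vec_l2norm_eq[of _ n]) (auto simp: norm_mult norm_inverse divide_inverse
        mult.commute intro!: L2_set_cong)
  also have "\<dots> = 1"
    using r by (subst L2_set_right_distrib[symmetric]) (auto simp: r_def)
  finally have "vec_l2norm (A *\<^sub>v w) \<le> mat_opnorm A"
    unfolding mat_opnorm_def using A w by (intro cSUP_upper mat_opnorm_bdd) auto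
  moreover have "vec_l2norm (A *\<^sub>v w) = L2_set (\<lambda>i. inverse r * cmod (\<Sum>k<n. A $$ (i, k) * v k))
      {..<n}"
  proof -
    have "cmod (\<Sum>k<n. A $$ (i, k) * vec_index w k) = inverse r * cmod (\<Sum>k<n. A $$ (i, k) * v k)"
        for i
    proof -
      have *: "(\<Sum>k<n. A $$ (i, k) * vec_index w k) = (\<Sum>k<n. A $$ (i, k) * v k) / of_real r"
        using w by (simp add: sum_divide_distrib)
      show ?thesis
        unfolding * using r by (simp add: norm_mult norm_inverse divide_inverse mult.commute)
    qed
    then show ?thesis
      using A w by (simp add: vec_l2norm_mult_eq)
  qed
  moreover have "\<dots> = inverse r * L2_set (\<lambda>i. cmod (\<Sum>k<n. A $$ (i, k) * v k)) {..<n}"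
    using r by (subst L2_set_right_distrib) auto
  ultimately have "inverse r * L2_set (\<lambda>i. cmod (\<Sum>k<n. A $$ (i, k) * v k)) {..<n} \<le> mat_opnorm A"
    by (simp only:)
  then show ?thesis
    using r unfolding r_def[symmetric] inverse_eq_divide
        by (simp add: pos_divide_le_eq mult.commute)
qed

lemma mat_opnorm_le:
  assumes A: "A \<in> carrier_mat n n" and K: "0 \<le> K"
    and bound: "\<And>v. L2_set (\<lambda>i. cmod (\<Sum>k<n. A $$ (i, k) * v k)) {..<n}
        \<le> K * L2_set (\<lambda>i. cmod (v i)) {..<n}"
  shows "mat_opnorm A \<le> K"
  unfolding mat_opnorm_def
proof (rule cSUP_least)
  have "vec_l2norm (0\<^sub>v (dim_col A)) \<le> 1"
    by (simp add: vec_l2norm_def)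
  then show "{v \<in> carrier_vec (dim_col A). vec_l2norm v \<le> 1} \<noteq> {}"
    by (metis (mono_tags, lifting) empty_iff mem_Collect_eq zero_carrier_vec)
next
  fix v assume v: "v \<in> {v \<in> carrier_vec (dim_col A). vec_l2norm v \<le> 1}"
  then have "vec_l2norm (A *\<^sub>v v) \<le> K * vec_l2norm v"
    using A bound[of "vec_index v"] by (simp add: vec_l2norm_mult_eq vec_l2norm_eq[of v n])
  also have "\<dots> \<le> K * 1"
    using v K by (intro mult_left_mono) auto
  finally show "vec_l2norm (A *\<^sub>v v) \<le> K"
    by simp
qed

lemma mat_opnorm_nonneg: "A \<in> carrier_mat n n \<Longrightarrow> 0 \<le> mat_opnorm A"
proof -
  assume A: "A \<in> carrier_mat n n"
  have z: "vec_l2norm (0\<^sub>v n) = 0"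
    by (simp add: vec_l2norm_def)
  have "vec_l2norm (A *\<^sub>v 0\<^sub>v n) \<le> mat_opnorm A"
    unfolding mat_opnorm_def using A z by (intro cSUP_upper mat_opnorm_bdd) auto
  moreover have "0 \<le> vec_l2norm (A *\<^sub>v 0\<^sub>v n)"
    by (simp add: vec_l2norm_def sum_nonneg)
  ultimately show ?thesis
    by simp
qed

definition row_gram :: "nat \<Rightarrow> ('d::finite \<Rightarrow> complex mat) \<Rightarrow> nat \<Rightarrow> nat \<Rightarrow> complex" where
  "row_gram n X i k = (\<Sum>j\<in>UNIV. \<Sum>l<n. X j $$ (i, l) * cnj (X j $$ (k, l)))"

lemma mult_adjoint_index:
  assumes "A \<in> carrier_mat n n" "i < n" "k < n"
  shows "(A * mat_adjoint A) $$ (i, k) = (\<Sum>l<n. A $$ (i, l) * cnj (A $$ (k, l)))"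
  using assms by (simp add: scalar_prod_def atLeast0LessThan mat_adjoint_def mat_of_rows_def)

text \<open>\<open>row_gram n X\<close> has the entries of the sum of \<open>X j\<close> times its
  adjoint. Trading the supremum for a constant \<open>q\<close> leaves membership proofs with one
  inequality for all vectors.\<close>

lemma nc_ball_iff:
  "X \<in> nc_ball n \<longleftrightarrow> 1 \<le> n \<and> (\<forall>j. X j \<in> carrier_mat n n) \<and>
     (\<exists>q. 0 \<le> q \<and> q < 1 \<and> (\<forall>v. L2_set (\<lambda>i. cmod (\<Sum>k<n. row_gram n X i k * v k)) {..<n}
        \<le> q * L2_set (\<lambda>i. cmod (v i)) {..<n}))" (is "_ \<longleftrightarrow> _ \<and> ?C \<and> ?Q")
proof -
  define M where "M = mat n n (\<lambda>ij. \<Sum>j\<in>UNIV. (X j * mat_adjoint (X j)) $$ ij)"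
  have M: "M \<in> carrier_mat n n"
    by (simp add: M_def)
  have "mat_opnorm M < 1 \<longleftrightarrow> ?Q" if ?C
  proof -
    have e: "M $$ (i, k) = row_gram n X i k" if "i < n" "k < n" for i k
      using that \<open>?C\<close> by (simp add: M_def row_gram_def mult_adjoint_index[of _ n] del:
          index_mult_mat)
    have L: "L2_set (\<lambda>i. cmod (\<Sum>k<n. M $$ (i, k) * v k)) {..<n}
        = L2_set (\<lambda>i. cmod (\<Sum>k<n. row_gram n X i k * v k)) {..<n}" for v
      by (rule L2_set_cong) (auto simp: e)
    show ?thesis
    proof
      assume "mat_opnorm M < 1"
      then show ?Q
        using L2_set_matrix_le_opnorm[OF M] mat_opnorm_nonneg[OF M] unfolding L by blast
    next
      assume ?Q
      then obtain q where "0 \<le> q" "q < 1"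
        "\<forall>v. L2_set (\<lambda>i. cmod (\<Sum>k<n. M $$ (i, k) * v k)) {..<n}
            \<le> q * L2_set (\<lambda>i. cmod (v i)) {..<n}"
        unfolding L by blast
      then show "mat_opnorm M < 1"
        using mat_opnorm_le[OF M, of q] by fastforce
    qed
  qed
  then show ?thesis
    unfolding nc_ball_def M_def by blast
qed

lemma nc_ball_carrier: "X \<in> nc_ball n \<Longrightarrow> X j \<in> carrier_mat n n"
  by (simp add: nc_ball_iff)

lemma nc_ball_size_unique: "X \<in> nc_ball n \<Longrightarrow> X \<in> nc_ball m \<Longrightarrow> m = n"
  using nc_ball_carrier[of X n undefined] nc_ball_carrier[of X m undefined] by auto

text \<open>With \<open>G = row_gram n X\<close>, the left side is the quadratic form of
  \<open>G\<close> at the conjugate of \<open>v\<close>, so Cauchy-Schwarz and the norm bound on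
  \<open>G\<close> give the factor \<open>q\<close>. Row vectors are multiplied from the left
  because words grow at their first letter.\<close>

lemma nc_ball_contraction:
  assumes X: "X \<in> nc_ball n"
  obtains q where "0 \<le> q" "q < 1"
    "\<And>v. (\<Sum>j\<in>UNIV. \<Sum>l<n. (cmod (\<Sum>i<n. v i * X j $$ (i, l)))\<^sup>2) \<le> q * (\<Sum>i<n. (cmod (v i))\<^sup>2)"
proof -
  obtain q where q: "0 \<le> q" "q < 1"
    and b: "\<And>v. L2_set (\<lambda>i. cmod (\<Sum>k<n. row_gram n X i k * v k)) {..<n}
        \<le> q * L2_set (\<lambda>i. cmod (v i)) {..<n}"
    using X unfolding nc_ball_iff by blast
  have "(\<Sum>j\<in>UNIV. \<Sum>l<n. (cmod (\<Sum>i<n. v i * X j $$ (i, l)))\<^sup>2) \<le> q * (\<Sum>i<n. (cmod (v i))\<^sup>2)" for v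
  proof -
    define w where "w i = (\<Sum>k<n. row_gram n X i k * cnj (v k))" for i
    have "complex_of_real (\<Sum>j\<in>UNIV. \<Sum>l<n. (cmod (\<Sum>i<n. v i * X j $$ (i, l)))\<^sup>2)
        = (\<Sum>j\<in>UNIV. \<Sum>l<n. (\<Sum>i<n. v i * X j $$ (i, l)) * cnj (\<Sum>k<n. v k * X j $$ (k, l)))"
      by (simp only: of_real_sum complex_norm_square)
    also have "\<dots> = (\<Sum>j\<in>UNIV. \<Sum>l<n. \<Sum>i<n. \<Sum>k<n. v i * (X j $$ (i, l) * cnj (X j $$ (k, l))) * cnj
        (v k))"
      by (simp add: sum_product mult_ac)
    also have "\<dots> = (\<Sum>j\<in>UNIV. \<Sum>i<n. \<Sum>k<n. \<Sum>l<n. v i * (X j $$ (i, l) * cnj (X j $$ (k, l))) * cnj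
        (v k))"
      by (rule sum.cong[OF refl], subst sum.swap, rule sum.cong[OF refl], rule sum.swap)
    also have "\<dots> = (\<Sum>i<n. \<Sum>k<n. \<Sum>j\<in>UNIV. \<Sum>l<n. v i * (X j $$ (i, l) * cnj (X j $$ (k, l))) * cnj
        (v k))"
      by (subst sum.swap, rule sum.cong[OF refl], rule sum.swap)
    also have "\<dots> = (\<Sum>i<n. v i * w i)"
      by (simp add: w_def row_gram_def sum_distrib_left sum_distrib_right mult.assoc)
    finally have "Re (complex_of_real (\<Sum>j\<in>UNIV. \<Sum>l<n. (cmod (\<Sum>i<n. v i * X j $$ (i, l)))\<^sup>2))
        = Re (\<Sum>i<n. v i * w i)"
      by (rule arg_cong)
    then have "(\<Sum>j\<in>UNIV. \<Sum>l<n. (cmod (\<Sum>i<n. v i * X j $$ (i, l)))\<^sup>2) = Re (\<Sum>i<n. v i * w i)"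
      by (simp only: Re_complex_of_real)
    also have "\<dots> \<le> (\<Sum>i<n. \<bar>cmod (v i)\<bar> * \<bar>cmod (w i)\<bar>)"
      using complex_Re_le_cmod[of "\<Sum>i<n. v i * w i"] norm_sum[of "\<lambda>i. v i * w i" "{..<n}"]
      by (simp add: norm_mult)
    also have "\<dots> \<le> L2_set (\<lambda>i. cmod (v i)) {..<n} * L2_set (\<lambda>i. cmod (w i)) {..<n}"
      by (rule L2_set_mult_ineq)
    also have "\<dots> \<le> L2_set (\<lambda>i. cmod (v i)) {..<n} * (q * L2_set (\<lambda>i. cmod (v i)) {..<n})"
      using b[of "\<lambda>k. cnj (v k)"] by (intro mult_left_mono) (auto simp: w_def)
    also have "\<dots> = q * (\<Sum>i<n. (cmod (v i))\<^sup>2)"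
      by (simp add: L2_set_def sum_nonneg)
    finally show ?thesis .
  qed
  then show thesis
    using q that by blast
qed

section \<open>Word products at a point of the ball\<close>

lemma word_mat_carrier: "(\<And>j. Z j \<in> carrier_mat n n) \<Longrightarrow> word_mat n Z \<alpha> \<in> carrier_mat n n"
  by (induction \<alpha>) (auto intro: mult_carrier_mat)

lemma mat_mult_index:
  "A \<in> carrier_mat n n \<Longrightarrow> B \<in> carrier_mat n n \<Longrightarrow> i < n \<Longrightarrow> j < n
    \<Longrightarrow> (A * B) $$ (i, j) = (\<Sum>k<n. A $$ (i, k) * B $$ (k, j))"
  by (simp add: scalar_prod_def atLeast0LessThan)

lemma word_mat_Cons_index:
  assumes "\<And>j. Z j \<in> carrier_mat n n" "i < n" "l < n"
  shows "word_mat n Z (j # \<alpha>) $$ (i, l) = (\<Sum>k<n. Z j $$ (i, k) * word_mat n Z \<alpha> $$ (k, l))"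
  using assms word_mat_carrier[of Z n \<alpha>] by (simp add: mat_mult_index del: index_mult_mat)

lemma words_of_length_0: "{\<alpha> :: 'd list. length \<alpha> = 0} = {[]}"
  by auto

lemma sum_words_Suc:
  fixes f :: "'d::finite list \<Rightarrow> 'b::comm_monoid_add"
  shows "(\<Sum>\<alpha> | length \<alpha> = Suc N. f \<alpha>) = (\<Sum>j\<in>UNIV. \<Sum>\<alpha> | length \<alpha> = N. f (j # \<alpha>))"
proof -
  have "(\<Sum>\<alpha> | length \<alpha> = Suc N. f \<alpha>) = (\<Sum>(j, \<alpha>) \<in> UNIV \<times> {\<alpha>. length \<alpha> = N}. f (j # \<alpha>))"
    by (rule sum.reindex_bij_witness[of _ "\<lambda>(j, \<alpha>). j # \<alpha>" "\<lambda>\<alpha>. (hd \<alpha>, tl \<alpha>)"]) (auto simp: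
        length_Suc_conv)
  then show ?thesis
    by (simp add: sum.cartesian_product)
qed

lemma finite_words: "finite {\<alpha> :: 'd::finite list. length \<alpha>
    = N}" "finite {\<alpha> :: 'd::finite list. length \<alpha> \<le> N}"
  using finite_lists_length_eq[of "UNIV :: 'd set" N] finite_lists_length_le[of "UNIV :: 'd set"
      N] by auto

lemma finite_subset_words:
  assumes "finite (A :: 'd list set)"
  shows "\<exists>N. A \<subseteq> {\<alpha>. length \<alpha> \<le> N}"
  using finite_nat_set_iff_bounded_le[of "length ` A"] assms by (auto simp: Ball_def)

text \<open>Each letter contributes a factor \<open>q\<close>, so the words of length
  \<open>N\<close> contribute at most \<open>q ^ N\<close>, and the geometric series bounds every
  finite sum.\<close>

lemma nc_ball_words_summable:
  assumes Z: "Z \<in> nc_ball n" and i: "i < n" and l: "l < n"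
  shows "(\<lambda>\<alpha>. (cmod (word_mat n Z \<alpha> $$ (i, l)))\<^sup>2) summable_on UNIV"
proof -
  obtain q where q: "0 \<le> q" "q < 1"
    and b: "\<And>v. (\<Sum>j\<in>UNIV. \<Sum>l<n. (cmod (\<Sum>i<n. v i * Z j $$ (i, l)))\<^sup>2) \<le> q * (\<Sum>i<n. (cmod (v i))\<^sup>2)"
    using nc_ball_contraction[OF Z] by blast
  note car = nc_ball_carrier[OF Z]
  \<comment> \<open>All row vectors \<open>v\<close> are treated at once: stripping the first letter
    \<open>j\<close> replaces \<open>v\<close> by \<open>v\<close> times \<open>Z j\<close>.\<close>
  have words: "(\<Sum>\<alpha> | length \<alpha> = N. \<Sum>l<n. (cmod (\<Sum>i<n. v i * word_mat n Z \<alpha> $$ (i, l)))\<^sup>2)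
      \<le> q ^ N * (\<Sum>i<n. (cmod (v i))\<^sup>2)" for N v
  proof (induction N arbitrary: v)
    case 0
    have "(\<Sum>i<n. v i * 1\<^sub>m n $$ (i, l)) = v l" if "l < n" for l
    proof -
      have "(\<Sum>i<n. v i * 1\<^sub>m n $$ (i, l)) = (\<Sum>i<n. if i = l then v l else 0)"
        using that by (intro sum.cong) auto
      then show ?thesis
        using that by simp
    qed
    then show ?case
      by (simp add: words_of_length_0 del: length_0_conv)
  next
    case (Suc N)
    have step: "(\<Sum>i<n. v i * word_mat n Z (j # \<alpha>) $$ (i, l))
        = (\<Sum>k<n. (\<Sum>i<n. v i * Z j $$ (i, k)) * word_mat n Z \<alpha> $$ (k, l))" if "l < n" for j \<alpha> l
    proof -
      have "(\<Sum>i<n. v i * word_mat n Z (j # \<alpha>) $$ (i, l))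
          = (\<Sum>i<n. \<Sum>k<n. v i * Z j $$ (i, k) * word_mat n Z \<alpha> $$ (k, l))"
        using that car by (simp add: word_mat_Cons_index sum_distrib_left mult.assoc del:
            word_mat.simps)
      then show ?thesis
        by (subst (asm) sum.swap) (simp add: sum_distrib_right)
    qed
    have "(\<Sum>\<alpha> | length \<alpha> = Suc N. \<Sum>l<n. (cmod (\<Sum>i<n. v i * word_mat n Z \<alpha> $$ (i, l)))\<^sup>2)
        = (\<Sum>j\<in>UNIV. \<Sum>\<alpha> | length \<alpha> = N. \<Sum>l<n. (cmod (\<Sum>k<n. (\<Sum>i<n. v i * Z j $$ (i, k)) * word_mat n
            Z \<alpha> $$ (k, l)))\<^sup>2)"
      by (simp add: sum_words_Suc step del: word_mat.simps)
    also have "\<dots> \<le> (\<Sum>j\<in>UNIV. q ^ N * (\<Sum>k<n. (cmod (\<Sum>i<n. v i * Z j $$ (i, k)))\<^sup>2))"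
      by (intro sum_mono Suc.IH)
    also have "\<dots> \<le> q ^ N * (q * (\<Sum>i<n. (cmod (v i))\<^sup>2))"
      unfolding sum_distrib_left[symmetric] using q by (intro mult_left_mono b) auto
    finally show ?case
      by (simp add: mult.assoc mult.left_commute)
  qed
  have single: "(\<Sum>\<alpha> | length \<alpha> = N. (cmod (word_mat n Z \<alpha> $$ (i, l)))\<^sup>2) \<le> q ^ N" for N
  proof -
    \<comment> \<open>The \<open>i\<close>-th unit vector selects row \<open>i\<close> of the word
      product.\<close>
    let ?v = "\<lambda>k. if k = i then 1 else 0 :: complex"
    have e: "(\<Sum>k<n. ?v k * word_mat n Z \<alpha> $$ (k, l)) = word_mat n Z \<alpha> $$ (i, l)" for \<alpha> l
    proof -
      have "(\<Sum>k<n. ?v k * word_mat n Z \<alpha> $$ (k, l)) = (\<Sum>k<n. if k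
          = i then word_mat n Z \<alpha> $$ (k, l) else 0)"
        by (intro sum.cong) auto
      then show ?thesis
        using i by simp
    qed
    have "(\<Sum>k<n. (cmod (?v k))\<^sup>2) = (\<Sum>k<n. if k = i then 1 else 0)"
      by (intro sum.cong) auto
    then have "(\<Sum>k<n. (cmod (?v k))\<^sup>2) = 1"
      using i by simp
    then have "(\<Sum>\<alpha> | length \<alpha> = N. \<Sum>l<n. (cmod (word_mat n Z \<alpha> $$ (i, l)))\<^sup>2) \<le> q ^ N"
      using words[of ?v N] unfolding e by simp
    moreover have "(\<Sum>\<alpha> | length \<alpha> = N. (cmod (word_mat n Z \<alpha> $$ (i, l)))\<^sup>2)
        \<le> (\<Sum>\<alpha> | length \<alpha> = N. \<Sum>l<n. (cmod (word_mat n Z \<alpha> $$ (i, l)))\<^sup>2)"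
      using l by (intro sum_mono member_le_sum) auto
    ultimately show ?thesis
      by linarith
  qed
  show ?thesis
  proof (rule nonneg_bdd_above_summable_on)
    show "bdd_above (sum (\<lambda>\<alpha>. (cmod (word_mat n Z \<alpha> $$ (i, l)))\<^sup>2) ` {F. F \<subseteq> UNIV \<and> finite F})"
    proof (rule bdd_aboveI2)
      fix F assume F: "F \<in> {F :: 'a list set. F \<subseteq> UNIV \<and> finite F}"
      then obtain N where N: "F \<subseteq> {\<alpha>. length \<alpha> \<le> N}"
        using finite_subset_words by blast
      have "(\<Sum>\<alpha>\<in>F. (cmod (word_mat n Z \<alpha> $$ (i, l)))\<^sup>2) \<le> (\<Sum>\<alpha> | length \<alpha>
          \<le> N. (cmod (word_mat n Z \<alpha> $$ (i, l)))\<^sup>2)"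
        using N by (intro sum_mono2 finite_words) auto
      also have "{\<alpha> :: 'a list. length \<alpha> \<le> N} = (\<Union>k\<le>N. {\<alpha>. length \<alpha> = k})"
        by auto
      also have "(\<Sum>\<alpha>\<in>\<dots>. (cmod (word_mat n Z \<alpha> $$ (i, l)))\<^sup>2)
          = (\<Sum>k\<le>N. \<Sum>\<alpha> | length \<alpha> = k. (cmod (word_mat n Z \<alpha> $$ (i, l)))\<^sup>2)"
        by (intro sum.UNION_disjoint) (auto simp: finite_words)
      also have "\<dots> \<le> (\<Sum>k\<le>N. q ^ k)"
        by (intro sum_mono single)
      also have "\<dots> \<le> (\<Sum>k. q ^ k)"
        using q by (intro sum_le_suminf summable_geometric) auto
      finally show "(\<Sum>\<alpha>\<in>F. (cmod (word_mat n Z \<alpha> $$ (i, l)))\<^sup>2) \<le> (\<Sum>k. q ^ k)" .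
    qed
  qed simp
qed

section \<open>Direct sums and similarities\<close>

lemma sum_lessThan_add: "(\<Sum>i<n + m. f i) = (\<Sum>i<n. f i) + (\<Sum>i<m. f (n + i))"
    for f :: "nat \<Rightarrow> 'b::comm_monoid_add"
  by (induction m) (auto simp: add.assoc)

abbreviation direct_sum :: "nat \<Rightarrow> nat \<Rightarrow> ('d \<Rightarrow> complex mat) \<Rightarrow> ('d \<Rightarrow> complex mat) \<Rightarrow> 'd \<Rightarrow> complex
    mat" where
  "direct_sum n m X Y \<equiv> \<lambda>j. four_block_mat (X j) (0\<^sub>m n m) (0\<^sub>m m n) (Y j)"

text \<open>The Gram matrix of the rows is block diagonal, so the larger of the two contraction
  constants serves for both blocks.\<close>

lemma nc_ball_direct_sum:
  assumes X: "X \<in> nc_ball n" and Y: "Y \<in> nc_ball m"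
  shows "direct_sum n m X Y \<in> nc_ball (n + m)"
  unfolding nc_ball_iff
proof (intro conjI allI)
  note car = nc_ball_carrier[OF X] nc_ball_carrier[OF Y]
  show "1 \<le> n + m"
    using X by (simp add: nc_ball_iff)
  show "direct_sum n m X Y j \<in> carrier_mat (n + m) (n + m)" for j
    using car by (intro four_block_carrier_mat) auto
  obtain p where p: "0 \<le> p" "p < 1"
    "\<And>v. L2_set (\<lambda>i. cmod (\<Sum>k<n. row_gram n X i k * v k)) {..<n}
        \<le> p * L2_set (\<lambda>i. cmod (v i)) {..<n}"
    using X unfolding nc_ball_iff by blast
  obtain q where q: "0 \<le> q" "q < 1"
    "\<And>v. L2_set (\<lambda>i. cmod (\<Sum>k<m. row_gram m Y i k * v k)) {..<m}
        \<le> q * L2_set (\<lambda>i. cmod (v i)) {..<m}"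
    using Y unfolding nc_ball_iff by blast
  let ?G = "row_gram (n + m) (direct_sum n m X Y)"
  have idx: "direct_sum n m X Y j $$ (i, k) = (if i < n then if k < n then X j $$ (i, k) else 0
      else if k < n then 0 else Y j $$ (i - n, k - n))" if "i < n + m" "k < n + m" for i j k
    using car[of j] that by auto
  have G: "?G i k = row_gram n X i k" "?G (n + i') (n + k') = row_gram m Y i' k'" "?G i (n + k')
      = 0" "?G (n + i') k = 0"
    if "i < n" "k < n" "i' < m" "k' < m" for i k i' k'
    using that by (simp_all add: row_gram_def sum_lessThan_add idx)
  \<comment> \<open>\<open>G\<close> presupposes indices in both blocks; this fact and the next give
    the diagonal blocks without an index from the other one.\<close>
  have G': "?G i k = row_gram n X i k" if "i < n" "k < n" for i k
    using that by (simp add: row_gram_def sum_lessThan_add idx)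
  have G'': "?G (n + i') (n + k') = row_gram m Y i' k'" if "i' < m" "k' < m" for i' k'
    using that by (simp add: row_gram_def sum_lessThan_add idx)
  define r where "r = max p q"
  have "L2_set (\<lambda>i. cmod (\<Sum>k<n + m. ?G i k * v k)) {..<n + m} \<le> r * L2_set (\<lambda>i. cmod (v i)) {..<n
      + m}" for v
  proof (rule power2_le_imp_le)
    have 1: "(\<Sum>k<n + m. ?G i k * v k) = (\<Sum>k<n. row_gram n X i k * v k)" if "i < n" for i
      using that G by (auto simp: sum_lessThan_add G' intro!: sum.neutral)
    have 2: "(\<Sum>k<n + m. ?G (n + i) k * v k) = (\<Sum>k<m. row_gram m Y i k * v (n + k))" if "i < m" for i
      using that G by (auto simp: sum_lessThan_add G'' intro!: sum.neutral)
    have "(L2_set (\<lambda>i. cmod (\<Sum>k<n + m. ?G i k * v k)) {..<n + m})\<^sup>2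
        = (L2_set (\<lambda>i. cmod (\<Sum>k<n. row_gram n X i k * v k)) {..<n})\<^sup>2
          + (L2_set (\<lambda>i. cmod (\<Sum>k<m. row_gram m Y i k * v (n + k))) {..<m})\<^sup>2"
    proof -
      define f where "f i = (cmod (\<Sum>k<n + m. ?G i k * v k))\<^sup>2" for i
      have "(\<Sum>i<n + m. f i) = (\<Sum>i<n. f i) + (\<Sum>i<m. f (n + i))"
        by (rule sum_lessThan_add)
      also have "\<dots> = (\<Sum>i<n. (cmod (\<Sum>k<n. row_gram n X i k * v k))\<^sup>2)
          + (\<Sum>i<m. (cmod (\<Sum>k<m. row_gram m Y i k * v (n + k)))\<^sup>2)"
        unfolding f_def by (intro arg_cong2[of _ _ _ _ "(+)"] sum.cong) (simp_all add: 1 2)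
      finally show ?thesis
        unfolding L2_set_def f_def by (simp add: sum_nonneg)
    qed
    also have "\<dots> \<le> (p * L2_set (\<lambda>i. cmod (v i)) {..<n})\<^sup>2 + (q * L2_set (\<lambda>i. cmod (v (n
        + i))) {..<m})\<^sup>2"
      by (intro add_mono power_mono p q) auto
    also have "\<dots> \<le> (r * L2_set (\<lambda>i. cmod (v i)) {..<n})\<^sup>2 + (r * L2_set (\<lambda>i. cmod (v (n
        + i))) {..<m})\<^sup>2"
      using p q by (intro add_mono power_mono mult_right_mono) (auto simp: r_def)
    also have "\<dots> = (r * L2_set (\<lambda>i. cmod (v i)) {..<n + m})\<^sup>2"
      unfolding L2_set_def power_mult_distrib
          by (simp add: sum_nonneg sum_lessThan_add[of _ n m] distrib_left)
    finally show "(L2_set (\<lambda>i. cmod (\<Sum>k<n + m. ?G i k * v k)) {..<n + m})\<^sup>2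
        \<le> (r * L2_set (\<lambda>i. cmod (v i)) {..<n + m})\<^sup>2" .
    show "0 \<le> r * L2_set (\<lambda>i. cmod (v i)) {..<n + m}"
      using p by (simp add: r_def le_max_iff_disj)
  qed
  then show "\<exists>q\<ge>0. q < 1 \<and> (\<forall>v. L2_set (\<lambda>i. cmod (\<Sum>k<n + m. ?G i k * v k)) {..<n + m}
      \<le> q * L2_set (\<lambda>i. cmod (v i)) {..<n + m})"
    using p q by (intro exI[of _ r]) (auto simp: r_def)
qed

lemma word_mat_direct_sum:
  assumes X: "\<And>j. X j \<in> carrier_mat n n" and Y: "\<And>j. Y j \<in> carrier_mat m m"
  shows "word_mat (n + m) (direct_sum n m X Y) \<alpha>
    = four_block_mat (word_mat n X \<alpha>) (0\<^sub>m n m) (0\<^sub>m m n) (word_mat m Y \<alpha>)"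
proof (induction \<alpha>)
  case (Cons j \<alpha>)
  have "word_mat n X \<alpha> \<in> carrier_mat n n" "word_mat m Y \<alpha> \<in> carrier_mat m m"
    using X Y by (auto intro: word_mat_carrier)
  then show ?case
    using Cons X[of j] Y[of j] by (simp add: mult_four_block_mat[of _ n n _ m _ m _ _ n _ m])
qed simp

lemma word_mat_similar:
  assumes X: "\<And>j. X j \<in> carrier_mat n n" and S: "S \<in> carrier_mat n n" "S' \<in> carrier_mat n n"
    and inv: "S * S' = 1\<^sub>m n" "S' * S = 1\<^sub>m n"
  shows "word_mat n (\<lambda>j. S' * X j * S) \<alpha> = S' * word_mat n X \<alpha> * S"
proof (induction \<alpha>)
  case (Cons j \<alpha>)
  have W: "word_mat n X \<alpha> \<in> carrier_mat n n"
    by (rule word_mat_carrier) (rule X)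
  have "S' * X j * S * (S' * word_mat n X \<alpha> * S) = S' * X j * ((S * S') * (word_mat n X \<alpha> * S))"
    using S X[of j] W by (simp add: assoc_mult_mat[of _ n n _ n _ n])
  also have "\<dots> = S' * (X j * word_mat n X \<alpha>) * S"
    unfolding inv using S X[of j] W by (simp add: assoc_mult_mat[of _ n n _ n _ n])
  finally show ?case
    using Cons by simp
qed (use S inv in simp)

text \<open>The compression of the left creation operators to the words of length at most \<open>N\<close>,
  scaled into the ball: a nilpotent point at which matrix entries isolate single coefficients.\<close>

definition trunc_shift :: "nat \<Rightarrow> (nat \<Rightarrow> 'd list) \<Rightarrow> 'd \<Rightarrow> complex mat" where
  "trunc_shift n h j = mat n n (\<lambda>(p, q). if h p = j # h q then 1/2 else 0)"

text \<open>For injective \<open>h\<close>, different rows are orthogonal and each row has at most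
  one nonzero entry over all \<open>j\<close>. The Gram matrix is therefore diagonal with entries 0
  or \<open>1/4\<close>, the square of the scaling factor \<open>1/2\<close>.\<close>

lemma trunc_shift_in_ball:
  fixes h :: "nat \<Rightarrow> 'd::finite list"
  assumes n: "1 \<le> n" and inj: "inj_on h {..<n}"
  shows "trunc_shift n h \<in> nc_ball n"
  unfolding nc_ball_iff
proof (intro conjI allI exI[of _ "1/4"])
  show "trunc_shift n h j \<in> carrier_mat n n" for j
    by (simp add: trunc_shift_def)
  have idx: "trunc_shift n h j $$ (p, q) = (if h p = j # h q then 1/2 else 0)" if "p < n" "q < n"
      for p q j
    using that by (simp add: trunc_shift_def)
  have diag: "row_gram n (trunc_shift n h) i k = 0" if "i < n" "k < n" "i \<noteq> k" for i k
    using that inj_onD[OF inj, of i k] by (auto simp: row_gram_def idx intro!: sum.neutral)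
  have le: "cmod (row_gram n (trunc_shift n h) i i) \<le> 1/4" if i: "i < n" for i
  proof (cases "\<exists>j q. q < n \<and> h i = j # h q")
    case True
    then obtain j q where jq: "q < n" "h i = j # h q"
      by blast
    have "row_gram n (trunc_shift n h) i i = (\<Sum>j'\<in>UNIV. \<Sum>l<n. if j' = j \<and> l = q then 1/4 else 0)"
      unfolding row_gram_def using i jq inj_onD[OF inj, of q]
          by (intro sum.cong refl) (auto simp: idx)
    also have "\<dots> = (\<Sum>j'\<in>UNIV. if j' = j then 1/4 else 0)"
      using jq by (intro sum.cong refl) auto
    finally have *: "row_gram n (trunc_shift n h) i i = 1/4"
      by simp
    show ?thesis
      unfolding * by (simp add: norm_divide)
  next
    case False
    then have "row_gram n (trunc_shift n h) i i = 0"
      using i by (auto simp: row_gram_def idx intro!: sum.neutral)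
    then show ?thesis
      by simp
  qed
  fix v
  have "(\<Sum>k<n. row_gram n (trunc_shift n h) i k * v k) = row_gram n (trunc_shift n h) i i * v i"
      if "i < n" for i
  proof -
    have "(\<Sum>k<n. row_gram n (trunc_shift n h) i k * v k) = (\<Sum>k<n. if k
        = i then row_gram n (trunc_shift n h) i i * v i else 0)"
      using that diag by (intro sum.cong) auto
    then show ?thesis
      using that by simp
  qed
  then have "L2_set (\<lambda>i. cmod (\<Sum>k<n. row_gram n (trunc_shift n h) i k * v k)) {..<n}
      \<le> L2_set (\<lambda>i. (1/4) * cmod (v i)) {..<n}"
    using mult_right_mono[OF le norm_ge_zero] by (intro L2_set_mono) (auto simp: norm_mult)
  also have "\<dots> = (1/4) * L2_set (\<lambda>i. cmod (v i)) {..<n}"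
    by (subst L2_set_right_distrib) auto
  finally show "L2_set (\<lambda>i. cmod (\<Sum>k<n. row_gram n (trunc_shift n h) i k * v k)) {..<n}
      \<le> (1/4) * L2_set (\<lambda>i. cmod (v i)) {..<n}" .
qed (use n in auto)

text \<open>The generator \<open>j\<close> leads from the word \<open>h q\<close> to
  \<open>j # h q\<close> at the cost of a factor \<open>1/2\<close>, so the product along
  \<open>\<alpha>\<close> leads to \<open>\<alpha> @ h q\<close> as long as all intermediate words
  are enumerated.\<close>

lemma word_mat_trunc_shift:
  fixes h :: "nat \<Rightarrow> 'd::finite list"
  assumes h: "bij_betw h {..<n} {\<alpha>. length \<alpha> \<le> N}" and pq: "p < n" "q < n"
  shows "word_mat n (trunc_shift n h) \<alpha> $$ (p, q) = (if h p = \<alpha> @ h q then (1/2) ^ length \<alpha> else 0)"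
  using pq
proof (induction \<alpha> arbitrary: p)
  case Nil
  then show ?case
    using bij_betw_imp_inj_on[OF h] by (auto simp: inj_on_def)
next
  case (Cons j \<alpha>)
  have car: "trunc_shift n h j \<in> carrier_mat n n" for j
    by (simp add: trunc_shift_def)
  have idx: "trunc_shift n h j $$ (p, q) = (if h p = j # h q then 1/2 else 0)" if "p < n" "q < n"
      for p q j
    using that by (simp add: trunc_shift_def)
  have sum: "word_mat n (trunc_shift n h) (j # \<alpha>) $$ (p, q)
      = (\<Sum>k<n. if h p = j # h k \<and> h k = \<alpha> @ h q then (1/2) ^ Suc (length \<alpha>) else 0)"
    unfolding word_mat_Cons_index[of "trunc_shift n h", OF car Cons.prems]
    using Cons by (intro sum.cong refl) (auto simp: idx)
  show ?case
  proof (cases "h p = (j # \<alpha>) @ h q")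
    case True
    \<comment> \<open>A suffix of a word of length at most \<open>N\<close> is again such a word, so
      the intermediate word \<open>\<alpha> @ h q\<close> is the value of \<open>h\<close> at some
      index.\<close>
    have "length (h p) \<le> N"
      using bij_betwE[OF h] Cons.prems by auto
    then have "\<alpha> @ h q \<in> h ` {..<n}"
      using True unfolding bij_betw_imp_surj_on[OF h] by simp
    then obtain k where k: "k < n" "h k = \<alpha> @ h q"
      by auto
    have "word_mat n (trunc_shift n h) (j # \<alpha>) $$ (p, q) = (\<Sum>l<n. if l
        = k then (1/2) ^ Suc (length \<alpha>) else 0)"
      unfolding sum
    proof (intro sum.cong refl)
      fix l assume "l \<in> {..<n}"
      then have "h l = \<alpha> @ h q \<longleftrightarrow> l = k"
        using k inj_onD[OF bij_betw_imp_inj_on[OF h], of l k] by auto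
      then show "(if h p = j # h l \<and> h l = \<alpha> @ h q then (1/2) ^ Suc (length \<alpha>) else 0)
          = (if l = k then (1/2) ^ Suc (length \<alpha>) else 0 :: complex)"
        using True k by (simp only: append_Cons) simp
    qed
    then show ?thesis
      using k True by simp
  next
    case False
    then have "word_mat n (trunc_shift n h) (j # \<alpha>) $$ (p, q) = 0"
      unfolding sum by (intro sum.neutral) auto
    then show ?thesis
      using False by simp
  qed
qed

text \<open>Truncating at \<open>length \<gamma>\<close> enumerates both \<open>\<gamma>\<close> and
  the empty word. The entry in row \<open>\<gamma>\<close> and column \<open>[]\<close> is nonzero
  only if \<open>\<gamma> = \<alpha> @ []\<close>.\<close>

lemma isolating_point:
  fixes \<gamma> :: "'d::finite list"
  shows "\<exists>n Z p q. Z \<in> nc_ball n \<and> p < n \<and> q < n \<and>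
    (\<forall>\<alpha>. word_mat n Z \<alpha> $$ (p, q) = (if \<alpha> = \<gamma> then (1/2) ^ length \<gamma> else 0))"
proof -
  let ?U = "{\<alpha> :: 'd list. length \<alpha> \<le> length \<gamma>}"
  obtain h where h: "bij_betw h {..<card ?U} ?U"
    using ex_bij_betw_nat_finite[OF finite_words(2)] by (auto simp: atLeast0LessThan)
  then have "\<gamma> \<in> h ` {..<card ?U}" "[] \<in> h ` {..<card ?U}"
    by (auto simp: bij_betw_def)
  then obtain p q where pq: "p < card ?U" "h p = \<gamma>" "q < card ?U" "h q = []"
    by auto
  show ?thesis
  proof (intro exI conjI allI)
    show "trunc_shift (card ?U) h \<in> nc_ball (card ?U)"
      using pq bij_betw_imp_inj_on[OF h] by (intro trunc_shift_in_ball) auto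
    show "word_mat (card ?U) (trunc_shift (card ?U) h) \<alpha> $$ (p, q) = (if \<alpha>
        = \<gamma> then (1/2) ^ length \<gamma> else 0)" for \<alpha>
      unfolding word_mat_trunc_shift[OF h pq(1,3)] pq(2,4) by auto
  qed (use pq in auto)
qed

section \<open>Power series and the Drury--Arveson space\<close>

lemma sum_fun_apply: "(\<Sum>i\<in>A. f i) x = (\<Sum>i\<in>A. f i x)"
  by (induction A rule: infinite_finite_induct) auto

lemma drury_arveson_simps:
  "hcarrier (drury_arveson E) = {f. nc_function (hscale E) (hcarrier E) f \<and> (\<exists>c. nc_series E c f)}"
  "hscale (drury_arveson E) = (\<lambda>a f Z i j. hscale E a (f Z i j))"
  "hinner (drury_arveson E) = (\<lambda>f g. \<Sum>\<^sub>\<infinity>\<alpha>. hinner E (nc_coeff E f \<alpha>) (nc_coeff E g \<alpha>))"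
  by (simp_all add: drury_arveson_def)

context hilbert_space
begin

lemma nc_function_mem:
  assumes f: "nc_function (hscale E) (hcarrier E) f"
  shows "f Z i j \<in> hcarrier E"
proof (cases "\<exists>n. Z \<in> nc_ball n \<and> i < n \<and> j < n")
  case True
  then show ?thesis
    using f by (auto simp: nc_function_def nmat_def)
next
  case False
  then have "f Z i j = 0"
    using f by (cases "Z \<in> (\<Union>n. nc_ball n)") (auto simp: nc_function_def nmat_def)
  then show ?thesis
    by simp
qed

lemma nc_series_iff:
  assumes "\<And>Z i j. f Z i j \<in> hcarrier E"
  shows "nc_series E c f \<longleftrightarrow> sq_summable E c \<and>
    (\<forall>n. \<forall>Z\<in>nc_ball n. \<forall>i<n. \<forall>j<n. hsum (\<lambda>\<alpha>. word_mat n Z \<alpha> $$ (i, j)) c (f Z i j))"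
  using assms by (auto simp: nc_series_def sq_summable_def hsum_def)

text \<open>Inverse of \<open>nc_coeff\<close>. A point carries no size, so the size is read off one
  component; \<open>undefined\<close> is merely some index, and all components of a point of the
  ball have the same size.\<close>

definition synth :: "('d::finite list \<Rightarrow> 'v) \<Rightarrow> ('d, 'v) nc_fun" where
  "synth c = (\<lambda>Z i j. if \<exists>n. Z \<in> nc_ball n \<and> i < n \<and> j < n
     then THE x. hsum (\<lambda>\<alpha>. word_mat (dim_row (Z undefined)) Z \<alpha> $$ (i, j)) c x else 0)"

lemma synth_eqI:
  assumes c: "\<And>\<alpha>. c \<alpha> \<in> hcarrier E" and Z: "Z \<in> nc_ball n" "i < n" "j < n"
    and x: "hsum (\<lambda>\<alpha>. word_mat n Z \<alpha> $$ (i, j)) c x"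
  shows "synth c Z i j = x"
proof -
  have "dim_row (Z undefined) = n"
    using nc_ball_carrier[OF Z(1)] by auto
  then have "synth c Z i j = (THE x. hsum (\<lambda>\<alpha>. word_mat n Z \<alpha> $$ (i, j)) c x)"
    using Z by (auto simp: synth_def)
  also have "\<dots> = x"
    using x hsum_unique[where c = c, OF c] by blast
  finally show ?thesis .
qed

lemma synth_hsum:
  assumes c: "sq_summable E c" and Z: "Z \<in> nc_ball n" "i < n" "j < n"
  shows "hsum (\<lambda>\<alpha>. word_mat n Z \<alpha> $$ (i, j)) c (synth c Z i j)"
proof -
  obtain x where "hsum (\<lambda>\<alpha>. word_mat n Z \<alpha> $$ (i, j)) c x"
    using hsum_exists[OF nc_ball_words_summable[OF Z] c] by blast
  then show ?thesis
    using synth_eqI[OF sq_summable_mem[OF c] Z] by simp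
qed

lemma synth_outside:
  "Z \<notin> (\<Union>n. nc_ball n) \<Longrightarrow> synth c Z = 0"
  "Z \<in> nc_ball n \<Longrightarrow> \<not> (i < n \<and> j < n) \<Longrightarrow> synth c Z i j = 0"
  by (auto simp: synth_def fun_eq_iff dest: nc_ball_size_unique)

lemma synth_mem:
  assumes c: "sq_summable E c"
  shows "synth c Z i j \<in> hcarrier E"
proof (cases "\<exists>n. Z \<in> nc_ball n \<and> i < n \<and> j < n")
  case True
  then show ?thesis
    using synth_hsum[OF c] by (auto simp: hsum_def)
qed (auto simp: synth_def)

text \<open>At a direct sum or at a similar point, the entries of a word product are linear
  combinations of entries at the given points, with scalars that do not depend on the word. The
  identities thus hold weight by weight and pass to the sums.\<close>

lemma synth_nc_function:
  fixes c :: "'d::finite list \<Rightarrow> 'v"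
  assumes c: "sq_summable E c"
  shows "nc_function (hscale E) (hcarrier E) (synth c)"
  unfolding nc_function_def
proof (intro conjI allI ballI impI)
  fix X :: "'d \<Rightarrow> complex mat" and n assume X: "X \<in> nc_ball n"
  show "synth c X \<in> nmat n (hcarrier E)"
    using synth_mem[OF c] synth_outside(2)[OF X] by (simp add: nmat_def)
next
  fix X Y :: "'d \<Rightarrow> complex mat" and n m assume X: "X \<in> nc_ball n" and Y: "Y \<in> nc_ball m"
  note XY = nc_ball_direct_sum[OF X Y]
  have idx: "word_mat (n + m) (direct_sum n m X Y) \<alpha> $$ (i, j)
      = (if i < n then if j < n then word_mat n X \<alpha> $$ (i, j) else 0
         else if j < n then 0 else word_mat m Y \<alpha> $$ (i - n, j - n))"
    if "i < n + m" "j < n + m" for \<alpha> i j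
    using that word_mat_carrier[of X n \<alpha>, OF nc_ball_carrier[OF X]] word_mat_carrier[of Y m \<alpha>, OF
        nc_ball_carrier[OF Y]]
    by (subst word_mat_direct_sum[OF nc_ball_carrier[OF X] nc_ball_carrier[OF Y]]) auto
  have "synth c (direct_sum n m X Y) i j = nmat_sum n (synth c X) (synth c Y) i j" for i j
  proof (cases "i < n + m \<and> j < n + m")
    case True
    show ?thesis
    proof (rule synth_eqI[OF sq_summable_mem[OF c] XY])
      show "hsum (\<lambda>\<alpha>. word_mat (n + m) (direct_sum n m X Y) \<alpha> $$ (i, j)) c (nmat_sum n (synth c X)
          (synth c Y) i j)"
        using True synth_hsum[OF c X, of i j] synth_hsum[OF c Y, of "i - n" "j - n"]
            sq_summable_mem[OF c]
        by (auto simp: idx nmat_sum_def intro: hsum_zero)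
    qed (use True in auto)
  next
    case False
    then have "synth c Y (i - n) (j - n) = 0" if "n \<le> i" "n \<le> j"
      using that by (intro synth_outside(2)[OF Y]) linarith
    then show ?thesis
      using False synth_outside(2)[OF XY, of i j c] by (auto simp: nmat_sum_def)
  qed
  then show "synth c (direct_sum n m X Y) = nmat_sum n (synth c X) (synth c Y)"
    by (intro ext)
next
  fix X :: "'d \<Rightarrow> complex mat" and n S S'
  assume X: "X \<in> nc_ball n" and S: "S \<in> carrier_mat n n" "S' \<in> carrier_mat n n"
    and inv: "S * S' = 1\<^sub>m n \<and> S' * S = 1\<^sub>m n \<and> (\<lambda>j. S' * X j * S) \<in> nc_ball n"
  have W: "word_mat n X \<alpha> \<in> carrier_mat n n" for \<alpha>
    by (rule word_mat_carrier) (rule nc_ball_carrier[OF X])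
  have idx: "word_mat n (\<lambda>j. S' * X j * S) \<alpha> $$ (i, j)
      = (\<Sum>k<n. S $$ (k, j) * (\<Sum>l<n. S' $$ (i, l) * word_mat n X \<alpha> $$ (l, k)))"
    if "i < n" "j < n" for \<alpha> i j
  proof -
    have "(S' * word_mat n X \<alpha> * S) $$ (i, j) = (\<Sum>k<n. (S' * word_mat n X \<alpha>) $$ (i, k) * S $$ (k,
        j))"
      using S W[of \<alpha>] that by (intro mat_mult_index mult_carrier_mat[of _ n n]) auto
    also have "\<dots> = (\<Sum>k<n. S $$ (k, j) * (\<Sum>l<n. S' $$ (i, l) * word_mat n X \<alpha> $$ (l, k)))"
      using that by (intro sum.cong refl) (simp add: mat_mult_index[OF S(2) W] mult.commute del:
          index_mult_mat)
    finally show ?thesis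
      using inv by (simp add: word_mat_similar[OF nc_ball_carrier[OF X] S])
  qed
  have "synth c (\<lambda>j. S' * X j * S) i j = rmult (hscale E) (lmult (hscale E) S' (synth c X)) S i j"
      for i j
  proof (cases "i < n \<and> j < n")
    case True
    show ?thesis
    proof (rule synth_eqI[OF sq_summable_mem[OF c] conjunct2[OF conjunct2[OF inv]]])
      have "hsum (\<lambda>\<alpha>. \<Sum>k<n. S $$ (k, j) * (\<Sum>l<n. S' $$ (i, l) * word_mat n X \<alpha> $$ (l, k))) c
          (\<Sum>k<n. hscale E (S $$ (k, j)) (\<Sum>l<n. hscale E (S' $$ (i, l)) (synth c X l k)))"
        using sq_summable_mem[OF c] by (intro hsum_lincomb synth_hsum[OF c X]) auto
      then show "hsum (\<lambda>\<alpha>. word_mat n (\<lambda>j. S' * X j * S) \<alpha> $$ (i, j)) c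
          (rmult (hscale E) (lmult (hscale E) S' (synth c X)) S i j)"
        using True S by (simp add: idx rmult_def lmult_def)
    qed (use True in auto)
  next
    case False
    then show ?thesis
      using synth_outside(2)[OF conjunct2[OF conjunct2[OF inv]], of i j c] S
      by (auto simp: rmult_def lmult_def)
  qed
  then show "synth c (\<lambda>j. S' * X j * S) = rmult (hscale E) (lmult (hscale E) S' (synth c X)) S"
    by (intro ext)
qed (use synth_outside(1) in auto)

lemma nc_series_synth: "sq_summable E c \<Longrightarrow> nc_series E c (synth c)"
  by (simp add: nc_series_iff synth_mem synth_hsum)

lemma synth_in_drury_arveson: "sq_summable E c \<Longrightarrow> synth c \<in> hcarrier (drury_arveson E)"
  using synth_nc_function nc_series_synth by (auto simp: drury_arveson_simps)

text \<open>At a point isolating \<open>\<gamma>\<close> only one weight is nonzero, namely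
  \<open>(1/2) ^ length \<gamma>\<close>, so a single entry of the value of \<open>f\<close>
  determines the coefficient at \<open>\<gamma>\<close>.\<close>

lemma nc_series_unique:
  fixes f :: "('d::finite, 'v) nc_fun"
  assumes f: "\<And>Z i j. f Z i j \<in> hcarrier E" and c: "nc_series E c f" and d: "nc_series E d f"
  shows "c = d"
proof
  fix \<gamma> :: "'d list"
  obtain n Z p q where pq: "Z \<in> nc_ball n" "p < n" "q < n"
    and iso: "\<And>\<alpha>. word_mat n Z \<alpha> $$ (p, q) = (if \<alpha> = \<gamma> then (1/2) ^ length \<gamma> else 0)"
    using isolating_point[of \<gamma>] by auto
  have "f Z p q = hscale E ((1/2) ^ length \<gamma>) (b \<gamma>)" if b: "nc_series E b f" for b
  proof -
    have mem: "b \<alpha> \<in> hcarrier E" for \<alpha>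
      using b by (simp add: nc_series_def)
    have "hsum (\<lambda>\<alpha>. word_mat n Z \<alpha> $$ (p, q)) b (f Z p q)"
      using b pq by (simp add: nc_series_iff[OF f])
    moreover have "hsum (\<lambda>\<alpha>. word_mat n Z \<alpha> $$ (p, q)) b (\<Sum>\<alpha>\<in>{\<gamma>}. hscale E (word_mat n Z \<alpha> $$ (p,
        q)) (b \<alpha>))"
      by (rule hsum_finite_support) (auto simp: mem iso)
    ultimately have "f Z p q = (\<Sum>\<alpha>\<in>{\<gamma>}. hscale E (word_mat n Z \<alpha> $$ (p, q)) (b \<alpha>))"
      by (rule hsum_unique[rotated]) (rule mem)
    then show ?thesis
      by (simp add: iso)
  qed
  then have "hscale E ((1/2) ^ length \<gamma>) (c \<gamma>) = hscale E ((1/2) ^ length \<gamma>) (d \<gamma>)"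
    using c d by metis
  then show "c \<gamma> = d \<gamma>"
    by (simp add: scale_cancel_left)
qed

lemma nc_coeff_eqI:
  assumes f: "f \<in> hcarrier (drury_arveson E)" and c: "nc_series E c f"
  shows "nc_coeff E f = c"
proof -
  have "f Z i j \<in> hcarrier E" for Z i j
    using f nc_function_mem by (auto simp: drury_arveson_simps)
  then have "d = c" if "nc_series E d f" for d
    using nc_series_unique that c by blast
  then show ?thesis
    unfolding nc_coeff_def using c by blast
qed

lemma nc_coeff_synth: "sq_summable E c \<Longrightarrow> nc_coeff E (synth c) = c"
  using nc_coeff_eqI[OF synth_in_drury_arveson nc_series_synth] by blast

text \<open>On the ball the series determines the values; elsewhere, and outside the index range,
  \<open>nc_function\<close> forces zero.\<close>

lemma nc_series_imp_synth:
  assumes f: "f \<in> hcarrier (drury_arveson E)" and c: "nc_series E c f"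
  shows "f = synth c"
proof (intro ext)
  fix Z i j
  have nf: "nc_function (hscale E) (hcarrier E) f"
    using f by (simp add: drury_arveson_simps)
  have h: "sq_summable E c" "\<And>n. Z \<in> nc_ball n \<Longrightarrow> i < n \<Longrightarrow> j < n
      \<Longrightarrow> hsum (\<lambda>\<alpha>. word_mat n Z \<alpha> $$ (i, j)) c (f Z i j)"
    using c by (auto simp: nc_series_iff[OF nc_function_mem[OF nf]])
  show "f Z i j = synth c Z i j"
  proof (cases "\<exists>n. Z \<in> nc_ball n \<and> i < n \<and> j < n")
    case True
    then show ?thesis
      using synth_eqI[where c = c, OF sq_summable_mem[OF h(1)]] h(2)
          by (auto intro!: sym[of "synth c Z i j"])
  next
    case False
    then show ?thesis
      using nf by (cases "Z \<in> (\<Union>n. nc_ball n)") (auto simp: nc_function_def nmat_def synth_def)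
  qed
qed

lemma drury_arveson_coeff:
  assumes "f \<in> hcarrier (drury_arveson E)"
  shows "sq_summable E (nc_coeff E f)" "synth (nc_coeff E f) = f"
proof -
  obtain c where c: "nc_series E c f"
    using assms by (auto simp: drury_arveson_simps)
  then have "nc_coeff E f = c" "sq_summable E c" "f = synth c"
    using nc_coeff_eqI[OF assms] nc_series_imp_synth[OF assms]
        by (auto simp: nc_series_def sq_summable_def)
  then show "sq_summable E (nc_coeff E f)" "synth (nc_coeff E f) = f"
    by auto
qed

section \<open>Linearity of the correspondence between functions and coefficients\<close>

lemma synth_add:
  fixes c d :: "'d::finite list \<Rightarrow> 'v"
  assumes c: "sq_summable E c" and d: "sq_summable E d"
  shows "synth (\<lambda>\<alpha>. c \<alpha> + d \<alpha>) = synth c + synth d"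
proof (intro ext)
  fix Z :: "'d \<Rightarrow> complex mat" and i j
  note cd = sq_summable_add[OF c d]
  show "synth (\<lambda>\<alpha>. c \<alpha> + d \<alpha>) Z i j = (synth c + synth d) Z i j"
  proof (cases "\<exists>n. Z \<in> nc_ball n \<and> i < n \<and> j < n")
    case True
    then obtain n where n: "Z \<in> nc_ball n" "i < n" "j < n"
      by blast
    have "hsum (\<lambda>\<alpha>. word_mat n Z \<alpha> $$ (i, j)) (\<lambda>\<alpha>. c \<alpha> + d \<alpha>) (synth c Z i j + synth d Z i j)"
      by (rule hsum_add_general[OF sq_summable_mem[OF c] sq_summable_mem[OF d] synth_hsum[OF c n]
          synth_hsum[OF d n]])
        (rule scale_right_distrib)
    then show ?thesis
      using synth_eqI[OF sq_summable_mem[OF cd] n] by simp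
  qed (auto simp: synth_def)
qed

lemma synth_scale:
  fixes c :: "'d::finite list \<Rightarrow> 'v"
  assumes c: "sq_summable E c"
  shows "synth (\<lambda>\<alpha>. hscale E a (c \<alpha>)) = hscale (drury_arveson E) a (synth c)"
proof (intro ext)
  fix Z :: "'d \<Rightarrow> complex mat" and i j
  show "synth (\<lambda>\<alpha>. hscale E a (c \<alpha>)) Z i j = hscale (drury_arveson E) a (synth c) Z i j"
  proof (cases "\<exists>n. Z \<in> nc_ball n \<and> i < n \<and> j < n")
    case True
    then obtain n where n: "Z \<in> nc_ball n" "i < n" "j < n"
      by blast
    have "hsum (\<lambda>\<alpha>. word_mat n Z \<alpha> $$ (i, j)) (\<lambda>\<alpha>. hscale E a (c \<alpha>)) (hscale E a (synth c Z i j))"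
      by (rule hsum_scale_general[OF sq_summable_mem[OF c] synth_hsum[OF c n]]) (simp add:
          mult.commute)
    then show ?thesis
      using synth_eqI[OF sq_summable_mem[OF sq_summable_scale[OF c]] n]
          by (simp add: drury_arveson_simps)
  qed (auto simp: synth_def drury_arveson_simps)
qed

lemma nc_coeff_add:
  assumes "f \<in> hcarrier (drury_arveson E)" "g \<in> hcarrier (drury_arveson E)"
  shows "f + g \<in> hcarrier (drury_arveson E)" "nc_coeff E (f + g) = (\<lambda>\<alpha>. nc_coeff E f \<alpha>
      + nc_coeff E g \<alpha>)"
proof -
  have "f + g = synth (\<lambda>\<alpha>. nc_coeff E f \<alpha> + nc_coeff E g \<alpha>)"
    using assms by (simp add: synth_add drury_arveson_coeff)
  then show "f + g \<in> hcarrier (drury_arveson E)" "nc_coeff E (f + g) = (\<lambda>\<alpha>. nc_coeff E f \<alpha>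
      + nc_coeff E g \<alpha>)"
    using assms by (simp_all add: synth_in_drury_arveson nc_coeff_synth sq_summable_add
        drury_arveson_coeff)
qed

lemma nc_coeff_scale:
  assumes "f \<in> hcarrier (drury_arveson E)"
  shows "hscale (drury_arveson E) a f \<in> hcarrier (drury_arveson E)"
    "nc_coeff E (hscale (drury_arveson E) a f) = (\<lambda>\<alpha>. hscale E a (nc_coeff E f \<alpha>))"
proof -
  have "hscale (drury_arveson E) a f = synth (\<lambda>\<alpha>. hscale E a (nc_coeff E f \<alpha>))"
    using assms by (simp add: synth_scale drury_arveson_coeff)
  then show "hscale (drury_arveson E) a f \<in> hcarrier (drury_arveson E)"
    "nc_coeff E (hscale (drury_arveson E) a f) = (\<lambda>\<alpha>. hscale E a (nc_coeff E f \<alpha>))"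
    using assms by (simp_all add: synth_in_drury_arveson nc_coeff_synth sq_summable_scale
        drury_arveson_coeff)
qed

lemma hnorm_drury_arveson:
  assumes "f \<in> hcarrier (drury_arveson E)"
  shows "hnorm (drury_arveson E) f = sqrt (\<Sum>\<^sub>\<infinity>\<alpha>. (hnorm E (nc_coeff E f \<alpha>))\<^sup>2)"
  using sq_summable_inner_self[OF drury_arveson_coeff(1)[OF assms]]
      by (simp add: hnorm_def[of "drury_arveson E"] drury_arveson_simps)

end

lemma hnorm_H2d: "f \<in> hcarrier H2d \<Longrightarrow> hnorm H2d f = hnorm ell2 (nc_coeff complex_hspace f)"
  by (simp add: hnorm_def ell2_def drury_arveson_simps)

text \<open>Passing to coefficients is a linear bijection onto \<open>ell2\<close>, and the inner
  product of \<open>H2d\<close> is by definition the one pulled back along it.\<close>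

theorem hilbert_space_H2d: "hilbert_space (H2d :: ('d::finite, complex) nc_fun hspace)"
proof (rule hilbert_space_transport[OF hilbert_space_ell2, where \<phi> = "nc_coeff complex_hspace"])
  let ?H = "H2d :: ('d::finite, complex) nc_fun hspace"
  interpret V: vector_space "hscale ?H"
    by unfold_locales (auto simp: fun_eq_iff algebra_simps drury_arveson_simps)
  show "vector_space (hscale ?H)"
    by (rule V.vector_space_axioms)
  have "C.synth (\<lambda>_. 0) = (0 :: ('d, complex) nc_fun)"
    using C.synth_scale[of "\<lambda>_. 0" 0]
        by (simp add: sq_summable_complex fun_eq_iff drury_arveson_simps)
  moreover have "C.synth (\<lambda>_. 0) \<in> hcarrier ?H"
    by (rule C.synth_in_drury_arveson) (simp add: sq_summable_complex)
  ultimately have "0 \<in> hcarrier ?H"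
    by simp
  then show "V.subspace (hcarrier ?H)"
    unfolding V.subspace_def using C.nc_coeff_add(1) C.nc_coeff_scale(1) by blast
  show "bij_betw (nc_coeff complex_hspace) (hcarrier ?H) (hcarrier ell2)"
  proof (rule bij_betw_byWitness[where f' = C.synth])
    show "\<forall>f\<in>hcarrier ?H. C.synth (nc_coeff complex_hspace f) = f"
      using C.drury_arveson_coeff(2) by blast
    show "\<forall>c\<in>hcarrier ell2. nc_coeff complex_hspace (C.synth c) = c"
      using C.nc_coeff_synth by (auto simp: ell2_def)
    show "nc_coeff complex_hspace ` hcarrier ?H \<subseteq> hcarrier ell2"
      using C.drury_arveson_coeff(1) by (auto simp: ell2_def)
    show "C.synth ` hcarrier ell2 \<subseteq> hcarrier ?H"
      using C.synth_in_drury_arveson by (auto simp: ell2_def)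
  qed
  show "nc_coeff complex_hspace (f + g) = nc_coeff complex_hspace f + nc_coeff complex_hspace g"
    if "f \<in> hcarrier ?H" "g \<in> hcarrier ?H" for f g
    using C.nc_coeff_add(2)[OF that] by (simp add: plus_fun_def)
  show "nc_coeff complex_hspace (hscale ?H a f) = hscale ell2 a (nc_coeff complex_hspace f)"
    if "f \<in> hcarrier ?H" for f a
    using C.nc_coeff_scale(2)[OF that] by (simp add: ell2_def)
  show "hinner ?H f g = hinner ell2 (nc_coeff complex_hspace f) (nc_coeff complex_hspace g)" for f g
    by (simp add: ell2_def drury_arveson_simps)
qed

interpretation H: hilbert_space H2d
  by (rule hilbert_space_H2d)

text \<open>Counterpart of \<open>left_shift\<close> on coefficients. The value type need only have
  a zero, so that scalar families, vector families and the families of their squared norms are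
  shifted alike.\<close>

definition shift :: "'d \<Rightarrow> ('d list \<Rightarrow> 'v::zero) \<Rightarrow> 'd list \<Rightarrow> 'v" where
  "shift i c \<alpha> = (case \<alpha> of [] \<Rightarrow> 0 | j # \<beta> \<Rightarrow> if j = i then c \<beta> else 0)"

lemma shift_simps [simp]:
  "shift i c [] = 0"
  "shift i c (j # \<beta>) = (if j = i then c \<beta> else 0)"
  by (simp_all add: shift_def)

lemma has_sum_shift:
  assumes "(f has_sum s) UNIV"
  shows "(shift i f has_sum s) UNIV"
proof -
  have "(shift i f has_sum s) (range (Cons i))"
    by (subst has_sum_reindex) (use assms in \<open>auto simp: comp_def\<close>)
  then show ?thesis
    by (rule has_sum_cong_neutral[THEN iffD1, rotated -1]) (auto simp: shift_def split: list.splits)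
qed

lemma infsum_shift: "f summable_on UNIV \<Longrightarrow> infsum (shift i f) UNIV = infsum f UNIV"
  for f :: "'d list \<Rightarrow> 'b::{topological_comm_monoid_add, t2_space}"
  by (intro infsumI has_sum_shift has_sum_infsum)

lemma (in hilbert_space) sq_summable_shift:
  assumes c: "sq_summable E c"
  shows "sq_summable E (shift i c)"
  unfolding sq_summable_def
proof
  show "\<forall>\<alpha>. shift i c \<alpha> \<in> hcarrier E"
    using sq_summable_mem[OF c] by (auto simp: shift_def split: list.splits)
  have "(\<lambda>\<alpha>. (hnorm E (c \<alpha>))\<^sup>2) summable_on UNIV"
    using c by (simp add: sq_summable_def)
  then have "shift i (\<lambda>\<alpha>. (hnorm E (c \<alpha>))\<^sup>2) summable_on UNIV"
    by (auto simp: summable_on_def intro: has_sum_shift)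
  moreover have "shift i (\<lambda>\<alpha>. (hnorm E (c \<alpha>))\<^sup>2) = (\<lambda>\<alpha>. (hnorm E (shift i c \<alpha>))\<^sup>2)"
    by (auto simp: shift_def fun_eq_iff split: list.splits)
  ultimately show "(\<lambda>\<alpha>. (hnorm E (shift i c \<alpha>))\<^sup>2) summable_on UNIV"
    by simp
qed

text \<open>The factor \<open>Z i\<close> is absorbed into the weights, turning the weight of
  \<open>\<alpha>\<close> into that of \<open>i # \<alpha>\<close>; the sum is then reindexed over
  the words that begin with \<open>i\<close>.\<close>

lemma left_shift_synth:
  assumes c: "sq_summable complex_hspace c"
  shows "left_shift i (C.synth c) = C.synth (shift i c)"
proof (intro ext)
  fix Z :: "'a \<Rightarrow> complex mat" and p q
  have c': "sq_summable complex_hspace (shift i c)"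
    by (rule C.sq_summable_shift[OF c])
  show "left_shift i (C.synth c) Z p q = C.synth (shift i c) Z p q"
  proof (cases "Z \<in> (\<Union>n. nc_ball n)")
    case True
    then obtain n where Z: "Z \<in> nc_ball n"
      by blast
    note car = nc_ball_carrier[OF Z]
    have dims: "dim_row (Z i) = n" "dim_col (Z i) = n"
      using car[of i] by auto
    show ?thesis
    proof (cases "p < n \<and> q < n")
      case True
      have "C.hsum (\<lambda>\<alpha>. \<Sum>k<n. Z i $$ (p, k) * word_mat n Z \<alpha> $$ (k, q)) c
          (\<Sum>k<n. hscale complex_hspace (Z i $$ (p, k)) (C.synth c Z k q))"
        using True by (intro C.hsum_lincomb C.synth_hsum[OF c Z]) auto
      then have "C.hsum (\<lambda>\<alpha>. word_mat n Z (i # \<alpha>) $$ (p, q)) c (left_shift i (C.synth c) Z p q)"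
        using True dims by (simp add: left_shift_def lmult_def word_mat_Cons_index[OF car] del:
            word_mat.simps)
      then have "(shift i (\<lambda>\<alpha>. word_mat n Z (i # \<alpha>) $$ (p, q) * c \<alpha>) has_sum left_shift i (C.synth
          c) Z p q) UNIV"
        unfolding hsum_complex by (rule has_sum_shift)
      moreover have "shift i (\<lambda>\<alpha>. word_mat n Z (i # \<alpha>) $$ (p, q) * c \<alpha>)
          = (\<lambda>\<alpha>. word_mat n Z \<alpha> $$ (p, q) * shift i c \<alpha>)"
        by (auto simp: shift_def fun_eq_iff split: list.splits)
      ultimately have "C.hsum (\<lambda>\<alpha>. word_mat n Z \<alpha> $$ (p, q)) (shift i c) (left_shift i (C.synth c)
          Z p q)"
        by (simp add: hsum_complex)
      then show ?thesis
        using True C.synth_eqI[OF sq_summable_mem[OF c'] Z] by simp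
    next
      case False
      then show ?thesis
        using C.synth_outside(2)[OF Z] dims by (auto simp: left_shift_def lmult_def)
    qed
  next
    case False
    then show ?thesis
      by (simp add: C.synth_outside(1) left_shift_def lmult_def)
  qed
qed

lemma
  assumes "f \<in> hcarrier H2d"
  shows left_shift_mem: "left_shift i f \<in> hcarrier H2d"
    and nc_coeff_left_shift: "nc_coeff complex_hspace (left_shift i f)
        = shift i (nc_coeff complex_hspace f)"
proof -
  have "left_shift i f = C.synth (shift i (nc_coeff complex_hspace f))"
    using left_shift_synth[OF C.drury_arveson_coeff(1)[OF assms], of i]
        C.drury_arveson_coeff(2)[OF assms] by simp
  then show "left_shift i f \<in> hcarrier H2d" "nc_coeff complex_hspace (left_shift i f)
      = shift i (nc_coeff complex_hspace f)"
    using C.sq_summable_shift[OF C.drury_arveson_coeff(1)[OF assms], of i]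
    by (simp_all add: C.synth_in_drury_arveson C.nc_coeff_synth)
qed

section \<open>Right multipliers\<close>

lemma splits_Cons:
  "{(\<beta>, \<alpha>). \<beta> @ \<alpha> = j # \<gamma>} = insert ([], j # \<gamma>) ((\<lambda>(\<beta>, \<alpha>). (j # \<beta>, \<alpha>)) ` {(\<beta>, \<alpha>). \<beta> @ \<alpha> = \<gamma>})"
  by (auto simp: append_eq_Cons_conv image_iff)

lemma finite_splits: "finite {(\<beta>, \<alpha>). \<beta> @ \<alpha> = \<gamma>}"
proof (induction \<gamma>)
  case Nil
  have "{(\<beta> :: 'a list, \<alpha>). \<beta> @ \<alpha> = []} = {([], [])}"
    by auto
  then show ?case
    by simp
next
  case (Cons j \<gamma>)
  then show ?case
    by (simp only: splits_Cons finite_insert finite_imageI)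
qed

lemma right_product_coeff_Nil: "right_product_coeff \<psi> c [] = \<psi> [] (c [])"
proof -
  have "{(\<beta> :: 'a list, \<alpha>). \<beta> @ \<alpha> = []} = {([], [])}"
    by auto
  then show ?thesis
    by (simp add: right_product_coeff_def)
qed

text \<open>The left part of a split of \<open>j # \<gamma>\<close> is empty or begins with
  \<open>j\<close>. This recursion on the first letter carries the inductions over words
  below.\<close>

lemma right_product_coeff_Cons:
  fixes c :: "'d list \<Rightarrow> 'e"
  shows "right_product_coeff \<psi> c (j # \<gamma>) = \<psi> (j # \<gamma>) (c [])
      + right_product_coeff \<psi> (\<lambda>\<beta>. c (j # \<beta>)) \<gamma>"
proof -
  have inj: "inj_on (\<lambda>(\<beta>, \<alpha>). (j # \<beta>, \<alpha>)) A" for A :: "('d list \<times> 'd list) set"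
    by (auto simp: inj_on_def)
  show ?thesis
    unfolding right_product_coeff_def splits_Cons
    by (subst sum.insert[OF finite_imageI[OF finite_splits]], force)
      (subst sum.reindex[OF inj], simp add: comp_def case_prod_unfold)
qed

lemma right_product_coeff_zero:
  "(\<And>\<alpha>. \<psi> \<alpha> 0 = 0) \<Longrightarrow> right_product_coeff \<psi> (\<lambda>_. 0) \<gamma> = 0"
  by (auto simp: right_product_coeff_def intro: sum.neutral)

text \<open>Prepending a letter touches only the left part of a split. The split with empty left
  part meets the coefficient 0 of the shifted family, which is where
  \<open>\<psi> \<alpha> 0 = 0\<close> enters.\<close>

lemma right_product_coeff_shift:
  assumes "\<And>\<alpha>. \<psi> \<alpha> 0 = 0"
  shows "right_product_coeff \<psi> (shift i c) = shift i (right_product_coeff \<psi> c)"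
proof
  fix \<gamma>
  show "right_product_coeff \<psi> (shift i c) \<gamma> = shift i (right_product_coeff \<psi> c) \<gamma>"
    using assms right_product_coeff_zero[of \<psi>]
    by (cases \<gamma>) (auto simp: right_product_coeff_Nil right_product_coeff_Cons)
qed

lemma right_product_coeff_add:
  assumes "\<And>\<alpha> \<beta>. \<psi> \<alpha> (c \<beta> + d \<beta>) = \<psi> \<alpha> (c \<beta>) + \<psi> \<alpha> (d \<beta>)"
  shows "right_product_coeff \<psi> (\<lambda>\<beta>. c \<beta> + d \<beta>) \<gamma> = right_product_coeff \<psi> c \<gamma>
      + right_product_coeff \<psi> d \<gamma>"
  by (simp add: right_product_coeff_def assms case_prod_unfold sum.distrib)

text \<open>Only prefixes of \<open>\<gamma>\<close> occur as left parts, so a family may be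
  truncated beyond the length of \<open>\<gamma>\<close>.\<close>

lemma right_product_coeff_cong:
  assumes "\<And>\<beta>. length \<beta> \<le> length \<gamma> \<Longrightarrow> c \<beta> = d \<beta>"
  shows "right_product_coeff \<psi> c \<gamma> = right_product_coeff \<psi> d \<gamma>"
  unfolding right_product_coeff_def by (rule sum.cong) (auto intro!: arg_cong[of _ _ "\<psi> _"] assms)

section \<open>Multiplier coefficients and right products\<close>

lemma bounded_ops_zero: "T \<in> bounded_ops E F \<Longrightarrow> hilbert_space E \<Longrightarrow> T 0 = 0"
proof -
  assume T: "T \<in> bounded_ops E F" and E: "hilbert_space E"
  then have "T (0 + 0) = T 0 + T 0"
    using hilbert_space.zero_mem[OF E] unfolding bounded_ops_def by blast
  then show "T 0 = 0"
    by simp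
qed

lemma words_less_filterlim:
  "filterlim (\<lambda>N. {\<alpha> :: 'd::finite list. length \<alpha> < N}) (finite_subsets_at_top UNIV) sequentially"
  unfolding filterlim_finite_subsets_at_top
proof (intro allI impI)
  fix X :: "'d list set" assume "finite X \<and> X \<subseteq> UNIV"
  then obtain M where M: "X \<subseteq> {\<alpha>. length \<alpha> \<le> M}"
    using finite_subset_words by blast
  have "finite {\<alpha> :: 'd list. length \<alpha> < N}" for N
    by (rule finite_subset[OF _ finite_words(2)[of N]]) auto
  then show "\<forall>\<^sub>F N in sequentially. finite {\<alpha> :: 'd list. length \<alpha> < N} \<and> X \<subseteq> {\<alpha>. length \<alpha> < N}
      \<and> {\<alpha> :: 'd list. length \<alpha> < N} \<subseteq> UNIV"
    using M by (auto simp: eventually_sequentially intro!: exI[of _ "Suc M"])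
qed

lemma words_le_filterlim:
  "filterlim (\<lambda>N. {\<alpha> :: 'd::finite list. length \<alpha> \<le> N}) (finite_subsets_at_top UNIV) sequentially"
  using words_less_filterlim[where 'd = 'd] filterlim_sequentially_Suc[of "\<lambda>N. {\<alpha> :: 'd list.
      length \<alpha> < N}"]
  by (simp add: less_Suc_eq_le)

text \<open>Applied to a vector of the carrier, the partial sums at an isolating point are constant
  once the degree reaches \<open>length \<gamma>\<close>. Off the carrier both operators vanish by
  the convention for bounded operators.\<close>

lemma multiplier_series_unique:
  fixes \<psi> :: "'d::finite list \<Rightarrow> 'e::ab_group_add \<Rightarrow> complex"
  assumes \<psi>: "multiplier_series E complex_hspace \<psi> \<Psi>" and \<phi>: "multiplier_series E complex_hspace \<phi>
      \<Psi>"
  shows "\<psi> = \<phi>"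
proof (intro ext)
  fix \<gamma> e
  show "\<psi> \<gamma> e = \<phi> \<gamma> e"
  proof (cases "e \<in> hcarrier E")
    case True
    obtain n Z p q where pq: "Z \<in> nc_ball n" "p < n" "q < n"
      and iso: "\<And>\<alpha>. word_mat n Z \<alpha> $$ (p, q) = (if \<alpha> = \<gamma> then (1/2) ^ length \<gamma> else 0)"
      using isolating_point[of \<gamma>] by auto
    have "\<Psi> Z p q e = (1/2) ^ length \<gamma> * \<theta> \<gamma> e" if \<theta>: "multiplier_series E complex_hspace \<theta> \<Psi>" for \<theta>
    proof -
      have "(\<lambda>N. cmod ((\<Sum>\<alpha> | length \<alpha> \<le> N. word_mat n Z \<alpha> $$ (p, q) * \<theta> \<alpha> e) - \<Psi> Z p q e)) \<longlonglongrightarrow> 0"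
        using \<theta> pq True by (auto simp: multiplier_series_def)
      moreover have "(\<Sum>\<alpha> | length \<alpha> \<le> N. word_mat n Z \<alpha> $$ (p, q) * \<theta> \<alpha> e)
          = (1/2) ^ length \<gamma> * \<theta> \<gamma> e"
        if "N \<ge> length \<gamma>" for N
      proof -
        have "(\<Sum>\<alpha> | length \<alpha> \<le> N. word_mat n Z \<alpha> $$ (p, q) * \<theta> \<alpha> e)
            = (\<Sum>\<alpha> | length \<alpha> \<le> N. if \<alpha> = \<gamma> then (1/2) ^ length \<gamma> * \<theta> \<gamma> e else 0)"
          by (intro sum.cong) (auto simp: iso)
        then show ?thesis
          using that by (simp add: finite_words)
      qed
      then have "(\<lambda>N. cmod ((\<Sum>\<alpha> | length \<alpha> \<le> N. word_mat n Z \<alpha> $$ (p, q) * \<theta> \<alpha> e) - \<Psi> Z p q e))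
          \<longlonglongrightarrow> cmod ((1/2) ^ length \<gamma> * \<theta> \<gamma> e - \<Psi> Z p q e)"
        by (intro tendsto_eventually) (auto simp: eventually_sequentially intro!: exI[of _ "length
            \<gamma>"])
      ultimately have "cmod ((1/2) ^ length \<gamma> * \<theta> \<gamma> e - \<Psi> Z p q e) = 0"
        using LIMSEQ_unique by blast
      then show ?thesis
        by simp
    qed
    then have "(1/2) ^ length \<gamma> * \<psi> \<gamma> e = (1/2) ^ length \<gamma> * \<phi> \<gamma> e"
      using \<psi> \<phi> by metis
    then show ?thesis
      by simp
  next
    case False
    then show ?thesis
      using \<psi> \<phi> by (simp add: multiplier_series_def bounded_ops_def)
  qed
qed

lemma multiplier_coeff_eqI:
  "multiplier_series E complex_hspace \<psi> \<Psi> \<Longrightarrow> multiplier_coeff E complex_hspace \<Psi> = \<psi>"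
  unfolding multiplier_coeff_def using multiplier_series_unique by (intro the_equality) auto

lemma is_right_product_iff:
  "is_right_product E complex_hspace \<Psi> f g \<longleftrightarrow>
     sq_summable complex_hspace (right_product_coeff (multiplier_coeff E complex_hspace \<Psi>)
         (nc_coeff E f)) \<and>
     g = C.synth (right_product_coeff (multiplier_coeff E complex_hspace \<Psi>) (nc_coeff E f))"
  (is "_ \<longleftrightarrow> sq_summable _ ?c \<and> _")
proof
  assume "is_right_product E complex_hspace \<Psi> f g"
  then have g: "g \<in> hcarrier H2d" "nc_series complex_hspace ?c g"
    by (auto simp: is_right_product_def)
  then show "sq_summable complex_hspace ?c \<and> g = C.synth ?c"
    using C.nc_series_imp_synth by (auto simp: nc_series_def sq_summable_def)
next
  assume "sq_summable complex_hspace ?c \<and> g = C.synth ?c"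
  then show "is_right_product E complex_hspace \<Psi> f g"
    unfolding is_right_product_def using C.synth_in_drury_arveson[of ?c] C.nc_series_synth[of ?c]
        by blast
qed

lemma right_mult_op_eq:
  assumes "f \<in> hcarrier (drury_arveson E)"
    and "sq_summable complex_hspace (right_product_coeff (multiplier_coeff E complex_hspace \<Psi>)
        (nc_coeff E f))"
  shows "right_mult_op E complex_hspace \<Psi> f
    = C.synth (right_product_coeff (multiplier_coeff E complex_hspace \<Psi>) (nc_coeff E f))"
proof -
  have "(THE g. is_right_product E complex_hspace \<Psi> f g)
      = C.synth (right_product_coeff (multiplier_coeff E complex_hspace \<Psi>) (nc_coeff E f))"
    using assms(2) by (intro the_equality) (auto simp: is_right_product_iff)
  then show ?thesis
    using assms(1) by (simp add: right_mult_op_def)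
qed

lemma MultR_sq_summable:
  assumes "\<Psi> \<in> MultR E complex_hspace" "f \<in> hcarrier (drury_arveson E)"
  shows "sq_summable complex_hspace (right_product_coeff (multiplier_coeff E complex_hspace \<Psi>)
      (nc_coeff E f))"
proof -
  obtain g where "is_right_product E complex_hspace \<Psi> f g"
    using assms by (auto simp: MultR_def)
  then show ?thesis
    by (simp add: is_right_product_iff)
qed

lemma left_shift_right_mult_op:
  fixes \<Psi> :: "('d::finite, 'e::ab_group_add \<Rightarrow> complex) nc_fun"
  assumes E: "hilbert_space E" and \<Psi>: "\<Psi> \<in> MultR E complex_hspace" and f: "f \<in> hcarrier
      (drury_arveson E)"
  shows "\<exists>f'\<in>hcarrier (drury_arveson E).
    left_shift i (right_mult_op E complex_hspace \<Psi> f) = right_mult_op E complex_hspace \<Psi> f'"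
proof
  interpret E: hilbert_space E by fact
  let ?\<psi> = "multiplier_coeff E complex_hspace \<Psi>" and ?c = "nc_coeff E f"
  obtain \<psi> where \<psi>: "multiplier_series E complex_hspace \<psi> \<Psi>"
    using \<Psi> by (auto simp: MultR_def)
  have zero: "?\<psi> \<alpha> 0 = 0" for \<alpha>
    using \<psi> E bounded_ops_zero unfolding multiplier_coeff_eqI[OF \<psi>]
        by (auto simp: multiplier_series_def)
  have c: "sq_summable E (shift i ?c)"
    by (rule E.sq_summable_shift[OF E.drury_arveson_coeff(1)[OF f]])
  show f': "E.synth (shift i ?c) \<in> hcarrier (drury_arveson E)"
    by (rule E.synth_in_drury_arveson[OF c])
  have "right_mult_op E complex_hspace \<Psi> (E.synth (shift i ?c))
      = C.synth (shift i (right_product_coeff ?\<psi> ?c))"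
    using right_mult_op_eq[OF f' MultR_sq_summable[OF \<Psi> f']]
    by (simp add: E.nc_coeff_synth[OF c] right_product_coeff_shift zero)
  then show "left_shift i (right_mult_op E complex_hspace \<Psi> f)
      = right_mult_op E complex_hspace \<Psi> (E.synth (shift i ?c))"
    using right_mult_op_eq[OF f MultR_sq_summable[OF \<Psi> f]] left_shift_synth[OF
        MultR_sq_summable[OF \<Psi> f]] by simp
qed

lemma partial_isometric_range_invariant:
  assumes "hilbert_space E" "is_partial_isometric_range E \<Psi> S"
  shows "left_shift i ` S \<subseteq> S"
  using assms left_shift_right_mult_op[of E \<Psi> _ i]
      by (fastforce simp: is_partial_isometric_range_def)

section \<open>The wandering subspace\<close>

abbreviation tcoeff :: "('d::finite, complex) nc_fun \<Rightarrow> 'd list \<Rightarrow> complex" where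
  "tcoeff \<equiv> nc_coeff complex_hspace"

lemma tcoeff_sq_summable: "f \<in> hcarrier H2d \<Longrightarrow> sq_summable complex_hspace (tcoeff f)"
  by (rule C.drury_arveson_coeff(1))

lemma tcoeff_add: "f \<in> hcarrier H2d \<Longrightarrow> g \<in> hcarrier H2d \<Longrightarrow> tcoeff (f + g) \<alpha> = tcoeff f \<alpha> + tcoeff g \<alpha>"
  by (simp add: C.nc_coeff_add)

lemma tcoeff_scale: "f \<in> hcarrier H2d \<Longrightarrow> tcoeff (hscale H2d a f) \<alpha> = a * tcoeff f \<alpha>"
  by (simp add: C.nc_coeff_scale)

lemma tcoeff_zero: "tcoeff 0 \<alpha> = 0"
  using tcoeff_add[of 0 0 \<alpha>] H.zero_mem by simp

lemma tcoeff_sum: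
  "(\<And>i. i \<in> A \<Longrightarrow> f i \<in> hcarrier H2d) \<Longrightarrow> tcoeff (sum f A) \<alpha> = (\<Sum>i\<in>A. tcoeff (f i) \<alpha>)"
  by (induction A rule: infinite_finite_induct) (simp_all add: tcoeff_zero tcoeff_add H.sum_mem)

lemma synth_tcoeff: "f \<in> hcarrier H2d \<Longrightarrow> C.synth (tcoeff f) = f"
  by (rule C.drury_arveson_coeff(2))

lemma hinner_H2d: "hinner H2d f g = (\<Sum>\<^sub>\<infinity>\<alpha>. tcoeff f \<alpha> * cnj (tcoeff g \<alpha>))"
  by (simp add: drury_arveson_simps)

lemma tcoeff_le_hnorm: "f \<in> hcarrier H2d \<Longrightarrow> cmod (tcoeff f \<alpha>) \<le> hnorm H2d f"
  by (simp add: hnorm_H2d cmod_le_hnorm_ell2 tcoeff_sq_summable)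

lemma (in hilbert_space) sq_summable_tail:
  assumes c: "sq_summable E c"
  shows "sq_summable E (\<lambda>\<alpha>. c (i # \<alpha>))"
  unfolding sq_summable_def
proof
  show "\<forall>\<alpha>. c (i # \<alpha>) \<in> hcarrier E"
    using sq_summable_mem[OF c] by blast
  have "(\<lambda>\<alpha>. (hnorm E (c \<alpha>))\<^sup>2) summable_on UNIV"
    using c by (simp add: sq_summable_def)
  then have "(\<lambda>\<alpha>. (hnorm E (c \<alpha>))\<^sup>2) summable_on range (Cons i)"
    by (rule summable_on_subset_banach) (rule subset_UNIV)
  then show "(\<lambda>\<alpha>. (hnorm E (c (i # \<alpha>)))\<^sup>2) summable_on UNIV"
    by (subst (asm) summable_on_reindex) (simp_all add: comp_def)
qed

text \<open>Shifts by different letters have coefficients on disjoint sets of words; shifts by the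
  same letter merely reindex the sum.\<close>

lemma hinner_left_shift:
  assumes f: "f \<in> hcarrier H2d" and g: "g \<in> hcarrier H2d"
  shows "hinner H2d (left_shift i f) (left_shift j g) = (if i = j then hinner H2d f g else 0)"
proof (cases "i = j")
  case True
  have "(\<lambda>\<alpha>. tcoeff f \<alpha> * cnj (tcoeff g \<alpha>)) summable_on UNIV"
    using C.sq_summable_summable_inner[OF tcoeff_sq_summable[OF f] tcoeff_sq_summable[OF g]] by simp
  then have "infsum (shift i (\<lambda>\<alpha>. tcoeff f \<alpha> * cnj (tcoeff g \<alpha>))) UNIV = hinner H2d f g"
    unfolding hinner_H2d by (rule infsum_shift)
  moreover have "shift i (\<lambda>\<alpha>. tcoeff f \<alpha> * cnj (tcoeff g \<alpha>))
      = (\<lambda>\<alpha>. shift i (tcoeff f) \<alpha> * cnj (shift i (tcoeff g) \<alpha>))"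
    by (auto simp: shift_def fun_eq_iff split: list.splits)
  ultimately show ?thesis
    using True f g by (simp add: hinner_H2d nc_coeff_left_shift)
next
  case False
  then have "(\<lambda>\<alpha>. shift i (tcoeff f) \<alpha> * cnj (shift j (tcoeff g) \<alpha>)) = (\<lambda>_. 0)"
    by (auto simp: shift_def fun_eq_iff split: list.splits)
  then show ?thesis
    using False f g by (simp add: hinner_H2d nc_coeff_left_shift)
qed

text \<open>The vector \<open>b\<close> is the adjoint left shift of \<open>f\<close>: its
  coefficient at \<open>\<alpha>\<close> is that of \<open>f\<close> at
  \<open>i # \<alpha>\<close>.\<close>

lemma back_shift:
  assumes f: "f \<in> hcarrier H2d"
  obtains b where "b \<in> hcarrier H2d"
    "\<forall>g\<in>hcarrier H2d. hinner H2d b g = hinner H2d f (left_shift i g)"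
proof
  note c = C.sq_summable_tail[OF tcoeff_sq_summable[OF f], of i]
  show b: "C.synth (\<lambda>\<alpha>. tcoeff f (i # \<alpha>)) \<in> hcarrier H2d"
    by (rule C.synth_in_drury_arveson[OF c])
  show "\<forall>g\<in>hcarrier H2d. hinner H2d (C.synth (\<lambda>\<alpha>. tcoeff f (i # \<alpha>))) g
      = hinner H2d f (left_shift i g)"
  proof
    fix g :: "('a, complex) nc_fun" assume g: "g \<in> hcarrier H2d"
    have "(\<lambda>\<alpha>. tcoeff f (i # \<alpha>) * cnj (tcoeff g \<alpha>)) summable_on UNIV"
      using C.sq_summable_summable_inner[OF c tcoeff_sq_summable[OF g]] by simp
    then have "infsum (shift i (\<lambda>\<alpha>. tcoeff f (i # \<alpha>) * cnj (tcoeff g \<alpha>))) UNIV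
        = (\<Sum>\<^sub>\<infinity>\<alpha>. tcoeff f (i # \<alpha>) * cnj (tcoeff g \<alpha>))"
      by (rule infsum_shift)
    moreover have "shift i (\<lambda>\<alpha>. tcoeff f (i # \<alpha>) * cnj (tcoeff g \<alpha>))
        = (\<lambda>\<alpha>. tcoeff f \<alpha> * cnj (shift i (tcoeff g) \<alpha>))"
      by (auto simp: shift_def fun_eq_iff split: list.splits)
    ultimately show "hinner H2d (C.synth (\<lambda>\<alpha>. tcoeff f (i # \<alpha>))) g = hinner H2d f (left_shift i g)"
      using g by (simp add: hinner_H2d nc_coeff_left_shift C.nc_coeff_synth[OF c])
  qed
qed

text \<open>Pythagoras: the shifted copies are orthogonal to one another and to \<open>w\<close>,
  and each shift is isometric.\<close>

lemma hnorm_orthogonal_shifts: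
  fixes w :: "('d::finite, complex) nc_fun"
  assumes w: "w \<in> hcarrier H2d" and t: "\<And>j. t j \<in> hcarrier H2d"
    and orth: "\<And>j. hinner H2d w (left_shift j (t j)) = 0"
  shows "(hnorm H2d (w + (\<Sum>j\<in>UNIV. left_shift j (t j))))\<^sup>2 = (hnorm H2d w)\<^sup>2
      + (\<Sum>j\<in>UNIV. (hnorm H2d (t j))\<^sup>2)"
proof -
  let ?y = "\<Sum>j\<in>UNIV. left_shift j (t j)"
  have m: "left_shift j (t j) \<in> hcarrier H2d" for j
    by (rule left_shift_mem[OF t])
  have y: "?y \<in> hcarrier H2d"
    by (rule H.sum_mem) (rule m)
  have "hinner H2d ?y w = (\<Sum>j\<in>UNIV. hinner H2d (left_shift j (t j)) w)"
    by (rule H.inner_sum_left[OF m w])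
  also have "\<dots> = 0"
    using H.inner_cnj[OF m w] orth by simp
  finally have wy: "hinner H2d w ?y = 0"
    using H.inner_cnj[OF w y] by simp
  have "hinner H2d (left_shift j (t j)) ?y = hinner H2d (t j) (t j)" for j
  proof -
    have "hinner H2d ?y (left_shift j (t j)) = (\<Sum>k\<in>UNIV. if k
        = j then hinner H2d (t j) (t j) else 0)"
      unfolding H.inner_sum_left[OF m m] by (intro sum.cong refl) (auto simp: hinner_left_shift t)
    then show ?thesis
      using H.inner_cnj[OF m y] H.inner_cnj[OF t t, of j j] by simp
  qed
  then have "hinner H2d ?y ?y = (\<Sum>j\<in>UNIV. hinner H2d (t j) (t j))"
    by (simp add: H.inner_sum_left[OF m y])
  then have "(hnorm H2d ?y)\<^sup>2 = (\<Sum>j\<in>UNIV. (hnorm H2d (t j))\<^sup>2)"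
    by (simp add: H.hnorm_power2 y t)
  then show ?thesis
    by (simp add: H.hnorm_add_power2[OF w y] wy)
qed

lemma finite_words_less: "finite {\<alpha> :: 'd::finite list. length \<alpha> < N}"
  by (rule finite_subset[OF _ finite_words(2)[of N]]) auto

text \<open>The length bound is strict so that the inductions start from an empty sum and the empty
  word appears with the first step.\<close>

lemma sum_words_less_Suc:
  fixes f :: "'d::finite list \<Rightarrow> 'b::comm_monoid_add"
  shows "(\<Sum>\<alpha> | length \<alpha> < Suc N. f \<alpha>) = f [] + (\<Sum>j\<in>UNIV. \<Sum>\<alpha> | length \<alpha> < N. f (j # \<alpha>))"
proof -
  have "{\<alpha> :: 'd list. length \<alpha> < Suc N} = insert [] ((\<lambda>(j, \<alpha>). j # \<alpha>) ` (UNIV \<times> {\<alpha>. length \<alpha> <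
      N}))" (is "_ = insert [] (?h ` ?A)")
  proof (rule Set.set_eqI)
    fix \<alpha> :: "'d list"
    show "\<alpha> \<in> {\<alpha>. length \<alpha> < Suc N} \<longleftrightarrow> \<alpha> \<in> insert [] (?h ` ?A)"
      by (cases \<alpha>) auto
  qed
  moreover have "sum f (insert [] (?h ` ?A)) = f [] + sum f (?h ` ?A)"
    by (rule sum.insert) (intro finite_imageI finite_cartesian_product finite_words_less finite,
        auto)
  moreover have "sum f (?h ` ?A) = (\<Sum>(j, \<alpha>)\<in>?A. f (j # \<alpha>))"
    by (subst sum.reindex) (auto simp: inj_on_def comp_def case_prod_unfold)
  ultimately show ?thesis
    by (simp add: sum.cartesian_product)
qed

locale shift_invariant =
  fixes S :: "('d::finite, complex) nc_fun set"
  assumes closed: "closed_subspace H2d S"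
    and invariant: "f \<in> S \<Longrightarrow> left_shift i f \<in> S"
begin

lemma S_mem: "f \<in> S \<Longrightarrow> f \<in> hcarrier H2d"
  using closed by (auto simp: closed_subspace_def)

lemma S_subspace: "H.subspace S"
  using closed by (simp add: closed_subspace_def)

lemma S_limit: "\<lbrakk>\<And>k::nat. u k \<in> S; x \<in> hcarrier H2d; (\<lambda>k. hnorm H2d (u k - x)) \<longlonglongrightarrow> 0\<rbrakk> \<Longrightarrow> x \<in> S"
  using closed by (auto simp: closed_subspace_def)

definition wandering :: "('d, complex) nc_fun set" where
  "wandering = {w \<in> S. \<forall>i. \<forall>t\<in>S. hinner H2d w (left_shift i t) = 0}"

lemma wandering_S: "w \<in> wandering \<Longrightarrow> w \<in> S"
  by (simp add: wandering_def)

lemma wandering_mem: "w \<in> wandering \<Longrightarrow> w \<in> hcarrier H2d"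
  by (simp add: wandering_def S_mem)

text \<open>A limit stays in \<open>S\<close> because \<open>S\<close> is closed, and orthogonality
  survives because Cauchy-Schwarz makes the inner product continuous.\<close>

lemma closed_subspace_wandering: "closed_subspace H2d wandering"
  unfolding closed_subspace_def
proof (intro conjI allI impI)
  have m: "left_shift i t \<in> hcarrier H2d" if "t \<in> S" for i t
    by (rule left_shift_mem[OF S_mem[OF that]])
  show "wandering \<subseteq> hcarrier H2d"
    using wandering_mem by blast
  show "H.subspace wandering"
    unfolding H.subspace_def
  proof (intro conjI allI impI ballI)
    show "0 \<in> wandering"
      using S_subspace m by (simp add: wandering_def H.subspace_def)
    show "f + g \<in> wandering" if "f \<in> wandering" "g \<in> wandering" for f g
      using that S_subspace m by (auto simp: wandering_def H.subspace_def H.inner_add_left S_mem)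
    show "hscale H2d a f \<in> wandering" if "f \<in> wandering" for a f
      using that S_subspace m by (auto simp: wandering_def H.subspace_def H.inner_scale_left S_mem)
  qed
  fix u x assume u: "(\<forall>k::nat. u k \<in> wandering) \<and> x \<in> hcarrier H2d \<and> (\<lambda>k. hnorm H2d (u k - x)) \<longlonglongrightarrow> 0"
  then have x: "x \<in> S"
    using wandering_S by (intro S_limit[where u = u and x = x]) blast+
  have "hinner H2d x (left_shift i t) = 0" if t: "t \<in> S" for i t
  proof -
    let ?y = "left_shift i t"
    have "cmod (hinner H2d x ?y) \<le> hnorm H2d (u k - x) * hnorm H2d ?y" for k
    proof -
      have uk: "u k \<in> hcarrier H2d"
        using u wandering_mem by blast
      have "hinner H2d (u k) ?y = 0"
        using u t by (simp add: wandering_def)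
      then have "hinner H2d (u k - x) ?y = - hinner H2d x ?y"
        using H.inner_diff_left[OF uk S_mem[OF x] m[OF t, of i]] by simp
      then show ?thesis
        using H.hnorm_cauchy_schwarz[OF H.diff_mem[OF uk S_mem[OF x]] m[OF t, of i]] by simp
    qed
    moreover have "(\<lambda>k. hnorm H2d (u k - x) * hnorm H2d ?y) \<longlonglongrightarrow> 0 * hnorm H2d ?y"
      using u by (intro tendsto_mult tendsto_const) auto
    ultimately have "cmod (hinner H2d x ?y) \<le> 0 * hnorm H2d ?y"
      by (intro LIMSEQ_le_const) auto
    then show ?thesis
      by simp
  qed
  then show "x \<in> wandering"
    using x by (simp add: wandering_def)
qed

text \<open>The compression to \<open>S\<close> of the adjoint of the \<open>i\<close>-th left shift.\<close>

definition pull :: "'d \<Rightarrow> ('d, complex) nc_fun \<Rightarrow> ('d, complex) nc_fun" where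
  "pull i s = (SOME p. p \<in> S \<and> (\<forall>t\<in>S. hinner H2d p t = hinner H2d s (left_shift i t)))"

text \<open>\<open>back_shift\<close> supplies the adjoint shift of \<open>s\<close> in the whole
  space; projecting it onto \<open>S\<close> keeps all inner products with \<open>S\<close>.\<close>

lemma pull:
  assumes "s \<in> S"
  shows "pull i s \<in> S" "t \<in> S \<Longrightarrow> hinner H2d (pull i s) t = hinner H2d s (left_shift i t)"
proof -
  obtain b where b: "b \<in> hcarrier H2d" "\<forall>g\<in>hcarrier H2d. hinner H2d b g
      = hinner H2d s (left_shift i g)"
    using back_shift[OF S_mem[OF assms]] by blast
  then obtain p where "p \<in> S" "\<forall>t\<in>S. hinner H2d p t = hinner H2d s (left_shift i t)"
    using H.orthogonal_projection[OF closed b(1)] S_mem by auto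
  then have "\<exists>p. p \<in> S \<and> (\<forall>t\<in>S. hinner H2d p t = hinner H2d s (left_shift i t))"
    by blast
  then have "pull i s \<in> S \<and> (\<forall>t\<in>S. hinner H2d (pull i s) t = hinner H2d s (left_shift i t))"
    unfolding pull_def by (rule someI_ex)
  then show "pull i s \<in> S" "t \<in> S \<Longrightarrow> hinner H2d (pull i s) t = hinner H2d s (left_shift i t)"
    by auto
qed

text \<open>For \<open>s\<close> in \<open>S\<close> this is the orthogonal projection of
  \<open>s\<close> onto \<open>wandering\<close>.\<close>

definition wpart :: "('d, complex) nc_fun \<Rightarrow> ('d, complex) nc_fun" where
  "wpart s = s - (\<Sum>i\<in>UNIV. left_shift i (pull i s))"

lemma wpart_decomp: "wpart s + (\<Sum>i\<in>UNIV. left_shift i (pull i s)) = s"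
  by (simp add: wpart_def)

text \<open>Tested against \<open>left_shift j t\<close>, the sum leaves only its
  \<open>j\<close>-th term, which is the inner product of \<open>pull j s\<close> with
  \<open>t\<close> and cancels that of \<open>s\<close>.\<close>

lemma wpart_wandering:
  assumes s: "s \<in> S"
  shows "wpart s \<in> wandering"
proof -
  have p: "left_shift i (pull i s) \<in> S" for i
    by (rule invariant[OF pull(1)[OF s]])
  have y: "(\<Sum>i\<in>UNIV. left_shift i (pull i s)) \<in> S"
    by (rule H.subspace_sum[OF S_subspace p])
  have "wpart s \<in> S"
    unfolding wpart_def by (rule H.subspace_diff[OF S_subspace s y])
  moreover have "hinner H2d (wpart s) (left_shift j t) = 0" if t: "t \<in> S" for j t
  proof -
    note m = left_shift_mem[OF S_mem[OF t], of j]
    have "hinner H2d (\<Sum>i\<in>UNIV. left_shift i (pull i s)) (left_shift j t)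
        = (\<Sum>i\<in>UNIV. if i = j then hinner H2d (pull j s) t else 0)"
      unfolding H.inner_sum_left[OF S_mem[OF p] m]
      by (intro sum.cong refl) (auto simp: hinner_left_shift S_mem pull(1)[OF s] t)
    then show ?thesis
      unfolding wpart_def H.inner_diff_left[OF S_mem[OF s] S_mem[OF y] m]
          by (simp add: pull(2)[OF s t])
  qed
  ultimately show ?thesis
    by (simp add: wandering_def)
qed

lemma wpart_norm:
  assumes s: "s \<in> S"
  shows "(hnorm H2d s)\<^sup>2 = (hnorm H2d (wpart s))\<^sup>2 + (\<Sum>i\<in>UNIV. (hnorm H2d (pull i s))\<^sup>2)"
  using hnorm_orthogonal_shifts[of "wpart s" "\<lambda>i. pull i s"] wpart_wandering[OF s] pull(1)[OF s]
  by (simp add: wpart_decomp wandering_mem S_mem) (simp add: wandering_def)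

lemma tcoeff_wpart:
  assumes s: "s \<in> S"
  shows "tcoeff s [] = tcoeff (wpart s) []"
    and "tcoeff s (j # \<gamma>) = tcoeff (wpart s) (j # \<gamma>) + tcoeff (pull j s) \<gamma>"
proof -
  have m: "left_shift i (pull i s) \<in> hcarrier H2d" for i
    by (rule left_shift_mem[OF S_mem[OF pull(1)[OF s]]])
  have "tcoeff s \<alpha> = tcoeff (wpart s) \<alpha> + (\<Sum>i\<in>UNIV. shift i (tcoeff (pull i s)) \<alpha>)" for \<alpha>
    using arg_cong[OF wpart_decomp[of s, symmetric], of "\<lambda>f. tcoeff f \<alpha>"]
    by (simp add: tcoeff_add wandering_mem wpart_wandering s H.sum_mem m tcoeff_sum
        nc_coeff_left_shift S_mem pull(1))
  then show "tcoeff s [] = tcoeff (wpart s) []"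
    "tcoeff s (j # \<gamma>) = tcoeff (wpart s) (j # \<gamma>) + tcoeff (pull j s) \<gamma>"
    by auto
qed

text \<open>The vector coefficients in the expansion of \<open>s\<close>. The fold pulls the letters
  off from the left, matching words that are built by prepending.\<close>

definition wcoeff :: "('d, complex) nc_fun \<Rightarrow> 'd list \<Rightarrow> ('d, complex) nc_fun" where
  "wcoeff s \<beta> = wpart (foldl (\<lambda>t i. pull i t) s \<beta>)"

lemma wcoeff_simps: "wcoeff s [] = wpart s" "wcoeff s (i # \<beta>) = wcoeff (pull i s) \<beta>"
  by (simp_all add: wcoeff_def)

lemma wcoeff_wandering: "s \<in> S \<Longrightarrow> wcoeff s \<beta> \<in> wandering"
  by (induction \<beta> arbitrary: s) (simp_all add: wcoeff_simps wpart_wandering pull(1))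

text \<open>A Bessel inequality: \<open>wpart_norm\<close> is iterated over the letters, and the
  norms of the parts not yet split are dropped at \<open>N = 0\<close>.\<close>

lemma wcoeff_norm: "s \<in> S \<Longrightarrow> (\<Sum>\<beta> | length \<beta> < N. (hnorm H2d (wcoeff s \<beta>))\<^sup>2) \<le> (hnorm H2d s)\<^sup>2"
proof (induction N arbitrary: s)
  case (Suc N)
  have "(\<Sum>\<beta> | length \<beta> < Suc N. (hnorm H2d (wcoeff s \<beta>))\<^sup>2)
      = (hnorm H2d (wpart s))\<^sup>2 + (\<Sum>i\<in>UNIV. \<Sum>\<beta> | length \<beta> < N. (hnorm H2d (wcoeff (pull i s) \<beta>))\<^sup>2)"
    unfolding sum_words_less_Suc by (simp add: wcoeff_simps)
  also have "\<dots> \<le> (hnorm H2d (wpart s))\<^sup>2 + (\<Sum>i\<in>UNIV. (hnorm H2d (pull i s))\<^sup>2)"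
    by (intro add_left_mono sum_mono Suc.IH pull(1)[OF Suc.prems])
  finally show ?case
    by (simp add: wpart_norm[OF Suc.prems])
qed simp

text \<open>Wandering vectors are themselves elements of \<open>H2d\<close>, so this Hilbert space
  lives on the very type over which the existential quantifier of the theorem ranges.\<close>

abbreviation wspace :: "('d, complex) nc_fun hspace" where
  "wspace \<equiv> H2d\<lparr>hcarrier := wandering\<rparr>"

lemma hilbert_space_wspace: "hilbert_space wspace"
  by (rule H.closed_subspace_complete[OF closed_subspace_wandering])

lemma hnorm_wspace: "hnorm wspace = hnorm H2d"
  by (simp add: fun_eq_iff hnorm_def)

sublocale W: hilbert_space wspace
  by (rule hilbert_space_wspace)

lemma sq_summable_wcoeff:
  assumes s: "s \<in> S"
  shows "sq_summable wspace (wcoeff s)"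
  unfolding sq_summable_def hnorm_wspace
proof
  show "\<forall>\<alpha>. wcoeff s \<alpha> \<in> hcarrier wspace"
    using wcoeff_wandering[OF s] by simp
  show "(\<lambda>\<alpha>. (hnorm H2d (wcoeff s \<alpha>))\<^sup>2) summable_on UNIV"
  proof (rule nonneg_bdd_above_summable_on)
    show "bdd_above (sum (\<lambda>\<alpha>. (hnorm H2d (wcoeff s \<alpha>))\<^sup>2) ` {F. F \<subseteq> UNIV \<and> finite F})"
    proof (rule bdd_aboveI2)
      fix F assume "F \<in> {F :: 'd list set. F \<subseteq> UNIV \<and> finite F}"
      then obtain N where N: "F \<subseteq> {\<alpha>. length \<alpha> \<le> N}"
        using finite_subset_words by blast
      have "(\<Sum>\<alpha>\<in>F. (hnorm H2d (wcoeff s \<alpha>))\<^sup>2) \<le> (\<Sum>\<alpha> | length \<alpha> < Suc N. (hnorm H2d (wcoeff s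
          \<alpha>))\<^sup>2)"
        using N by (intro sum_mono2 finite_words_less) auto
      then show "(\<Sum>\<alpha>\<in>F. (hnorm H2d (wcoeff s \<alpha>))\<^sup>2) \<le> (hnorm H2d s)\<^sup>2"
        using wcoeff_norm[OF s, of "Suc N"] by linarith
    qed
  qed simp
qed

text \<open>Not to be confused with \<open>wcoeff\<close>: these are the scalar functionals that
  become the operator coefficients of the multiplier. They are cut off outside
  \<open>wandering\<close> to fit the convention for bounded operators.\<close>

definition wcoef :: "'d list \<Rightarrow> ('d, complex) nc_fun \<Rightarrow> complex" where
  "wcoef \<alpha> e = (if e \<in> wandering then tcoeff e \<alpha> else 0)"

abbreviation gen :: "('d list \<Rightarrow> ('d, complex) nc_fun) \<Rightarrow> 'd list \<Rightarrow> complex" where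
  "gen \<equiv> right_product_coeff wcoef"

text \<open>Each letter of \<open>\<gamma>\<close> uses the splitting once. At the empty word the
  shifted parts have coefficient 0, so the recursion closes with no limit involved.\<close>

lemma gen_wcoeff: "s \<in> S \<Longrightarrow> gen (wcoeff s) = tcoeff s"
proof
  fix \<gamma> assume "s \<in> S"
  then show "gen (wcoeff s) \<gamma> = tcoeff s \<gamma>"
  proof (induction \<gamma> arbitrary: s)
    case Nil
    then show ?case
      by (simp add: right_product_coeff_Nil wcoeff_simps wcoef_def wpart_wandering tcoeff_wpart)
  next
    case (Cons j \<gamma>)
    have "gen (wcoeff s) (j # \<gamma>) = wcoef (j # \<gamma>) (wpart s) + gen (wcoeff (pull j s)) \<gamma>"
      by (simp add: right_product_coeff_Cons wcoeff_simps)
    also have "\<dots> = tcoeff s (j # \<gamma>)"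
      using Cons.prems by (simp add: Cons.IH[OF pull(1)] tcoeff_wpart) (simp add: wcoef_def
          wpart_wandering)
    finally show ?case .
  qed
qed

lemma gen_step:
  assumes w: "\<And>\<beta>. w \<beta> \<in> wandering"
  shows "gen w \<gamma> = tcoeff (w []) \<gamma> + (\<Sum>j\<in>UNIV. shift j (gen (\<lambda>\<beta>. w (j # \<beta>))) \<gamma>)"
  by (cases \<gamma>) (auto simp: right_product_coeff_Nil right_product_coeff_Cons wcoef_def w)

lemma wandering_0: "0 \<in> wandering"
  using closed_subspace_wandering by (auto simp: closed_subspace_def H.subspace_def)

lemma wcoef_0: "wcoef \<alpha> 0 = 0"
  by (simp add: wcoef_def tcoeff_zero)

text \<open>Here \<open>gen w\<close> belongs to \<open>w [] + \<Sum> L_j t_j\<close>, where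
  \<open>t_j\<close> comes from the families starting with \<open>j\<close>. Membership in
  \<open>S\<close> is part of the induction because \<open>w []\<close> is orthogonal to the shift
  of \<open>t_j\<close> only when \<open>t_j\<close> lies in \<open>S\<close>.\<close>

lemma gen_finite:
  assumes "\<And>\<beta>. w \<beta> \<in> wandering" "\<And>\<beta>. N \<le> length \<beta> \<Longrightarrow> w \<beta> = 0"
  shows "sq_summable complex_hspace (gen w) \<and> C.synth (gen w) \<in> S \<and>
    (hnorm H2d (C.synth (gen w)))\<^sup>2 = (\<Sum>\<beta> | length \<beta> < N. (hnorm H2d (w \<beta>))\<^sup>2)"
  using assms
proof (induction N arbitrary: w)
  case 0
  then have "w \<beta> = 0" for \<beta>
    by blast
  then have w: "w = (\<lambda>_. 0)"
    by (rule ext)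
  have "gen w = tcoeff 0"
    unfolding w by (rule ext) (simp only: right_product_coeff_zero[of wcoef, OF wcoef_0]
        tcoeff_zero)
  then have z: "C.synth (gen w) = 0" "sq_summable complex_hspace (gen w)"
    using synth_tcoeff[OF H.zero_mem] tcoeff_sq_summable[OF H.zero_mem] by simp_all
  show ?case
    unfolding z(1) H.hnorm_zero by (intro conjI z(2) H.subspace_0[OF S_subspace]) simp
next
  case (Suc N)
  define t where "t j = C.synth (gen (\<lambda>\<beta>. w (j # \<beta>)))" for j
  have IH: "sq_summable complex_hspace (gen (\<lambda>\<beta>. w (j # \<beta>)))" "t j \<in> S"
    "(hnorm H2d (t j))\<^sup>2 = (\<Sum>\<beta> | length \<beta> < N. (hnorm H2d (w (j # \<beta>)))\<^sup>2)" for j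
    unfolding t_def using Suc.IH[of "\<lambda>\<beta>. w (j # \<beta>)"] Suc.prems by auto
  define y where "y = w [] + (\<Sum>j\<in>UNIV. left_shift j (t j))"
  have tH: "t j \<in> hcarrier H2d" for j
    by (rule S_mem[OF IH(2)])
  have m: "left_shift j (t j) \<in> hcarrier H2d" for j
    by (rule left_shift_mem[OF tH])
  have w0: "w [] \<in> wandering"
    by (rule Suc.prems)
  have yS: "y \<in> S"
    unfolding y_def
    by (rule H.subspace_add[OF S_subspace wandering_S[OF w0] H.subspace_sum[OF S_subspace
        invariant[OF IH(2)]]])
  have ct: "tcoeff (t j) = gen (\<lambda>\<beta>. w (j # \<beta>))" for j
    unfolding t_def by (rule C.nc_coeff_synth[OF IH(1)])
  have "tcoeff y \<gamma> = gen w \<gamma>" for \<gamma>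
    unfolding y_def
    by (subst gen_step[OF Suc.prems(1)]) (simp add: tcoeff_add wandering_mem[OF w0] H.sum_mem m
        tcoeff_sum nc_coeff_left_shift[OF tH] ct)
  then have gy: "gen w = tcoeff y"
    by auto
  have "(hnorm H2d y)\<^sup>2 = (hnorm H2d (w []))\<^sup>2 + (\<Sum>j\<in>UNIV. (hnorm H2d (t j))\<^sup>2)"
    unfolding y_def by (rule hnorm_orthogonal_shifts) (use w0 IH(2) tH wandering_mem in \<open>auto
        simp: wandering_def\<close>)
  also have "\<dots> = (\<Sum>\<beta> | length \<beta> < Suc N. (hnorm H2d (w \<beta>))\<^sup>2)"
    by (subst sum_words_less_Suc) (simp add: IH(3))
  finally show ?case
    unfolding gy using yS by (simp add: synth_tcoeff S_mem tcoeff_sq_summable)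
qed

section \<open>From square summable families in the wandering subspace into S\<close>

lemma wandering_add: "e \<in> wandering \<Longrightarrow> e' \<in> wandering \<Longrightarrow> e + e' \<in> wandering"
  and wandering_scale: "e \<in> wandering \<Longrightarrow> hscale H2d a e \<in> wandering"
  using W.add_mem[of e e'] W.scale_mem[of e a] by simp_all

lemma wcoef_add: "e \<in> wandering \<Longrightarrow> e' \<in> wandering \<Longrightarrow> wcoef \<alpha> (e + e') = wcoef \<alpha> e + wcoef \<alpha> e'"
  by (simp add: wcoef_def wandering_add tcoeff_add wandering_mem)

text \<open>This bound comes before the isometry: it shows that \<open>gen w\<close> defines an
  element of \<open>H2d\<close> at all, and it controls the tails in the limit argument.\<close>

lemma gen_norm_le:
  assumes w: "sq_summable wspace w"
  shows "sq_summable complex_hspace (gen w)"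
    "(hnorm H2d (C.synth (gen w)))\<^sup>2 \<le> (\<Sum>\<^sub>\<infinity>\<beta>. (hnorm H2d (w \<beta>))\<^sup>2)"
proof -
  have wW: "w \<beta> \<in> wandering" for \<beta>
    using sq_summable_mem[OF w] by simp
  have ws: "(\<lambda>\<beta>. (hnorm H2d (w \<beta>))\<^sup>2) summable_on UNIV"
    using w by (simp add: sq_summable_def hnorm_wspace)
  have b: "(\<Sum>\<alpha>\<in>A. (cmod (gen w \<alpha>))\<^sup>2) \<le> (\<Sum>\<^sub>\<infinity>\<beta>. (hnorm H2d (w \<beta>))\<^sup>2)" if A: "finite A" for A
  proof -
    obtain N where N: "A \<subseteq> {\<alpha>. length \<alpha> \<le> N}"
      using finite_subset_words[OF A] by blast
    \<comment> \<open>Words in \<open>A\<close> have length at most \<open>N\<close>, so cutting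
      \<open>w\<close> off beyond that length leaves the coefficients on \<open>A\<close> unchanged
      and makes the finite case applicable.\<close>
    define v where "v \<beta> = (if length \<beta> < Suc N then w \<beta> else 0)" for \<beta>
    have v: "sq_summable complex_hspace (gen v)" "C.synth (gen v) \<in> S"
      "(hnorm H2d (C.synth (gen v)))\<^sup>2 = (\<Sum>\<beta> | length \<beta> < Suc N. (hnorm H2d (v \<beta>))\<^sup>2)"
      using gen_finite[of v "Suc N"] wW wandering_0 by (auto simp: v_def)
    have "gen w \<alpha> = gen v \<alpha>" if "\<alpha> \<in> A" for \<alpha>
      using that N by (intro right_product_coeff_cong) (auto simp: v_def)
    then have "(\<Sum>\<alpha>\<in>A. (cmod (gen w \<alpha>))\<^sup>2) = (\<Sum>\<alpha>\<in>A. (cmod (gen v \<alpha>))\<^sup>2)"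
      by simp
    also have "\<dots> \<le> (hnorm H2d (C.synth (gen v)))\<^sup>2"
      using sum_le_hnorm_ell2[OF v(1) A] S_mem[OF v(2)]
          by (simp add: hnorm_H2d C.nc_coeff_synth v(1))
    also have "\<dots> = (\<Sum>\<beta> | length \<beta> < Suc N. (hnorm H2d (w \<beta>))\<^sup>2)"
      unfolding v(3) by (intro sum.cong) (auto simp: v_def)
    also have "\<dots> \<le> (\<Sum>\<^sub>\<infinity>\<beta>. (hnorm H2d (w \<beta>))\<^sup>2)"
      by (intro finite_sum_le_infsum ws finite_words_less) auto
    finally show ?thesis .
  qed
  show g: "sq_summable complex_hspace (gen w)"
    by (rule sq_summable_bounded(1)[OF b])
  show "(hnorm H2d (C.synth (gen w)))\<^sup>2 \<le> (\<Sum>\<^sub>\<infinity>\<beta>. (hnorm H2d (w \<beta>))\<^sup>2)"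
    using sq_summable_bounded(2)[OF b]
        by (simp add: hnorm_H2d C.synth_in_drury_arveson C.nc_coeff_synth g)
qed

text \<open>Truncations lie in \<open>S\<close> with squared norm \<open>m N\<close>. They converge
  to \<open>x\<close>, so \<open>S\<close> contains \<open>x\<close> and continuity of the norm
  turns \<open>m N\<close> into its limit \<open>M\<close>.\<close>

lemma gen_isometry:
  assumes w: "sq_summable wspace w"
  shows "C.synth (gen w) \<in> S"
    "(hnorm H2d (C.synth (gen w)))\<^sup>2 = (\<Sum>\<^sub>\<infinity>\<beta>. (hnorm H2d (w \<beta>))\<^sup>2)"
proof -
  have wW: "w \<beta> \<in> wandering" for \<beta>
    using sq_summable_mem[OF w] by simp
  have ws: "(\<lambda>\<beta>. (hnorm H2d (w \<beta>))\<^sup>2) summable_on UNIV"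
    using w by (simp add: sq_summable_def hnorm_wspace)
  define M where "M = (\<Sum>\<^sub>\<infinity>\<beta>. (hnorm H2d (w \<beta>))\<^sup>2)"
  define m where "m N = (\<Sum>\<beta> | length \<beta> < N. (hnorm H2d (w \<beta>))\<^sup>2)" for N
  have mM: "m \<longlonglongrightarrow> M"
    unfolding m_def M_def using filterlim_compose[OF infsum_tendsto[OF ws] words_less_filterlim] .
  define v where "v N \<beta> = (if length \<beta> < N then w \<beta> else 0)" for N \<beta>
  \<comment> \<open>The tail of \<open>w\<close>; the contractive bound applied to it estimates the
    distance from the \<open>N\<close>-th truncation to \<open>x\<close> by
    \<open>M - m N\<close>.\<close>
  define r where "r N \<beta> = (if length \<beta> < N then 0 else w \<beta>)" for N \<beta>
  have v: "sq_summable complex_hspace (gen (v N))" "C.synth (gen (v N)) \<in> S"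
    "(hnorm H2d (C.synth (gen (v N))))\<^sup>2 = m N" for N
    using gen_finite[of "v N" N] wW wandering_0 by (auto simp: v_def m_def intro!: sum.cong)
  define x where "x = C.synth (gen w)"
  have x: "x \<in> hcarrier H2d"
    unfolding x_def by (rule C.synth_in_drury_arveson[OF gen_norm_le(1)[OF w]])
  have rs: "sq_summable wspace (r N)" for N
    unfolding sq_summable_def hnorm_wspace
  proof
    show "\<forall>\<alpha>. r N \<alpha> \<in> hcarrier wspace"
      using wW wandering_0 by (simp add: r_def)
    show "(\<lambda>\<alpha>. (hnorm H2d (r N \<alpha>))\<^sup>2) summable_on UNIV"
      by (rule summable_on_comparison_test[OF ws]) (simp_all add: r_def)
  qed
  have rM: "(\<Sum>\<^sub>\<infinity>\<beta>. (hnorm H2d (r N \<beta>))\<^sup>2) = M - m N" for N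
  proof -
    have s: "(\<lambda>\<beta>. (hnorm H2d (v N \<beta>))\<^sup>2) summable_on UNIV" "(\<lambda>\<beta>. (hnorm H2d (r N \<beta>))\<^sup>2)
        summable_on UNIV"
      by (auto simp: r_def v_def intro!: summable_on_comparison_test[OF ws])
    have "M = (\<Sum>\<^sub>\<infinity>\<beta>. (hnorm H2d (v N \<beta>))\<^sup>2 + (hnorm H2d (r N \<beta>))\<^sup>2)"
      unfolding M_def by (intro infsum_cong) (auto simp: r_def v_def)
    also have "\<dots> = (\<Sum>\<^sub>\<infinity>\<beta>. (hnorm H2d (v N \<beta>))\<^sup>2) + (\<Sum>\<^sub>\<infinity>\<beta>. (hnorm H2d (r N \<beta>))\<^sup>2)"
      by (rule infsum_add[OF s])
    also have "(\<Sum>\<^sub>\<infinity>\<beta>. (hnorm H2d (v N \<beta>))\<^sup>2) = (\<Sum>\<^sub>\<infinity>\<beta>\<in>{\<beta>. length \<beta> < N}. (hnorm H2d (w \<beta>))\<^sup>2)"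
      by (rule infsum_cong_neutral) (auto simp: v_def)
    also have "\<dots> = m N"
      by (simp add: m_def finite_words_less)
    finally show ?thesis
      by simp
  qed
  have diff: "C.synth (gen (v N)) + C.synth (gen (r N)) = x" for N
  proof -
    have "wcoef \<alpha> (w \<beta>) = wcoef \<alpha> (v N \<beta>) + wcoef \<alpha> (r N \<beta>)" for \<alpha> \<beta>
      by (simp add: v_def r_def wcoef_0)
    then have "gen w = (\<lambda>\<gamma>. gen (v N) \<gamma> + gen (r N) \<gamma>)"
      by (simp add: fun_eq_iff right_product_coeff_def case_prod_unfold sum.distrib)
    then show ?thesis
      unfolding x_def using C.synth_add[OF v(1) gen_norm_le(1)[OF rs], of N N] by simp
  qed
  have "(hnorm H2d (C.synth (gen (v N)) - x))\<^sup>2 \<le> M - m N" for N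
  proof -
    have "C.synth (gen (v N)) - x = - C.synth (gen (r N))"
      using diff[of N] by (metis add_diff_cancel_left' minus_diff_eq)
    then show ?thesis
      using gen_norm_le(2)[OF rs, of N] C.synth_in_drury_arveson[OF gen_norm_le(1)[OF rs], of N]
      by (simp add: H.hnorm_minus rM)
  qed
  moreover have "(\<lambda>N. M - m N) \<longlonglongrightarrow> 0"
    using tendsto_diff[OF tendsto_const mM, of M] by simp
  ultimately have "(\<lambda>N. (hnorm H2d (C.synth (gen (v N)) - x))\<^sup>2) \<longlonglongrightarrow> 0"
    using tendsto_sandwich[of "\<lambda>_. 0" _ sequentially "\<lambda>N. M - m N"] by simp
  then have lim: "(\<lambda>N. hnorm H2d (C.synth (gen (v N)) - x)) \<longlonglongrightarrow> 0"
    by simp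
  show "C.synth (gen w) \<in> S"
    using S_limit[OF v(2) x lim] by (simp add: x_def)
  have "(\<lambda>N. (hnorm H2d (C.synth (gen (v N))))\<^sup>2) \<longlonglongrightarrow> (hnorm H2d x)\<^sup>2"
    by (intro tendsto_power H.hnorm_lim S_mem v x lim)
  then show "(hnorm H2d (C.synth (gen w)))\<^sup>2 = (\<Sum>\<^sub>\<infinity>\<beta>. (hnorm H2d (w \<beta>))\<^sup>2)"
    using LIMSEQ_unique[OF _ mM] unfolding v(3) x_def M_def by blast
qed

end

section \<open>The multiplier attached to the wandering subspace\<close>

text \<open>An entry of the value at \<open>Z\<close> is the \<open>ell2\<close> inner product of
  the coefficients with the conjugated entries of the word products: the reproducing kernel
  property, entry by entry.\<close>

lemma point_evaluation_bounded:
  assumes Z: "Z \<in> nc_ball n" "i < n" "j < n"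
  shows "\<exists>K. \<forall>e\<in>hcarrier H2d. cmod (e Z i j) \<le> K * hnorm H2d e"
proof (intro exI ballI)
  fix e :: "('a, complex) nc_fun" assume e: "e \<in> hcarrier H2d"
  let ?a = "\<lambda>\<alpha>. cnj (word_mat n Z \<alpha> $$ (i, j))"
  have a: "sq_summable complex_hspace ?a"
    using nc_ball_words_summable[OF Z] by (simp add: sq_summable_complex)
  have "((\<lambda>\<alpha>. word_mat n Z \<alpha> $$ (i, j) * tcoeff e \<alpha>) has_sum e Z i j) UNIV"
    using C.synth_hsum[OF tcoeff_sq_summable[OF e] Z] by (simp add: hsum_complex synth_tcoeff[OF e])
  then have "e Z i j = hinner ell2 (tcoeff e) ?a"
    by (simp add: ell2_def infsumI mult.commute)
  then show "cmod (e Z i j) \<le> hnorm ell2 ?a * hnorm H2d e"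
    using L.hnorm_cauchy_schwarz[of "tcoeff e" ?a] a tcoeff_sq_summable[OF e]
    by (simp add: hnorm_H2d[OF e] ell2_def mult.commute)
qed

context shift_invariant
begin

definition wmult :: "('d, ('d, complex) nc_fun \<Rightarrow> complex) nc_fun" where
  "wmult Z i j e = (if e \<in> wandering then e Z i j else 0)"

lemma wandering_nc_function: "e \<in> wandering \<Longrightarrow> nc_function (*) UNIV e"
  using wandering_mem[of e] by (simp add: drury_arveson_simps)

lemma wmult_bounded: "wmult Z i j \<in> bounded_ops wspace complex_hspace"
proof -
  have "\<exists>K. \<forall>e\<in>wandering. cmod (e Z i j) \<le> K * hnorm H2d e"
  proof (cases "\<exists>n. Z \<in> nc_ball n \<and> i < n \<and> j < n")
    case True
    then show ?thesis
      using point_evaluation_bounded[of Z _ i j] wandering_mem by meson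
  next
    case False
    have "e Z i j = 0" if e: "e \<in> wandering" for e
      using False wandering_nc_function[OF e]
      by (cases "Z \<in> (\<Union>n. nc_ball n)") (auto simp: nc_function_def nmat_def)
    then show ?thesis
      by (intro exI[of _ 0]) simp
  qed
  then show ?thesis
    by (simp add: bounded_ops_def wmult_def hnorm_wspace wandering_add wandering_scale
        drury_arveson_simps[where E = complex_hspace]
        wandering_scale[unfolded drury_arveson_simps hscale_complex])
qed

lemma wcoef_bounded: "wcoef \<alpha> \<in> bounded_ops wspace complex_hspace"
proof -
  have "\<exists>K. \<forall>e\<in>wandering. cmod (tcoeff e \<alpha>) \<le> K * hnorm H2d e"
    by (intro exI[of _ 1]) (simp add: tcoeff_le_hnorm wandering_mem)
  then show ?thesis
    by (simp add: bounded_ops_def wcoef_add wandering_add wandering_scale hnorm_wspace)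
      (simp add: wcoef_def wandering_scale tcoeff_scale wandering_mem)
qed

text \<open>Applied to a fixed \<open>e\<close> in \<open>wandering\<close>, every requirement
  becomes the same requirement on the nc function \<open>e\<close>; other arguments give 0 on both
  sides.\<close>

lemma wmult_nc_function: "nc_function (op_scale complex_hspace) (bounded_ops wspace
    complex_hspace) wmult"
  unfolding nc_function_def
proof (intro conjI allI ballI impI)
  note nc = wandering_nc_function[unfolded nc_function_def]
  show "wmult X = 0" if "X \<notin> (\<Union>n. nc_ball n)" for X
    using nc that by (simp add: fun_eq_iff wmult_def)
  fix n and X :: "'d \<Rightarrow> complex mat" assume X: "X \<in> nc_ball n"
  have "e X i j = 0" if "e \<in> wandering" "\<not> (i < n \<and> j < n)" for e i j
    using nc[OF that(1)] that(2) X by (simp add: nmat_def)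
  then show "wmult X \<in> nmat n (bounded_ops wspace complex_hspace)"
    by (simp add: nmat_def wmult_bounded) (auto simp: fun_eq_iff wmult_def)
  show "wmult (direct_sum n m X Y) = nmat_sum n (wmult X) (wmult Y)" if Y: "Y \<in> nc_ball m" for m Y
  proof (intro ext)
    fix i j e
    have "e (direct_sum n m X Y) = nmat_sum n (e X) (e Y)" if "e \<in> wandering"
      using nc[OF that] X Y by blast
    then show "wmult (direct_sum n m X Y) i j e = nmat_sum n (wmult X) (wmult Y) i j e"
      by (simp add: wmult_def nmat_sum_def)
  qed
  show "wmult (\<lambda>j. S' * X j * T) = rmult (op_scale complex_hspace) (lmult (op_scale
      complex_hspace) S' (wmult X)) T"
    if T: "T \<in> carrier_mat n n" and S': "S' \<in> carrier_mat n n"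
      and inv: "T * S' = 1\<^sub>m n \<and> S' * T = 1\<^sub>m n \<and> (\<lambda>j. S' * X j * T) \<in> nc_ball n" for T S'
  proof (intro ext)
    fix i j e
    have "e (\<lambda>j. S' * X j * T) = rmult (*) (lmult (*) S' (e X)) T" if "e \<in> wandering"
      using nc[OF that] X T S' inv by blast
    then show "wmult (\<lambda>j. S' * X j * T) i j e
        = rmult (op_scale complex_hspace) (lmult (op_scale complex_hspace) S' (wmult X)) T i j e"
      by (auto simp: wmult_def rmult_def lmult_def op_scale_def sum_fun_apply intro!: sum.cong)
  qed
qed

text \<open>For a fixed wandering vector the series is its own expansion, which converges unordered;
  the sets of words of bounded length are cofinal among the finite sets.\<close>

lemma multiplier_series_wmult: "multiplier_series wspace complex_hspace wcoef wmult"
  unfolding multiplier_series_def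
proof (intro conjI allI ballI impI)
  show "wcoef \<alpha> \<in> bounded_ops wspace complex_hspace" for \<alpha>
    by (rule wcoef_bounded)
  fix n i j e and Z :: "'d \<Rightarrow> complex mat"
  assume Z: "Z \<in> nc_ball n" "i < n" "j < n" and "e \<in> hcarrier wspace"
  then have e: "e \<in> wandering"
    by simp
  have "C.hsum (\<lambda>\<alpha>. word_mat n Z \<alpha> $$ (i, j)) (tcoeff e) (e Z i j)"
    using C.synth_hsum[OF tcoeff_sq_summable[OF wandering_mem[OF e]] Z]
        by (simp add: synth_tcoeff wandering_mem e)
  then have "((\<lambda>A. hnorm complex_hspace ((\<Sum>\<alpha>\<in>A. hscale complex_hspace (word_mat n Z \<alpha> $$ (i, j))
      (wcoef \<alpha> e)) - wmult Z i j e)) \<longlongrightarrow> 0)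
      (finite_subsets_at_top UNIV)"
    using e by (simp add: C.hsum_def wcoef_def wmult_def)
  then show "(\<lambda>N. hnorm complex_hspace ((\<Sum>\<alpha> | length \<alpha> \<le> N. hscale complex_hspace (word_mat n Z \<alpha>
      $$ (i, j)) (wcoef \<alpha> e))
      - wmult Z i j e)) \<longlonglongrightarrow> 0"
    by (rule filterlim_compose[OF _ words_le_filterlim])
qed

lemma wmult_op:
  assumes f: "f \<in> hcarrier (drury_arveson wspace)"
  shows "is_right_product wspace complex_hspace wmult f (C.synth (gen (nc_coeff wspace f)))"
    and "right_mult_op wspace complex_hspace wmult f = C.synth (gen (nc_coeff wspace f))"
  using gen_norm_le(1)[OF W.drury_arveson_coeff(1)[OF f]] right_mult_op_eq[OF f, of wmult]
  by (simp_all add: is_right_product_iff multiplier_coeff_eqI[OF multiplier_series_wmult])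

lemma wmult_MultR: "wmult \<in> MultR wspace complex_hspace"
  using wmult_nc_function multiplier_series_wmult wmult_op(1) by (auto simp: MultR_def)

lemma wmult_isometry:
  assumes f: "f \<in> hcarrier (drury_arveson wspace)"
  shows "right_mult_op wspace complex_hspace wmult f \<in> S"
    and "hnorm H2d (right_mult_op wspace complex_hspace wmult f) = hnorm (drury_arveson wspace) f"
proof -
  let ?w = "nc_coeff wspace f"
  have w: "sq_summable wspace ?w"
    by (rule W.drury_arveson_coeff(1)[OF f])
  show S: "right_mult_op wspace complex_hspace wmult f \<in> S"
    unfolding wmult_op(2)[OF f] by (rule gen_isometry(1)[OF w])
  have "(hnorm H2d (right_mult_op wspace complex_hspace wmult f))\<^sup>2 = (\<Sum>\<^sub>\<infinity>\<beta>. (hnorm H2d (?w \<beta>))\<^sup>2)"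
    unfolding wmult_op(2)[OF f] by (rule gen_isometry(2)[OF w])
  then show "hnorm H2d (right_mult_op wspace complex_hspace wmult f)
      = hnorm (drury_arveson wspace) f"
    unfolding W.hnorm_drury_arveson[OF f] hnorm_wspace
    using H.hnorm_nonneg[OF S_mem[OF S]] by (metis real_sqrt_unique)
qed

text \<open>The preimage of \<open>s\<close> is the function whose coefficients are
  \<open>wcoeff s\<close>.\<close>

lemma wmult_range: "right_mult_op wspace complex_hspace wmult ` hcarrier (drury_arveson wspace) = S"
proof
  show "right_mult_op wspace complex_hspace wmult ` hcarrier (drury_arveson wspace) \<subseteq> S"
    using wmult_isometry(1) by blast
  show "S \<subseteq> right_mult_op wspace complex_hspace wmult ` hcarrier (drury_arveson wspace)"
  proof
    fix s assume s: "s \<in> S"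
    note w = sq_summable_wcoeff[OF s]
    have "right_mult_op wspace complex_hspace wmult (W.synth (wcoeff s)) = s"
      using wmult_op(2)[OF W.synth_in_drury_arveson[OF w]]
      by (simp add: W.nc_coeff_synth[OF w] gen_wcoeff[OF s] synth_tcoeff[OF S_mem[OF s]])
    then show "s \<in> right_mult_op wspace complex_hspace wmult ` hcarrier (drury_arveson wspace)"
      using W.synth_in_drury_arveson[OF w] by (metis imageI)
  qed
qed

section \<open>Linearity and boundedness of the multiplication operator\<close>

lemma gen_add:
  assumes "\<And>\<beta>. c \<beta> \<in> wandering" "\<And>\<beta>. d \<beta> \<in> wandering"
  shows "gen (\<lambda>\<beta>. c \<beta> + d \<beta>) = (\<lambda>\<gamma>. gen c \<gamma> + gen d \<gamma>)"
  using right_product_coeff_add[of wcoef c d] assms by (simp add: fun_eq_iff wcoef_add)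

lemma gen_scale:
  assumes "\<And>\<beta>. c \<beta> \<in> wandering"
  shows "gen (\<lambda>\<beta>. hscale H2d a (c \<beta>)) = (\<lambda>\<gamma>. a * gen c \<gamma>)"
proof -
  have "wcoef \<alpha> (hscale H2d a (c \<beta>)) = a * wcoef \<alpha> (c \<beta>)" for \<alpha> \<beta>
    using assms[of \<beta>] by (simp add: wcoef_def wandering_scale tcoeff_scale wandering_mem)
  then show ?thesis
    by (simp add: fun_eq_iff right_product_coeff_def case_prod_unfold sum_distrib_left)
qed

lemma wmult_op_bounded: "right_mult_op wspace complex_hspace wmult \<in> bounded_ops (drury_arveson
    wspace) H2d"
proof -
  let ?T = "right_mult_op wspace complex_hspace wmult"
  have mem: "nc_coeff wspace f \<beta> \<in> wandering" if "f \<in> hcarrier (drury_arveson wspace)" for f \<beta>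
    using sq_summable_mem[OF W.drury_arveson_coeff(1)[OF that]] by simp
  have add: "?T (f + g) = ?T f + ?T g"
    if f: "f \<in> hcarrier (drury_arveson wspace)" and g: "g \<in> hcarrier (drury_arveson wspace)" for f g
    using C.synth_add[OF gen_norm_le(1) gen_norm_le(1), OF W.drury_arveson_coeff(1)
        W.drury_arveson_coeff(1), OF f g]
    by (simp add: wmult_op(2) f g W.nc_coeff_add gen_add mem)
  have scale: "?T (hscale (drury_arveson wspace) a f) = hscale H2d a (?T f)"
    if f: "f \<in> hcarrier (drury_arveson wspace)" for f a
    using C.synth_scale[OF gen_norm_le(1), OF W.drury_arveson_coeff(1), OF f, of a] gen_scale[of
        "nc_coeff wspace f" a] mem[OF f]
    by (simp add: wmult_op(2) f W.nc_coeff_scale)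
  show ?thesis
    unfolding bounded_ops_def mem_Collect_eq
  proof (intro conjI allI ballI impI)
    show "?T f = 0" if "f \<notin> hcarrier (drury_arveson wspace)" for f
      using that by (simp add: right_mult_op_def)
    show "\<exists>K. \<forall>f\<in>hcarrier (drury_arveson wspace). hnorm H2d (?T f)
        \<le> K * hnorm (drury_arveson wspace) f"
      by (rule exI[of _ 1]) (simp add: wmult_isometry(2))
  qed (use add scale wmult_isometry(1) S_mem in auto)
qed

text \<open>The norm is preserved on the whole carrier, hence in particular on the vectors
  orthogonal to the kernel.\<close>

theorem is_partial_isometric_range_wmult: "is_partial_isometric_range wspace wmult S"
  unfolding is_partial_isometric_range_def partial_isometry_def
  using wmult_MultR wmult_op_bounded wmult_range wmult_isometry(2) by auto

end

theorem theorem6p4: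
  fixes S :: "('d::finite, complex) nc_fun set"
  assumes "closed_subspace H2d S" and "S \<noteq> {0}"
  shows "((\<forall>i. left_shift i ` S \<subseteq> S) \<longleftrightarrow>
            (\<exists>(E :: ('d, complex) nc_fun hspace) \<Psi>.
               hilbert_space E \<and> is_partial_isometric_range E \<Psi> S)) \<and>
         (\<forall>(E :: 'e::ab_group_add hspace) \<Psi>.
               hilbert_space E \<and> is_partial_isometric_range E \<Psi> S
               \<longrightarrow> (\<forall>i. left_shift i ` S \<subseteq> S))"
proof (intro conjI iffI allI impI)
  assume "\<forall>i. left_shift i ` S \<subseteq> S"
  then interpret shift_invariant S
    using assms(1) by unfold_locales auto
  show "\<exists>(E :: ('d, complex) nc_fun hspace) \<Psi>. hilbert_space E \<and> is_partial_isometric_range E \<Psi> S"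
    using hilbert_space_wspace is_partial_isometric_range_wmult by blast
qed (use partial_isometric_range_invariant in blast)+

end
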